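(* Let $m>0$. Assume there exist $a,b\in\mathbb{R}$ satisfying $0\le b-a<\frac{\pi}{2}$ such that $Z_1(0),Z_1(1)\in C_{[a,b]}$ and $Z_2(0),Z_2(1)\in C_{[a,b]}^+$. Assume further that $|Z_i(0)|+|Z_i(1)|\neq 0$ for $i=1,2$. Let $Z=(Z_1,Z_2)\in H^1([0,1],\mathbb{C}^2)$ be a minimizer of the action $\mathcal{A}$ connecting the two fixed ends $Z(0)$ and $Z(1)$. Then $Z_1(t)\in C_{[a,b]}$ and $Z_2(t)\in C_{[a,b]}^+$ for all $t\in[0,1]$, and they satisfy one of the following two cases: (a) both $Z_1(t)$ and $Z_2(t)$ are away from the boundaries of the corresponding closed cones for all $t\in(0,1)$; (b) both $Z_1(t)$ and $Z_2(t)$ are on the boundaries of the corresponding closed cones for all $t\in[0,1]$, and they do not reach the origin for $t\in(0,1)$. The same conclusion holds with $C_{[a,b]}^+$ replaced by $C_{[a,b]}^-$ throughout, if $Z_2(0),Z_2(1)\in C_{[a,b]}^-$.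
   Context: Planar three-body problem with masses $(1,m,m)$, $m>0$, positions $q_1,q_2,q_3\in\mathbb{C}$ and center of mass at the origin. The Jacobi coordinates are $Z_1=q_3-q_2$, $Z_2=q_1-\frac{q_2+q_3}{2}=(1+\frac{1}{2m})q_1$. The kinetic energy and potential are $$K=\frac m4|\dot Z_1|^2+\frac{m}{2m+1}|\dot Z_2|^2,\qquad U=\frac{m^2}{|Z_1|}+\frac{m}{|\frac12Z_1+Z_2|}+\frac{m}{|\frac12 Z_1-Z_2|},$$ and the action is $\mathcal{A}(Z)=\int_0^1(K+U)\,dt$. A minimizer connecting the fixed ends $Z(0),Z(1)\in\mathbb{C}^2$ is a $Z$ in $P(Z(0),Z(1))=\{\widehat Z\in H^1([0,1],\mathbb{C}^2): \widehat Z(0)=Z(0),\ \widehat Z(1)=Z(1)\}$ with $\mathcal{A}(Z)=\inf_{P(Z(0),Z(1))}\mathcal{A}$. For $a\le b$ the closed cones are $$C_{[a,b]}=\{re^{i\theta}\in\mathbb{C}: r\ge0,\ \theta\in[a,b]\},\quad C^+_{[a,b]}=\{re^{i\theta}: r\ge 0,\ \theta\in[a+\tfrac\pi2,b+\tfrac\pi2]\},\quad C^-_{[a,b]}=\{re^{i\theta}: r\ge 0,\ \theta\in[a-\tfrac\pi2,b-\tfrac\pi2]\}.$$ The boundary of such a cone consists of its two extreme rays (including the origin); if $a=b$ the cone is a single ray and equals its boundary. *)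

theory Defs
  imports "HOL-Analysis.Analysis"
begin

section \<open>The Sobolev space of paths on the unit interval\<close>

text \<open>
  In one dimension an element of \<open>H\<^sup>1([0,1])\<close> is identified with its continuous representative,
  that is, with a primitive of an \<open>L\<^sup>2\<close> function, its weak derivative. Only the values on
  \<open>[0,1]\<close> matter.
\<close>

definition has_L2_derivative :: "(real \<Rightarrow> 'a::euclidean_space) \<Rightarrow> (real \<Rightarrow> 'a) \<Rightarrow> bool" where
  "has_L2_derivative Z g \<longleftrightarrow>
     set_borel_measurable lborel {0..1} g \<and>
     set_integrable lborel {0..1} (\<lambda>t. (norm (g t))\<^sup>2) \<and>
     (\<forall>t\<in>{0..1}. Z t = Z 0 + (LINT s:{0..t}|lborel. g s))"

definition H1 :: "(real \<Rightarrow> 'a::euclidean_space) set" where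
  "H1 = {Z. \<exists>g. has_L2_derivative Z g}"

definition weak_deriv :: "(real \<Rightarrow> 'a::euclidean_space) \<Rightarrow> real \<Rightarrow> 'a" where
  "weak_deriv Z = (SOME g. has_L2_derivative Z g)"

lemma has_L2_derivative_integrable:
  assumes "has_L2_derivative Z g"
  shows "set_integrable lborel {0..1} g"
proof (rule set_integrable_bound)
  show "set_integrable lborel {0..1} (\<lambda>t. 1 + (norm (g t))\<^sup>2)"
  proof (rule set_integral_add)
    show "set_integrable lborel {0..1} (\<lambda>t::real. 1::real)"
      by (simp add: set_integrable_def)
    show "set_integrable lborel {0..1} (\<lambda>t. (norm (g t))\<^sup>2)"
      using assms by (simp add: has_L2_derivative_def)
  qed
  show "set_borel_measurable lborel {0..1} g"
    using assms by (simp add: has_L2_derivative_def)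
  have "x \<le> 1 + x\<^sup>2" for x :: real
    using zero_le_power2[of "x - 1/2"] zero_le_power2[of "1/2 :: real"]
    unfolding power2_diff by (simp add: power_one_over)
  then have "norm (g x) \<le> norm (1 + (norm (g x))\<^sup>2)" for x
    using abs_ge_self order_trans unfolding real_norm_def by blast
  then show "AE x in lborel. x \<in> {0..1} \<longrightarrow> norm (g x) \<le> norm (1 + (norm (g x))\<^sup>2)"
    by simp
qed

lemma integral_atMost_zero_AE:
  fixes F :: "real \<Rightarrow> 'a::euclidean_space"
  assumes F: "integrable lborel F"
    and tot: "(LINT x|lborel. F x) = 0"
    and z: "\<And>t. (LINT x:{..t}|lborel. F x) = 0"
  shows "AE x in lborel. F x = 0"
proof (rule sigma_finite_measure.density_zero[OF sigma_finite_lborel F])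
  fix A :: "real set" assume "A \<in> sets lborel"
  then have A: "A \<in> sigma_sets UNIV (range (\<lambda>t::real. {..t}))"
    by (simp add: borel_eq_atMost)
  have stable: "Int_stable (range (\<lambda>t::real. {..t}))"
    by (auto simp: Int_stable_def)
  have "range (\<lambda>t::real. {..t}) \<subseteq> Pow UNIV" by simp
  from stable this A show "(LINT x:A|lborel. F x) = 0"
  proof (induction rule: sigma_sets_induct_disjoint)
    case (basic A) then show ?case using z by auto
  next
    case empty show ?case by (simp add: set_lebesgue_integral_def)
  next
    case (compl A)
    then have A: "A \<in> sets lborel" by (simp add: borel_eq_atMost)
    have "(LINT x:UNIV - A|lborel. F x)
        = (LINT x|lborel. F x - indicator A x *\<^sub>R F x)"
      unfolding set_lebesgue_integral_def
      by (rule Bochner_Integration.integral_cong) (auto simp: indicator_def)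
    also have "\<dots> = (LINT x|lborel. F x) - (LINT x:A|lborel. F x)"
      unfolding set_lebesgue_integral_def
      by (rule Bochner_Integration.integral_diff[OF F integrable_mult_indicator[OF A F]])
    finally show ?case using compl tot by simp
  next
    case (union A)
    have m: "A i \<in> sets lborel" for i
      using union(2) by (auto simp: borel_eq_atMost)
    have "(LINT x:(\<Union>i. A i)|lborel. F x) = (\<Sum>i. (LINT x:(A i)|lborel. F x))"
    proof (rule lebesgue_integral_countable_add[OF m])
      show "A i \<inter> A j = {}" if "i \<noteq> j" for i j
        using union(1) that by (auto simp: disjoint_family_on_def)
      show "set_integrable lborel (\<Union>i. A i) F"
        unfolding set_integrable_def
        by (rule integrable_mult_indicator[OF _ F]) (use m in blast)
    qed
    then show ?case using union(3) by simp
  qed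
qed

lemma has_L2_derivative_unique:
  assumes g: "has_L2_derivative Z g" and h: "has_L2_derivative Z h"
  shows "AE t in lborel. t \<in> {0..1} \<longrightarrow> g t = h t"
proof -
  define F where "F x = indicator {0..1} x *\<^sub>R (g x - h x)" for x :: real
  have gi: "set_integrable lborel {0..1} g" and hi: "set_integrable lborel {0..1} h"
    using g h by (auto intro: has_L2_derivative_integrable)
  have F: "integrable lborel F"
    using set_integral_diff(1)[OF gi hi] unfolding set_integrable_def F_def .
  have sub: "(LINT x:{0..t}|lborel. g x - h x) = 0" if "t \<in> {0..1}" for t
  proof -
    have "set_integrable lborel {0..t} g" "set_integrable lborel {0..t} h"
      using that by (auto intro: set_integrable_subset[OF gi] set_integrable_subset[OF hi])
    then have "(LINT x:{0..t}|lborel. g x - h x)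
        = (LINT x:{0..t}|lborel. g x) - (LINT x:{0..t}|lborel. h x)"
      by (rule set_integral_diff(2))
    moreover have "Z t = Z 0 + (LINT s:{0..t}|lborel. g s)" "Z t = Z 0 + (LINT s:{0..t}|lborel. h s)"
      using g h that unfolding has_L2_derivative_def by blast+
    ultimately show ?thesis by (metis add_left_cancel diff_self)
  qed
  have z: "(LINT x:{..t}|lborel. F x) = 0" for t
  proof (cases "t < 0")
    case True
    then have "(\<lambda>x. indicator {..t} x *\<^sub>R F x) = (\<lambda>x. 0)"
      by (auto simp: F_def indicator_def)
    then show ?thesis by (simp add: set_lebesgue_integral_def)
  next
    case False
    have "(LINT x:{..t}|lborel. F x) = (LINT x:{0..min t 1}|lborel. g x - h x)"
      unfolding set_lebesgue_integral_def F_def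
      by (rule Bochner_Integration.integral_cong) (auto simp: indicator_def)
    then show ?thesis using sub[of "min t 1"] False by simp
  qed
  have "(LINT x|lborel. F x) = (LINT x:{..1}|lborel. F x)"
    unfolding set_lebesgue_integral_def F_def
    by (rule Bochner_Integration.integral_cong) (auto simp: indicator_def)
  then have "AE x in lborel. F x = 0"
    using integral_atMost_zero_AE[OF F] z by simp
  then show ?thesis
    by eventually_elim (auto simp: F_def)
qed

section \<open>The action functional in Jacobi coordinates\<close>

definition kinetic :: "real \<Rightarrow> complex \<times> complex \<Rightarrow> real" where
  "kinetic m v = m / 4 * (cmod (fst v))\<^sup>2 + m / (2 * m + 1) * (cmod (snd v))\<^sup>2"

text \<open>
  Division takes place in \<^typ>\<open>ennreal\<close>, so that the potential is infinite at collisions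
  (in \<^typ>\<open>real\<close> a quotient by zero would vanish).
\<close>

definition potential :: "real \<Rightarrow> complex \<times> complex \<Rightarrow> ennreal" where
  "potential m z =
     ennreal (m\<^sup>2) / ennreal (cmod (fst z))
   + ennreal m / ennreal (cmod (fst z / 2 + snd z))
   + ennreal m / ennreal (cmod (fst z / 2 - snd z))"

text \<open>
  The Lagrangian is nonnegative, hence the action is a well-defined value in \<open>[0,\<infinity>]\<close>; paths
  with collisions are not excluded.
\<close>

definition action :: "real \<Rightarrow> (real \<Rightarrow> complex \<times> complex) \<Rightarrow> ennreal" where
  "action m Z = (\<integral>\<^sup>+t\<in>{0..1}. (ennreal (kinetic m (weak_deriv Z t)) + potential m (Z t)) \<partial>lborel)"

text \<open>The choice made by \<^const>\<open>weak_deriv\<close> does not affect the action:\<close>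

lemma action_eq:
  assumes "has_L2_derivative Z g"
  shows "action m Z = (\<integral>\<^sup>+t\<in>{0..1}. (ennreal (kinetic m (g t)) + potential m (Z t)) \<partial>lborel)"
proof -
  have "has_L2_derivative Z (weak_deriv Z)"
    unfolding weak_deriv_def by (rule someI[where P = "has_L2_derivative Z", OF assms])
  from has_L2_derivative_unique[OF this assms] show ?thesis
    unfolding action_def
    by (intro nn_integral_cong_AE, eventually_elim) (auto simp: indicator_def)
qed

definition paths :: "complex \<times> complex \<Rightarrow> complex \<times> complex \<Rightarrow> (real \<Rightarrow> complex \<times> complex) set" where
  "paths x y = {W \<in> H1. W 0 = x \<and> W 1 = y}"

definition action_minimizer :: "real \<Rightarrow> (real \<Rightarrow> complex \<times> complex) \<Rightarrow> bool" where
  "action_minimizer m Z \<longleftrightarrow>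
     Z \<in> paths (Z 0) (Z 1) \<and> action m Z = (INF W\<in>paths (Z 0) (Z 1). action m W)"

section \<open>Closed cones\<close>

definition angular_cone :: "real \<Rightarrow> real \<Rightarrow> complex set" where
  "angular_cone a b = {complex_of_real r * cis \<theta> | r \<theta>. r \<ge> 0 \<and> \<theta> \<in> {a..b}}"

text \<open>The two extreme rays; for \<open>a = b\<close> this is the whole (degenerate) cone.\<close>

definition cone_boundary :: "real \<Rightarrow> real \<Rightarrow> complex set" where
  "cone_boundary a b = {complex_of_real r * cis \<theta> | r \<theta>. r \<ge> 0 \<and> \<theta> \<in> {a, b}}"

abbreviation cone_plus :: "real \<Rightarrow> real \<Rightarrow> complex set" where
  "cone_plus a b \<equiv> angular_cone (a + pi / 2) (b + pi / 2)"

abbreviation cone_plus_boundary :: "real \<Rightarrow> real \<Rightarrow> complex set" where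
  "cone_plus_boundary a b \<equiv> cone_boundary (a + pi / 2) (b + pi / 2)"

abbreviation cone_minus :: "real \<Rightarrow> real \<Rightarrow> complex set" where
  "cone_minus a b \<equiv> angular_cone (a - pi / 2) (b - pi / 2)"

abbreviation cone_minus_boundary :: "real \<Rightarrow> real \<Rightarrow> complex set" where
  "cone_minus_boundary a b \<equiv> cone_boundary (a - pi / 2) (b - pi / 2)"

end

theory Submission
  imports Defs
begin

text \<open>
  All steps are comparison arguments for the action, so no equation of motion is needed. After a
  rotation the cones lie in a quadrant for \<open>Z\<^sub>1\<close> and in the next quadrant for \<open>Z\<^sub>2\<close>. Reflecting all four
  real coordinates into these quadrants keeps the kinetic energy and does not increase the potential,
  so the folded path is again a minimizer. Inside the quadrants some direction separates all bodies
  at once, and pushing along it removes an interior collision at a gain exceeding any multiple of the first-order cost.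
  The first variation along a coordinate axis bounds the second difference of the coordinate \<open>u\<close>
  around an instant \<open>c\<close> with \<open>u = 0\<close> by \<open>C h\<^sup>2\<close> times the maximum of \<open>u\<close> on \<open>[c - h, c + h]\<close>; as
  \<open>u \<ge> 0\<close>, it vanishes near \<open>c\<close> and hence on the whole interval, and then the strict sign of the
  force makes a coordinate of the other vector vanish too. A coordinate that is positive at one end
  thus never vanishes inside, which traps the original path in every rotated pair of quadrants
  containing the cones, that is, in the cones. The two extreme rotations give the dichotomy.
\<close>

section \<open>Calculus in the Sobolev space\<close>

text \<open>Its substitute is the pairing of the derivative of a tent function with that of the
  path: it yields a second difference and asks for no second derivative. The quadrants are chosen
  for the sign of the force. The difference between the attractions of the first body to the other
  two is governed by the inner product of the Jacobi vectors, which is there a difference of two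
  products of nonnegative coordinates. Hence the force along a coordinate \<open>u\<close> with
  partner \<open>p\<close> is at most a positive multiple of \<open>p * (u * p - w)\<close>: linear
  in \<open>u\<close> up to a term of good sign. A tent just wide enough to reach a maximum of
  \<open>u\<close> then closes the estimate. Folding alone does not locate the original path, but a
  coordinate whose absolute value has no interior zero keeps its sign. Strictness of
  \<open>b - a < pi / 2\<close> leaves an open interval of rotations that put both cones, apart from
  the origin, strictly inside the quadrants; its two end points give the half-planes bounding the
  cones.\<close>

lemma has_L2_derivativeD:
  assumes "has_L2_derivative Z g"
  shows "set_borel_measurable lborel {0..1} g"
    and "set_integrable lborel {0..1} (\<lambda>t. (norm (g t))\<^sup>2)"
    and "t \<in> {0..1} \<Longrightarrow> Z t = Z 0 + (LINT s:{0..t}|lborel. g s)"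
  using assms unfolding has_L2_derivative_def by blast+

text \<open>Passes from the set integrals of the definition to Henstock-Kurzweil integrals over
  subintervals, for which the combination and domination rules are used below.\<close>

lemma has_L2_derivative_diff:
  assumes Z: "has_L2_derivative Z g" and s: "0 \<le> s" "s \<le> t" "t \<le> 1"
  shows "Z t - Z s = integral {s..t} g" and "g integrable_on {s..t}"
    and "(\<lambda>x. norm (g x)) integrable_on {s..t}"
    and "(\<lambda>x. (norm (g x))\<^sup>2) integrable_on {s..t}"
proof -
  have gi: "set_integrable lborel {0..1} g"
    by (rule has_L2_derivative_integrable[OF Z])
  have sub: "set_integrable lborel {u..v} g" if "0 \<le> u" "v \<le> 1" for u v
    by (rule set_integrable_subset[OF gi]) (use that in auto)
  have eq: "Z u = Z 0 + integral {0..u} g" if "0 \<le> u" "u \<le> 1" for u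
  proof -
    have e: "(LINT s:{0..u}|lborel. g s) = integral {0..u} g"
      using that by (intro set_borel_integral_eq_integral(2) sub) auto
    have "Z u = Z 0 + (LINT s:{0..u}|lborel. g s)"
      by (rule has_L2_derivativeD(3)[OF Z]) (use that in simp)
    then show ?thesis unfolding e .
  qed
  show gst: "g integrable_on {s..t}"
    using s by (intro set_borel_integral_eq_integral(1) sub) auto
  have "integral {0..s} g + integral {s..t} g = integral {0..t} g"
    using s by (intro Henstock_Kurzweil_Integration.integral_combine set_borel_integral_eq_integral(1) sub) auto
  moreover have e: "Z s = Z 0 + integral {0..s} g" "Z t = Z 0 + integral {0..t} g"
    using s by (intro eq; simp)+
  ultimately show "Z t - Z s = integral {s..t} g"
    unfolding e by (metis add_diff_cancel_left add_diff_cancel_left')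
  show "(\<lambda>x. norm (g x)) integrable_on {s..t}"
    using s by (intro set_borel_integral_eq_integral(1) set_integrable_norm sub) auto
  have "set_integrable lborel {s..t} (\<lambda>x. (norm (g x))\<^sup>2)"
    by (rule set_integrable_subset[OF has_L2_derivativeD(2)[OF Z]]) (use s in auto)
  then show "(\<lambda>x. (norm (g x))\<^sup>2) integrable_on {s..t}"
    by (rule set_borel_integral_eq_integral(1))
qed

lemma has_L2_derivativeI:
  assumes m: "g \<in> borel_measurable borel"
    and i: "set_integrable lborel {0..1} (\<lambda>t. (norm (g t))\<^sup>2)"
    and e: "\<And>t. 0 \<le> t \<Longrightarrow> t \<le> 1 \<Longrightarrow> Z t = Z 0 + (LINT s:{0..t}|lborel. g s)"
  shows "has_L2_derivative Z g"
  unfolding has_L2_derivative_def set_borel_measurable_def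
proof (intro conjI ballI)
  show "(\<lambda>x. indicat_real {0..1} x *\<^sub>R g x) \<in> borel_measurable lborel"
    using m by simp
  show "set_integrable lborel {0..1} (\<lambda>t. (norm (g t))\<^sup>2)" by (rule i)
  show "Z t = Z 0 + (LINT s:{0..t}|lborel. g s)" if "t \<in> {0..1}" for t
    by (rule e) (use that in auto)
qed

lemma has_L2_derivative_norm_le:
  assumes Z: "has_L2_derivative Z g" and s: "0 \<le> s" "s \<le> t" "t \<le> 1"
  shows "norm (Z t - Z s) \<le> integral {s..t} (\<lambda>x. norm (g x))"
  unfolding has_L2_derivative_diff(1)[OF assms]
  by (intro Henstock_Kurzweil_Integration.integral_norm_bound_integral has_L2_derivative_diff[OF assms]) auto

text \<open>A square-root-free form of the Cauchy-Schwarz inequality.\<close>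

lemma has_L2_derivative_norm_le_weighted:
  assumes Z: "has_L2_derivative Z g" and s: "0 \<le> s" "s \<le> t" "t \<le> 1" and c: "c > 0"
  shows "norm (Z t - Z s) \<le> (c * integral {s..t} (\<lambda>x. (norm (g x))\<^sup>2) + (t - s) / c) / 2"
proof -
  have "norm (Z t - Z s) \<le> integral {s..t} (\<lambda>x. norm (g x))"
    by (rule has_L2_derivative_norm_le[OF Z s])
  also have "\<dots> \<le> integral {s..t} (\<lambda>x. (c/2) * (norm (g x))\<^sup>2 + 1 / (2*c))"
  proof (rule integral_le)
    show "(\<lambda>x. norm (g x)) integrable_on {s..t}" by (rule has_L2_derivative_diff[OF Z s])
    show "(\<lambda>x. (c/2) * (norm (g x))\<^sup>2 + 1 / (2*c)) integrable_on {s..t}"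
      by (intro integrable_add integrable_on_mult_right has_L2_derivative_diff[OF Z s]) auto
    fix x
    have "0 \<le> (c * norm (g x) - 1)\<^sup>2 / (2 * c)" using c by simp
    also have "\<dots> = (c/2) * (norm (g x))\<^sup>2 + 1 / (2*c) - norm (g x)"
      using c by (simp add: field_simps power2_eq_square)
    finally show "norm (g x) \<le> (c/2) * (norm (g x))\<^sup>2 + 1 / (2*c)" by simp
  qed
  also have "\<dots> = (c * integral {s..t} (\<lambda>x. (norm (g x))\<^sup>2) + (t - s) / c) / 2"
    using s c by (subst Henstock_Kurzweil_Integration.integral_add)
       (auto intro!: integrable_on_mult_right has_L2_derivative_diff[OF Z s] simp: field_simps)
  finally show ?thesis .
qed

lemma has_L2_derivative_continuous:
  assumes Z: "has_L2_derivative Z g"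
  shows "continuous_on {0..1} Z"
proof -
  have "g integrable_on {0..1}" by (rule has_L2_derivative_diff[OF Z]) auto
  then have "continuous_on {0..1} (\<lambda>t. Z 0 + integral {0..t} g)"
    by (intro continuous_intros indefinite_integral_continuous_1)
  moreover have "Z 0 + integral {0..t} g = Z t" if "t \<in> {0..1}" for t
    using has_L2_derivative_diff(1)[OF Z, of 0 t] that by (simp add: diff_eq_eq add.commute)
  ultimately show ?thesis
    by (rule continuous_on_eq)
qed

lemma has_L2_derivative_linear:
  assumes L: "bounded_linear L" and Z: "has_L2_derivative Z g"
  shows "has_L2_derivative (\<lambda>t. L (Z t)) (\<lambda>t. L (g t))"
  unfolding has_L2_derivative_def
proof (intro conjI ballI)
  interpret L: bounded_linear L by (rule L)
  have Lind: "indicator A x *\<^sub>R L (g x) = L (indicator A x *\<^sub>R g x)" for A and x :: real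
    by (simp add: L.scaleR)
  have Lm: "L \<in> borel_measurable borel"
    by (intro borel_measurable_continuous_onI L.continuous_on continuous_on_id)
  show m: "set_borel_measurable lborel {0..1} (\<lambda>t. L (g t))"
    using has_L2_derivativeD(1)[OF Z] unfolding set_borel_measurable_def Lind
    by (rule measurable_compose[OF _ Lm])
  obtain K where K: "\<And>x. norm (L x) \<le> norm x * K" using L.bounded by blast
  show "set_integrable lborel {0..1} (\<lambda>t. (norm (L (g t)))\<^sup>2)"
  proof (rule set_integrable_bound)
    show "set_integrable lborel {0..1} (\<lambda>t. K\<^sup>2 * (norm (g t))\<^sup>2)"
      by (intro set_integrable_mult_right has_L2_derivativeD[OF Z])
    have eq: "indicat_real {0..1} x *\<^sub>R (norm (L (g x)))\<^sup>2 = (norm (indicat_real {0..1} x *\<^sub>R L (g x)))\<^sup>2" for x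
      by (auto simp: indicator_def)
    show "set_borel_measurable lborel {0..1} (\<lambda>t. (norm (L (g t)))\<^sup>2)"
      unfolding set_borel_measurable_def eq
      using m[unfolded set_borel_measurable_def] by (intro borel_measurable_power measurable_compose[OF _ borel_measurable_norm])
    have "(norm (L (g x)))\<^sup>2 \<le> (norm (g x) * K)\<^sup>2" for x
      by (intro power_mono K) auto
    then show "AE x in lborel. x \<in> {0..1} \<longrightarrow> norm ((norm (L (g x)))\<^sup>2) \<le> norm (K\<^sup>2 * (norm (g x))\<^sup>2)"
      by (auto simp: power_mult_distrib mult.commute)
  qed
  fix t :: real assume t: "t \<in> {0..1}"
  have "set_integrable lborel {0..t} g"
    by (rule set_integrable_subset[OF has_L2_derivative_integrable[OF Z]]) (use t in auto)
  then have "(LINT s:{0..t}|lborel. L (g s)) = L (LINT s:{0..t}|lborel. g s)"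
    unfolding set_lebesgue_integral_def set_integrable_def Lind
    by (rule integral_bounded_linear[OF L])
  moreover have "Z t = Z 0 + (LINT s:{0..t}|lborel. g s)"
    using Z t unfolding has_L2_derivative_def by blast
  ultimately show "L (Z t) = L (Z 0) + (LINT s:{0..t}|lborel. L (g s))"
    by (metis L.add)
qed

lemma has_L2_derivative_add:
  assumes Z: "has_L2_derivative Z g" and W: "has_L2_derivative W h"
  shows "has_L2_derivative (\<lambda>t. Z t + W t) (\<lambda>t. g t + h t)"
  unfolding has_L2_derivative_def
proof (intro conjI ballI)
  show m: "set_borel_measurable lborel {0..1} (\<lambda>t. g t + h t)"
    using has_L2_derivativeD(1)[OF Z] has_L2_derivativeD(1)[OF W]
    unfolding set_borel_measurable_def scaleR_add_right by (rule borel_measurable_add)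
  show "set_integrable lborel {0..1} (\<lambda>t. (norm (g t + h t))\<^sup>2)"
  proof (rule set_integrable_bound)
    show "set_integrable lborel {0..1} (\<lambda>t. 2 * (norm (g t))\<^sup>2 + 2 * (norm (h t))\<^sup>2)"
      by (intro set_integral_add set_integrable_mult_right has_L2_derivativeD[OF Z] has_L2_derivativeD[OF W])
    have eq: "indicat_real {0..1} x *\<^sub>R (norm (g x + h x))\<^sup>2 = (norm (indicat_real {0..1} x *\<^sub>R (g x + h x)))\<^sup>2" for x
      by (auto simp: indicator_def)
    show "set_borel_measurable lborel {0..1} (\<lambda>t. (norm (g t + h t))\<^sup>2)"
      unfolding set_borel_measurable_def eq
      using m[unfolded set_borel_measurable_def] by (intro borel_measurable_power measurable_compose[OF _ borel_measurable_norm])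
    have "(norm (g x + h x))\<^sup>2 \<le> (norm (g x) + norm (h x))\<^sup>2" for x
      by (intro power_mono norm_triangle_ineq) auto
    moreover have "(norm (g x) + norm (h x))\<^sup>2 \<le> 2 * (norm (g x))\<^sup>2 + 2 * (norm (h x))\<^sup>2" for x
      using zero_le_power2[of "norm (g x) - norm (h x)"]
      by (simp add: power2_eq_square algebra_simps)
    ultimately have "(norm (g x + h x))\<^sup>2 \<le> 2 * (norm (g x))\<^sup>2 + 2 * (norm (h x))\<^sup>2" for x
      using order_trans by blast
    then show "AE x in lborel. x \<in> {0..1} \<longrightarrow>
       norm ((norm (g x + h x))\<^sup>2) \<le> norm (2 * (norm (g x))\<^sup>2 + 2 * (norm (h x))\<^sup>2)"
      by simp
  qed
  fix t :: real assume t: "t \<in> {0..1}"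
  have "set_integrable lborel {0..t} g" "set_integrable lborel {0..t} h"
    using t by (auto intro: set_integrable_subset[OF has_L2_derivative_integrable[OF Z]]
                            set_integrable_subset[OF has_L2_derivative_integrable[OF W]])
  then have "(LINT s:{0..t}|lborel. g s + h s) = (LINT s:{0..t}|lborel. g s) + (LINT s:{0..t}|lborel. h s)"
    by (rule set_integral_add)
  moreover have "Z t = Z 0 + (LINT s:{0..t}|lborel. g s)" "W t = W 0 + (LINT s:{0..t}|lborel. h s)"
    using Z W t unfolding has_L2_derivative_def by blast+
  ultimately show "Z t + W t = Z 0 + W 0 + (LINT s:{0..t}|lborel. g s + h s)"
    by (simp add: algebra_simps)
qed

lemma has_L2_derivative_const: "has_L2_derivative (\<lambda>t. c :: 'a::euclidean_space) (\<lambda>t. 0)"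
  unfolding has_L2_derivative_def set_borel_measurable_def set_integrable_def set_lebesgue_integral_def
  by simp

text \<open>The derivative may blow up at the ends, so continuity gives no integrability. The
  fundamental theorem yields Henstock-Kurzweil integrability, which for a nonnegative function is
  absolute integrability.\<close>

lemma set_integrable_FTC_nonneg:
  fixes F f :: "real \<Rightarrow> real"
  assumes F: "continuous_on {0..1} F"
    and f: "\<And>x. x \<in> {0<..<1} \<Longrightarrow> (F has_real_derivative f x) (at x)"
    and nn: "\<And>x. x \<in> {0..1} \<Longrightarrow> f x \<ge> 0" and m: "f \<in> borel_measurable borel"
  shows "set_integrable lborel {0..1} f"
    and "0 \<le> t \<Longrightarrow> t \<le> 1 \<Longrightarrow> (LINT s:{0..t}|lborel. f s) = F t - F 0"
proof -
  have I: "(f has_integral (F t - F 0)) {0..t}" if "0 \<le> t" "t \<le> 1" for t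
  proof (rule fundamental_theorem_of_calculus_interior)
    show "continuous_on {0..t} F" by (rule continuous_on_subset[OF F]) (use that in auto)
    show "(F has_vector_derivative f x) (at x)" if "x \<in> {0<..<t}" for x
      using f[of x] that \<open>t \<le> 1\<close> by (simp add: has_real_derivative_iff_has_vector_derivative)
  qed (use that in simp)
  have "f absolutely_integrable_on {0..1}"
  proof (rule nonnegative_absolutely_integrable_1)
    show "f integrable_on {0..1}" by (rule has_integral_integrable[OF I[of 1]]) simp_all
  qed (rule nn)
  then have "integrable lebesgue (\<lambda>x. indicator {0..1} x *\<^sub>R f x)"
    unfolding set_integrable_def .
  \<comment> \<open>Borel measurability of \<open>f\<close> allows the passage from the completed
    measure back to \<open>lborel\<close>.\<close>
  then show i: "set_integrable lborel {0..1} f"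
    unfolding set_integrable_def using m
    by (subst (asm) integrable_completion) auto
  assume t: "0 \<le> t" "t \<le> 1"
  have "set_integrable lborel {0..t} f"
    by (rule set_integrable_subset[OF i]) (use t in auto)
  from set_borel_integral_eq_integral(2)[OF this] I[OF t]
  show "(LINT s:{0..t}|lborel. f s) = F t - F 0"
    by (simp add: integral_unique)
qed

text \<open>The sign \<open>\<sigma>\<close> reduces a decreasing \<open>F\<close>, such as a power
  of \<open>1 - t\<close>, to the nonnegative case.\<close>

lemma has_L2_derivative_of_sign:
  fixes F f Q q :: "real \<Rightarrow> real" and \<sigma> :: real
  assumes F: "continuous_on {0..1} F"
    and f: "\<And>x. x \<in> {0<..<1} \<Longrightarrow> (F has_real_derivative f x) (at x)"
    and \<sigma>: "\<sigma> = 1 \<or> \<sigma> = -1"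
    and nn: "\<And>x. x \<in> {0..1} \<Longrightarrow> \<sigma> * f x \<ge> 0" and m: "f \<in> borel_measurable borel"
    and sq: "set_integrable lborel {0..1} (\<lambda>x. (f x)\<^sup>2)"
  shows "has_L2_derivative F f"
proof (rule has_L2_derivativeI[OF m])
  show "set_integrable lborel {0..1} (\<lambda>t. (norm (f t))\<^sup>2)" using sq by simp
  fix t :: real assume t: "0 \<le> t" "t \<le> 1"
  have ss: "\<sigma> * (\<sigma> * u) = u" for u using \<sigma> by auto
  have "(LINT s:{0..t}|lborel. \<sigma> * f s) = \<sigma> * F t - \<sigma> * F 0"
  proof (rule set_integrable_FTC_nonneg(2)[of "\<lambda>x. \<sigma> * F x" "\<lambda>x. \<sigma> * f x"])
    show "continuous_on {0..1} (\<lambda>x. \<sigma> * F x)" by (intro continuous_intros F)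
    show "((\<lambda>x. \<sigma> * F x) has_real_derivative \<sigma> * f x) (at x)" if "x \<in> {0<..<1}" for x
      by (rule DERIV_cmult[OF f[OF that]])
    show "(\<lambda>x. \<sigma> * f x) \<in> borel_measurable borel" using m by simp
  qed (use nn t in simp_all)
  then have "\<sigma> * (LINT s:{0..t}|lborel. f s) = \<sigma> * F t - \<sigma> * F 0" by simp
  then have "\<sigma> * (\<sigma> * (LINT s:{0..t}|lborel. f s)) = \<sigma> * (\<sigma> * F t - \<sigma> * F 0)" by simp
  then show "F t = F 0 + (LINT s:{0..t}|lborel. f s)"
    by (simp only: right_diff_distrib ss)
qed

text \<open>For the exponent 2/3 the squared derivative and the reciprocal of the function have the
  same order \<open>t powr (-2/3)\<close>, which is integrable at 0. So one integrability statement
  will serve both the kinetic energy and the potential.\<close>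

lemma has_L2_derivative_powr_two_thirds:
  "has_L2_derivative (\<lambda>t. t powr (2/3)) (\<lambda>t. 2/3 * t powr (-1/3))" (is ?th1)
  "has_L2_derivative (\<lambda>t. (1 - t) powr (2/3)) (\<lambda>t. - 2/3 * (1 - t) powr (-1/3))" (is ?th2)
  "set_integrable lborel {0..1} (\<lambda>t::real. t powr (-2/3))" (is ?th3)
  "set_integrable lborel {0..1} (\<lambda>t::real. (1 - t) powr (-2/3))" (is ?th4)
proof -
  have c: "continuous_on {0..1} (\<lambda>t::real. t powr a)" "continuous_on {0..1} (\<lambda>t::real. (1-t) powr a)"
    if "a > 0" for a :: real
    by (intro continuous_on_powr' continuous_intros; use that in simp)+
  have d: "((\<lambda>t::real. k * t powr a) has_real_derivative k * (a * x powr (a - 1))) (at x)"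
    "((\<lambda>t::real. k * (1 - t) powr a) has_real_derivative - k * (a * (1 - x) powr (a - 1))) (at x)"
    if "x \<in> {0<..<1}" for x k a :: real
    using that by (auto intro!: derivative_eq_intros simp: powr_diff)
  show i3: ?th3
  proof (rule set_integrable_FTC_nonneg(1))
    show "((\<lambda>t::real. 3 * t powr (1/3)) has_real_derivative x powr (-2/3)) (at x)"
      if "x \<in> {0<..<1}" for x :: real
      using d(1)[OF that, of 3 "1/3"] by simp
  qed (auto intro!: c continuous_on_mult_left)
  show i4: ?th4
  proof (rule set_integrable_FTC_nonneg(1))
    show "((\<lambda>t::real. -3 * (1 - t) powr (1/3)) has_real_derivative (1 - x) powr (-2/3)) (at x)"
      if "x \<in> {0<..<1}" for x :: real
      using d(2)[OF that, of "-3" "1/3"] by simp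
    show "continuous_on {0..1} (\<lambda>t::real. -3 * (1 - t) powr (1/3))"
      by (intro c continuous_on_mult_left) simp
  qed auto
  have sq: "(k * x powr (-1/3))\<^sup>2 = k\<^sup>2 * x powr (-2/3)" for x k :: real
    by (simp add: power2_eq_square powr_add[symmetric])
  show ?th1
  proof (rule has_L2_derivative_of_sign[where \<sigma>=1])
    show "((\<lambda>t. t powr (2/3)) has_real_derivative 2/3 * x powr (-1/3)) (at x)"
      if "x \<in> {0<..<1}" for x :: real
      using d(1)[OF that, of 1 "2/3"] by simp
    show "set_integrable lborel {0..1} (\<lambda>x::real. (2/3 * x powr (-1/3))\<^sup>2)"
      unfolding sq by (intro set_integrable_mult_right i3)
  qed (auto intro!: c)
  show ?th2
  proof (rule has_L2_derivative_of_sign[where \<sigma>="-1"])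
    show "((\<lambda>t. (1 - t) powr (2/3)) has_real_derivative - 2/3 * (1 - x) powr (-1/3)) (at x)"
      if "x \<in> {0<..<1}" for x :: real
      using d(2)[OF that, of 1 "2/3"] by simp
    show "set_integrable lborel {0..1} (\<lambda>x::real. (- 2/3 * (1 - x) powr (-1/3))\<^sup>2)"
      unfolding sq by (intro set_integrable_mult_right i4)
  qed (auto intro!: c)
qed

text \<open>Ramps are the building blocks of tents; with corner 0 the ramp is the parameter of an
  affine path.\<close>

lemma has_L2_derivative_ramp:
  fixes c :: real
  assumes "0 \<le> c"
  shows "has_L2_derivative (\<lambda>t. max 0 (t - c)) (\<lambda>t. indicator {c..} t)"
proof (rule has_L2_derivativeI)
  show "indicat_real {c..} \<in> borel_measurable borel" by simp
  have "(norm (indicat_real {c..} t))\<^sup>2 = indicat_real {c..} t" for t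
    by (auto simp: indicator_def)
  moreover have "integrable lborel (\<lambda>x. indicat_real {max 0 c..1} x)"
    by (intro integrable_real_indicator) (auto simp: emeasure_lborel_Icc_eq)
  moreover have "(\<lambda>x. indicat_real {max 0 c..1} x) = (\<lambda>x. indicat_real {0..1} x *\<^sub>R indicat_real {c..} x)"
    by (auto simp: indicator_def fun_eq_iff)
  ultimately show "set_integrable lborel {0..1} (\<lambda>t. (norm (indicat_real {c..} t))\<^sup>2)"
    by (simp add: set_integrable_def)
  fix t :: real assume "0 \<le> t" "t \<le> 1"
  have "(LINT s:{0..t}|lborel. indicat_real {c..} s) = (LINT s|lborel. indicat_real {c..t} s)"
    unfolding set_lebesgue_integral_def using assms
    by (intro Bochner_Integration.integral_cong) (auto simp: indicator_def)
  then show "max 0 (t - c) = max 0 (0 - c) + (LINT s:{0..t}|lborel. indicat_real {c..} s)"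
    using assms by (cases "c \<le> t") (auto simp: max_def)
qed

section \<open>Chain rule and absolute value for H^1 functions\<close>

lemma constant_if_increment_le_square:
  fixes D H :: "real \<Rightarrow> real"
  assumes ab: "a \<le> b" and H: "continuous_on {a..b} H"
    and mono: "\<And>s t. a \<le> s \<Longrightarrow> s \<le> t \<Longrightarrow> t \<le> b \<Longrightarrow> H s \<le> H t"
    and D: "\<And>s t. a \<le> s \<Longrightarrow> s \<le> t \<Longrightarrow> t \<le> b \<Longrightarrow> \<bar>D t - D s\<bar> \<le> (H t - H s)\<^sup>2"
  shows "D b = D a"
proof -
  \<comment> \<open>Over a partition the squared increments of \<open>H\<close> add up to at most
    the largest increment times \<open>H b - H a\<close>; uniform continuity makes the largest
    increment smaller than \<open>e\<close>.\<close>
  have "\<bar>D b - D a\<bar> \<le> e * (H b - H a)" if e: "e > 0" for e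
  proof -
    have "uniformly_continuous_on {a..b} H"
      by (rule compact_uniformly_continuous[OF H]) simp
    then obtain d where d: "d > 0" and du: "\<And>x y. x \<in> {a..b} \<Longrightarrow> y \<in> {a..b} \<Longrightarrow> dist y x < d \<Longrightarrow> dist (H y) (H x) < e"
      using e unfolding uniformly_continuous_on_def by metis
    obtain n :: nat where n: "(b - a) / d < real n" using reals_Archimedean2 by blast
    then have n0: "n > 0" using ab d by (metis divide_nonneg_pos diff_ge_0_iff_ge gr0I not_less of_nat_0)
    define x where "x i = a + real i * ((b - a) / real n)" for i :: nat
    have st: "(b - a) / real n < d" "0 \<le> (b - a) / real n"
      using n d n0 ab by (auto simp: field_simps)
    have xi: "a \<le> x i" for i
      using mult_nonneg_nonneg[OF of_nat_0_le_iff st(2), of i] by (simp add: x_def)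
    have xb: "x i \<le> b" if "i \<le> n" for i
    proof -
      have "real i * ((b - a) / real n) \<le> real n * ((b - a) / real n)"
        using that st by (intro mult_right_mono) auto
      then show ?thesis using n0 by (simp add: x_def)
    qed
    have xs: "x (Suc i) - x i = (b - a) / real n" for i
      unfolding x_def of_nat_Suc distrib_right by simp
    have "\<bar>D (x i) - D a\<bar> \<le> e * (H (x i) - H a)" if "i \<le> n" for i
      using that
    proof (induction i)
      case 0 show ?case by (simp add: x_def)
    next
      case (Suc i)
      have le: "x i \<le> x (Suc i)" using xs[of i] st by linarith
      have b: "x (Suc i) \<le> b" "x i \<le> b" using Suc.prems by (auto intro: xb)
      have h: "0 \<le> H (x (Suc i)) - H (x i)" using mono[OF xi le b(1)] by simp
      have "dist (H (x (Suc i))) (H (x i)) < e"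
        by (rule du) (use xi b xs[of i] st in \<open>auto simp: dist_real_def\<close>)
      then have "(H (x (Suc i)) - H (x i))\<^sup>2 \<le> e * (H (x (Suc i)) - H (x i))"
        unfolding power2_eq_square using h by (intro mult_right_mono) (auto simp: dist_real_def)
      moreover have "\<bar>D (x (Suc i)) - D (x i)\<bar> \<le> (H (x (Suc i)) - H (x i))\<^sup>2"
        by (rule D[OF xi le b(1)])
      moreover have "\<bar>D (x i) - D a\<bar> \<le> e * (H (x i) - H a)" using Suc by simp
      ultimately show ?case by (simp add: algebra_simps)
    qed
    from this[of n] n0 show ?thesis by (simp add: x_def)
  qed
  note * = this
  have "0 \<le> H b - H a" using mono[of a b] ab by simp
  have "\<bar>D b - D a\<bar> \<le> 0"
  proof (rule field_le_epsilon)
    fix e :: real assume e: "e > 0"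
    \<comment> \<open>The summand 1 in the denominator covers the case
      \<open>H b = H a\<close>.\<close>
    have "\<bar>D b - D a\<bar> \<le> e / (H b - H a + 1) * (H b - H a)"
      by (rule *) (use \<open>0 \<le> H b - H a\<close> e in auto)
    also have "\<dots> \<le> 0 + e" using \<open>0 \<le> H b - H a\<close> e by (simp add: field_simps)
    finally show "\<bar>D b - D a\<bar> \<le> 0 + e" .
  qed
  then show ?thesis by simp
qed

lemma
  fixes u g \<psi> :: "real \<Rightarrow> real"
  assumes Z: "has_L2_derivative u g" and \<psi>: "\<psi> \<in> borel_measurable borel" "\<And>x. \<bar>\<psi> x\<bar> \<le> 1"
  shows set_measurable_comp_mult_L2: "set_borel_measurable lborel {0..1} (\<lambda>t. \<psi> (u t) * g t)"
    and set_integrable_comp_mult_L2: "set_integrable lborel {0..1} (\<lambda>t. \<psi> (u t) * g t)"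
    and set_integrable_comp_mult_L2_sq: "set_integrable lborel {0..1} (\<lambda>t. (norm (\<psi> (u t) * g t))\<^sup>2)"
proof -
  have "(\<lambda>t. indicator {0..1} t *\<^sub>R u t) \<in> borel_measurable borel"
    by (intro borel_measurable_continuous_on_indicator has_L2_derivative_continuous[OF Z]) simp
  then have "(\<lambda>t. \<psi> (indicator {0..1} t *\<^sub>R u t)) \<in> borel_measurable lborel"
    by (intro measurable_compose[OF _ \<psi>(1)]) simp
  \<comment> \<open>Only the values on [0,1] are controlled, so both functions are cut off first.
    Outside, the cut-off leaves \<open>\<psi> 0\<close>, which is annihilated by the vanishing
    second factor.\<close>
  then have m: "(\<lambda>t. \<psi> (indicator {0..1} t *\<^sub>R u t) * (indicator {0..1} t *\<^sub>R g t)) \<in> borel_measurable lborel"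
    using has_L2_derivativeD(1)[OF Z] unfolding set_borel_measurable_def by (rule borel_measurable_times)
  have e: "\<psi> (indicator {0..1} t *\<^sub>R u t) * (indicator {0..1} t *\<^sub>R g t) = indicator {0..1} t *\<^sub>R (\<psi> (u t) * g t)" for t
    by (auto simp: indicator_def)
  show 1: "set_borel_measurable lborel {0..1} (\<lambda>t. \<psi> (u t) * g t)"
    using m unfolding set_borel_measurable_def e .
  have le: "\<bar>\<psi> (u t) * g t\<bar> \<le> \<bar>g t\<bar>" for t
    unfolding abs_mult using mult_right_mono[OF \<psi>(2), of "\<bar>g t\<bar>" "u t"] by simp
  show "set_integrable lborel {0..1} (\<lambda>t. \<psi> (u t) * g t)"
    by (rule set_integrable_bound[OF has_L2_derivative_integrable[OF Z] 1]) (use le in simp)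
  show "set_integrable lborel {0..1} (\<lambda>t. (norm (\<psi> (u t) * g t))\<^sup>2)"
  proof (rule set_integrable_bound[OF has_L2_derivativeD(2)[OF Z]])
    have e2: "indicat_real {0..1} t *\<^sub>R (norm (\<psi> (u t) * g t))\<^sup>2 = (indicator {0..1} t *\<^sub>R (\<psi> (u t) * g t))\<^sup>2" for t
      by (auto simp: indicator_def)
    show "set_borel_measurable lborel {0..1} (\<lambda>t. (norm (\<psi> (u t) * g t))\<^sup>2)"
      using 1 unfolding set_borel_measurable_def e2 by (rule borel_measurable_power)
    show "AE x in lborel. x \<in> {0..1} \<longrightarrow> norm ((norm (\<psi> (u x) * g x))\<^sup>2) \<le> norm ((norm (g x))\<^sup>2)"
      using le by (auto simp: abs_le_square_iff)
  qed
qed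

text \<open>On [r,s] both the increment of \<open>\<phi> (u x)\<close> and the integral of
  \<open>\<phi>' (u x) * g x\<close> differ from \<open>\<phi>' (u r) * (u s - u r)\<close> by at
  most \<open>C\<close> times the square of the integral of \<open>\<bar>g x\<bar>\<close>. Their
  discrepancy thus has quadratically small increments and is constant; differentiability of
  \<open>u\<close> at points never enters.\<close>

lemma has_L2_derivative_chain_rule:
  fixes u g \<phi> \<phi>' :: "real \<Rightarrow> real"
  assumes Z: "has_L2_derivative u g"
    and der: "\<And>x. (\<phi> has_real_derivative \<phi>' x) (at x)"
    and lip: "\<And>x y. \<bar>\<phi>' x - \<phi>' y\<bar> \<le> C * \<bar>x - y\<bar>"
    and bd: "\<And>x. \<bar>\<phi>' x\<bar> \<le> 1" and m: "\<phi>' \<in> borel_measurable borel" and t: "0 \<le> t" "t \<le> 1"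
  shows "((\<lambda>x. \<phi>' (u x) * g x) has_integral \<phi> (u t) - \<phi> (u 0)) {0..t}"
proof -
  have C: "C \<ge> 0" using lip[of 1 0] abs_ge_zero[of "\<phi>' 1 - \<phi>' 0"] by simp
  let ?p = "\<lambda>x. \<phi>' (u x) * g x"
  have pi: "?p integrable_on {r..s}" if "0 \<le> r" "s \<le> 1" for r s
    by (rule set_borel_integral_eq_integral(1), rule set_integrable_subset[OF set_integrable_comp_mult_L2[OF Z m bd]])
       (use that in auto)
  \<comment> \<open>The two errors add up to \<open>2 * C\<close> times a square; the root makes
    this the square of an increment of \<open>H\<close>.\<close>
  define H where "H s = sqrt (2 * C) * integral {0..s} (\<lambda>x. \<bar>g x\<bar>)" for s
  define D where "D s = \<phi> (u s) - integral {0..s} ?p" for s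
  have gi: "(\<lambda>x. \<bar>g x\<bar>) integrable_on {r..s}" if "0 \<le> r" "r \<le> s" "s \<le> 1" for r s
    using has_L2_derivative_diff(3)[OF Z that] by simp
  have Hd: "H s - H r = sqrt (2 * C) * integral {r..s} (\<lambda>x. \<bar>g x\<bar>)" if "0 \<le> r" "r \<le> s" "s \<le> 1" for r s
  proof -
    have "integral {0..r} (\<lambda>x. \<bar>g x\<bar>) + integral {r..s} (\<lambda>x. \<bar>g x\<bar>) = integral {0..s} (\<lambda>x. \<bar>g x\<bar>)"
      using that by (intro Henstock_Kurzweil_Integration.integral_combine gi) auto
    then show ?thesis unfolding H_def by (metis add_diff_cancel_left' right_diff_distrib')
  qed
  have Dd: "\<bar>D s - D r\<bar> \<le> (H s - H r)\<^sup>2" if rs: "0 \<le> r" "r \<le> s" "s \<le> 1" for r s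
  proof -
    let ?G = "integral {r..s} (\<lambda>x. \<bar>g x\<bar>)"
    have inc: "\<bar>u x - u r\<bar> \<le> ?G" if "x \<in> {r..s}" for x
    proof -
      have "\<bar>u x - u r\<bar> \<le> integral {r..x} (\<lambda>x. \<bar>g x\<bar>)"
        using has_L2_derivative_norm_le[OF Z, of r x] rs that by simp
      also have "\<dots> \<le> ?G"
        by (rule integral_subset_le) (use rs that in \<open>auto intro!: gi\<close>)
      finally show ?thesis .
    qed
    have G0: "0 \<le> ?G" using inc[of r] rs by simp
    have "\<bar>\<phi> (u s) - \<phi> (u r) - \<phi>' (u r) * (u s - u r)\<bar> \<le> C * ?G\<^sup>2"
    proof -
      obtain \<xi> where \<xi>: "\<bar>\<xi> - u r\<bar> \<le> \<bar>u s - u r\<bar>" "\<phi> (u s) - \<phi> (u r) = (u s - u r) * \<phi>' \<xi>"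
      proof (cases "u s = u r")
        case True then show ?thesis using that[of "u r"] by simp
      next
        case False
        then consider "u r < u s" | "u s < u r" by linarith
        then show ?thesis
        proof cases
          case 1
          from MVT2[OF 1 der] obtain z where "u r < z" "z < u s" "\<phi> (u s) - \<phi> (u r) = (u s - u r) * \<phi>' z"
            by blast
          then show ?thesis by (intro that[of z]) auto
        next
          case 2
          from MVT2[OF 2 der] obtain z where z: "u s < z" "z < u r" "\<phi> (u r) - \<phi> (u s) = (u r - u s) * \<phi>' z"
            by blast
          have "\<phi> (u s) - \<phi> (u r) = (u s - u r) * \<phi>' z"
            using z(3) by (metis minus_diff_eq mult_minus_left)
          then show ?thesis using z by (intro that[of z]) auto
        qed
      qed
      have "\<phi> (u s) - \<phi> (u r) - \<phi>' (u r) * (u s - u r) = (\<phi>' \<xi> - \<phi>' (u r)) * (u s - u r)"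
        unfolding \<xi>(2) by (simp add: algebra_simps)
      also have "\<bar>\<dots>\<bar> \<le> (C * ?G) * ?G"
        unfolding abs_mult
      proof (intro mult_mono)
        have "\<bar>\<phi>' \<xi> - \<phi>' (u r)\<bar> \<le> C * \<bar>\<xi> - u r\<bar>" by (rule lip)
        also have "\<dots> \<le> C * ?G"
          using C \<xi>(1) inc[of s] rs by (intro mult_left_mono) auto
        finally show "\<bar>\<phi>' \<xi> - \<phi>' (u r)\<bar> \<le> C * ?G" .
      qed (use C G0 inc[of s] rs in auto)
      finally show ?thesis by (simp add: power2_eq_square mult.assoc)
    qed
    moreover have "\<bar>\<phi>' (u r) * (u s - u r) - integral {r..s} ?p\<bar> \<le> C * ?G\<^sup>2"
    proof -
      have gr: "g integrable_on {r..s}" by (rule has_L2_derivative_diff(2)[OF Z rs])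
      have "\<phi>' (u r) * (u s - u r) - integral {r..s} ?p = integral {r..s} (\<lambda>x. \<phi>' (u r) * g x) - integral {r..s} ?p"
        unfolding has_L2_derivative_diff(1)[OF Z rs] by simp
      also have "\<dots> = integral {r..s} (\<lambda>x. \<phi>' (u r) * g x - ?p x)"
        using rs by (intro Henstock_Kurzweil_Integration.integral_diff[symmetric] integrable_on_mult_right gr pi) auto
      also have "\<bar>\<dots>\<bar> \<le> integral {r..s} (\<lambda>x. C * ?G * \<bar>g x\<bar>)"
        unfolding real_norm_def[symmetric]
      proof (rule Henstock_Kurzweil_Integration.integral_norm_bound_integral)
        show "(\<lambda>x. \<phi>' (u r) * g x - ?p x) integrable_on {r..s}"
          using rs by (intro integrable_diff integrable_on_mult_right gr pi) auto
        show "(\<lambda>x. C * integral {r..s} (\<lambda>x. norm (g x)) * norm (g x)) integrable_on {r..s}"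
          using gi[OF rs] by (intro integrable_on_mult_right) simp
        fix x assume x: "x \<in> {r..s}"
        have "\<phi>' (u r) * g x - ?p x = (\<phi>' (u r) - \<phi>' (u x)) * g x" by (simp add: algebra_simps)
        also have "norm \<dots> \<le> (C * \<bar>u r - u x\<bar>) * norm (g x)"
          unfolding norm_mult by (intro mult_right_mono) (use lip in auto)
        also have "\<dots> \<le> (C * ?G) * norm (g x)"
          using inc[OF x] C by (intro mult_right_mono mult_left_mono) (auto simp: abs_minus_commute)
        finally show "norm (\<phi>' (u r) * g x - ?p x) \<le> C * integral {r..s} (\<lambda>x. norm (g x)) * norm (g x)" by simp
      qed
      also have "\<dots> = C * ?G\<^sup>2" by (simp add: power2_eq_square)
      finally show ?thesis .
    qed
    moreover have "integral {0..r} ?p + integral {r..s} ?p = integral {0..s} ?p"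
      using rs by (intro Henstock_Kurzweil_Integration.integral_combine pi) auto
    ultimately have "\<bar>D s - D r\<bar> \<le> C * ?G\<^sup>2 + C * ?G\<^sup>2"
      unfolding D_def abs_le_iff by (smt (verit))
    also have "\<dots> = (H s - H r)\<^sup>2" unfolding Hd[OF rs] using C by (simp add: power_mult_distrib)
    finally show ?thesis .
  qed
  have "D t = D 0"
  proof (rule constant_if_increment_le_square[where H=H and D=D and a=0 and b=t])
    show "0 \<le> t" by fact
    show "continuous_on {0..t} H"
      unfolding H_def using t by (intro continuous_intros indefinite_integral_continuous_1 gi) auto
    show "H r \<le> H s" if "0 \<le> r" "r \<le> s" "s \<le> t" for r s
    proof -
      have "0 \<le> H s - H r"
        unfolding Hd[OF that(1,2) order_trans[OF that(3) t(2)]] using that t C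
        by (intro mult_nonneg_nonneg Henstock_Kurzweil_Integration.integral_nonneg gi) auto
      then show ?thesis by simp
    qed
    show "\<bar>D s - D r\<bar> \<le> (H s - H r)\<^sup>2" if "0 \<le> r" "r \<le> s" "s \<le> t" for r s
      using Dd that t by simp
  qed
  then have "integral {0..t} ?p = \<phi> (u t) - \<phi> (u 0)" unfolding D_def by simp
  then show ?thesis using pi[of 0 t] t by (metis integrable_integral order_refl)
qed

text \<open>The absolute value is approximated by \<open>sqrt (x\<^sup>2 + e)\<close>, to which the chain rule applies.\<close>

lemma has_L2_derivative_abs:
  fixes u g :: "real \<Rightarrow> real"
  assumes Z: "has_L2_derivative u g"
  shows "has_L2_derivative (\<lambda>t. \<bar>u t\<bar>) (\<lambda>t. sgn (u t) * g t)"
  unfolding has_L2_derivative_def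
proof (intro conjI ballI)
  have sg: "(sgn :: real \<Rightarrow> real) \<in> borel_measurable borel" "\<bar>sgn x\<bar> \<le> 1" for x :: real
    by (auto simp: sgn_if)
  show "set_borel_measurable lborel {0..1} (\<lambda>t. sgn (u t) * g t)"
    by (rule set_measurable_comp_mult_L2[OF Z sg])
  show "set_integrable lborel {0..1} (\<lambda>t. (norm (sgn (u t) * g t))\<^sup>2)"
    by (rule set_integrable_comp_mult_L2_sq[OF Z sg])
  fix t :: real assume t: "t \<in> {0..1}"
  define e where "e n = 1 / real (Suc n)" for n
  have e: "e n > 0" for n by (simp add: e_def)
  have e0: "e \<longlonglongrightarrow> 0"
    using LIMSEQ_inverse_real_of_nat unfolding e_def by (simp add: divide_inverse)
  define p where "p n x = x / sqrt (x\<^sup>2 + e n)" for n x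
  have pos: "x\<^sup>2 + e n > 0" for n and x :: real using e[of n] zero_le_power2[of x] by linarith
  have der: "((\<lambda>x. sqrt (x\<^sup>2 + e n)) has_real_derivative p n x) (at x)" for n x
    unfolding p_def using pos[of x n] by (auto intro!: derivative_eq_intros simp: field_simps)
  have der2: "((\<lambda>x. p n x) has_real_derivative e n / ((x\<^sup>2 + e n) * sqrt (x\<^sup>2 + e n))) (at x)" for n x
  proof -
    have "sqrt (x\<^sup>2 + e n) \<noteq> 0" using pos[of x n] by simp
    have "(p n has_real_derivative (1 * sqrt (x\<^sup>2 + e n) - x * p n x) / (sqrt (x\<^sup>2 + e n) * sqrt (x\<^sup>2 + e n))) (at x)"
      unfolding p_def[of n, abs_def]
      by (rule DERIV_divide[OF DERIV_ident der[unfolded p_def]]) fact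
    moreover have "(1 * sqrt (x\<^sup>2 + e n) - x * p n x) / (sqrt (x\<^sup>2 + e n) * sqrt (x\<^sup>2 + e n)) = e n / ((x\<^sup>2 + e n) * sqrt (x\<^sup>2 + e n))"
    proof -
      have "(1 * sqrt (x\<^sup>2 + e n) - x * p n x) = (sqrt (x\<^sup>2 + e n) * sqrt (x\<^sup>2 + e n) - x\<^sup>2) / sqrt (x\<^sup>2 + e n)"
        unfolding p_def using \<open>sqrt (x\<^sup>2 + e n) \<noteq> 0\<close> by (simp add: field_simps power2_eq_square)
      also have "\<dots> = e n / sqrt (x\<^sup>2 + e n)" using pos[of x n] by simp
      finally have num: "1 * sqrt (x\<^sup>2 + e n) - x * p n x = e n / sqrt (x\<^sup>2 + e n)" .
      have "sqrt (x\<^sup>2 + e n) * sqrt (x\<^sup>2 + e n) = x\<^sup>2 + e n" using pos[of x n] by simp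
      then show ?thesis unfolding num by (simp add: mult.commute)
    qed
    ultimately show ?thesis by simp
  qed
  \<comment> \<open>This Lipschitz constant blows up with \<open>n\<close>, which is harmless: the
    chain rule is an exact identity for each \<open>n\<close>, and the limit relies on the uniform
    bound \<open>bd\<close>.\<close>
  have lip: "\<bar>p n x - p n y\<bar> \<le> (1 / sqrt (e n)) * \<bar>x - y\<bar>" for n x y
  proof -
    have "norm (p n x - p n y) \<le> (1 / sqrt (e n)) * norm (x - y)"
    proof (rule field_differentiable_bound[where S=UNIV])
      show "(p n has_field_derivative e n / ((z\<^sup>2 + e n) * sqrt (z\<^sup>2 + e n))) (at z within UNIV)" for z
        using der2[of n z] by simp
      show "norm (e n / ((z\<^sup>2 + e n) * sqrt (z\<^sup>2 + e n))) \<le> 1 / sqrt (e n)" for z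
      proof -
        have "e n * sqrt (e n) \<le> (z\<^sup>2 + e n) * sqrt (z\<^sup>2 + e n)"
          using e[of n] by (intro mult_mono) auto
        then have "e n / ((z\<^sup>2 + e n) * sqrt (z\<^sup>2 + e n)) \<le> e n / (e n * sqrt (e n))"
          using e[of n] pos[of z n] by (intro divide_left_mono) (auto intro!: mult_pos_pos)
        then show ?thesis using e[of n] pos[of z n] by (simp add: abs_mult)
      qed
    qed auto
    then show ?thesis by simp
  qed
  have bd: "\<bar>p n x\<bar> \<le> 1" for n x
  proof -
    have "\<bar>x\<bar> \<le> sqrt (x\<^sup>2 + e n)" using e[of n] by (intro real_le_rsqrt) simp
    then show ?thesis using pos[of x n] by (simp add: p_def abs_mult field_simps)
  qed
  have pm: "p n \<in> borel_measurable borel" for n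
    unfolding p_def by measurable
  \<comment> \<open>At 0 every \<open>p n\<close> vanishes, in agreement with
    \<open>sgn 0 = 0\<close>, so the convergence holds also at the zeros of
    \<open>u\<close>.\<close>
  have lim: "(\<lambda>n. p n x) \<longlonglongrightarrow> sgn x" for x
  proof (cases "x = 0")
    case True then show ?thesis by (simp add: p_def)
  next
    case False
    have "(\<lambda>n. p n x) \<longlonglongrightarrow> x / sqrt (x\<^sup>2 + 0)"
      unfolding p_def using False by (intro tendsto_intros e0) auto
    moreover have "x / sqrt (x\<^sup>2 + 0) = sgn x" using False by (auto simp: sgn_if)
    ultimately show ?thesis by simp
  qed
  have gt: "(\<lambda>x. \<bar>g x\<bar>) integrable_on {0..t}"
    using has_L2_derivative_diff(3)[OF Z, of 0 t] t by simp
  have hi: "((\<lambda>x. p n (u x) * g x) has_integral sqrt ((u t)\<^sup>2 + e n) - sqrt ((u 0)\<^sup>2 + e n)) {0..t}" for n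
    by (rule has_L2_derivative_chain_rule[OF Z der lip bd pm]) (use t in auto)
  have "(\<lambda>n. integral {0..t} (\<lambda>x. p n (u x) * g x)) \<longlonglongrightarrow> integral {0..t} (\<lambda>x. sgn (u x) * g x)"
  proof (rule dominated_convergence(2))
    show "(\<lambda>x. p n (u x) * g x) integrable_on {0..t}" for n using hi by blast
    show "(\<lambda>x. \<bar>g x\<bar>) integrable_on {0..t}" by fact
    show "norm (p n (u x) * g x) \<le> \<bar>g x\<bar>" for n x
      using mult_right_mono[OF bd[of n "u x"], of "\<bar>g x\<bar>"] by (simp add: abs_mult)
    show "(\<lambda>n. p n (u x) * g x) \<longlonglongrightarrow> sgn (u x) * g x" for x
      by (intro tendsto_intros lim)
  qed
  moreover have "(\<lambda>n. integral {0..t} (\<lambda>x. p n (u x) * g x)) \<longlonglongrightarrow> sqrt ((u t)\<^sup>2 + 0) - sqrt ((u 0)\<^sup>2 + 0)"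
    unfolding integral_unique[OF hi] by (intro tendsto_intros e0)
  ultimately have "integral {0..t} (\<lambda>x. sgn (u x) * g x) = sqrt ((u t)\<^sup>2 + 0) - sqrt ((u 0)\<^sup>2 + 0)"
    by (rule LIMSEQ_unique)
  moreover have "set_integrable lborel {0..t} (\<lambda>x. sgn (u x) * g x)"
    by (rule set_integrable_subset[OF set_integrable_comp_mult_L2[OF Z sg]]) (use t in auto)
  note set_borel_integral_eq_integral(2)[OF this]
  ultimately have "(LINT s:{0..t}|lborel. sgn (u s) * g s) = \<bar>u t\<bar> - \<bar>u 0\<bar>" by simp
  then show "\<bar>u t\<bar> = \<bar>u 0\<bar> + (LINT s:{0..t}|lborel. sgn (u s) * g s)" by simp
qed

section \<open>Minimizers of finite action\<close>

text \<open>In terms of the bodies the three vectors are q3 - q2, q1 - q2 and q3 - q1.\<close>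

definition collision_free :: "complex \<times> complex \<Rightarrow> bool" where
  "collision_free z \<longleftrightarrow> fst z \<noteq> 0 \<and> fst z / 2 + snd z \<noteq> 0 \<and> fst z / 2 - snd z \<noteq> 0"

text \<open>A quotient by zero is 0 here, so at collisions this differs from
  \<open>potential\<close>. For this reason estimates of the action carry
  \<open>collision_free\<close> almost everywhere as a companion.\<close>

definition real_potential :: "real \<Rightarrow> complex \<times> complex \<Rightarrow> real" where
  "real_potential m z = m\<^sup>2 / cmod (fst z) + m / cmod (fst z / 2 + snd z) + m / cmod (fst z / 2 - snd z)"

text \<open>The polarization of the quadratic form \<open>kinetic m\<close>.\<close>

definition kinetic_inner :: "real \<Rightarrow> complex \<times> complex \<Rightarrow> complex \<times> complex \<Rightarrow> real" where
  "kinetic_inner m v w = m / 4 * (fst v \<bullet> fst w) + m / (2 * m + 1) * (snd v \<bullet> snd w)"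

lemma real_potential_nonneg: "m > 0 \<Longrightarrow> real_potential m z \<ge> 0"
  by (simp add: real_potential_def)

lemma kinetic_nonneg: "m > 0 \<Longrightarrow> kinetic m v \<ge> 0"
  by (simp add: kinetic_def)

lemma potential_collision_free:
  assumes "m > 0" "collision_free z"
  shows "potential m z = ennreal (real_potential m z)"
proof -
  have d: "cmod (fst z) > 0" "cmod (fst z / 2 + snd z) > 0" "cmod (fst z / 2 - snd z) > 0"
    using assms unfolding collision_free_def by auto
  show ?thesis
    unfolding potential_def real_potential_def
    using assms(1) d by (simp only: divide_ennreal zero_le_power2 less_imp_le ennreal_plus[symmetric]
        divide_nonneg_pos add_nonneg_nonneg)
qed

lemma potential_collision:
  assumes "m > 0" "\<not> collision_free z"
  shows "potential m z = \<infinity>"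
  using assms unfolding collision_free_def potential_def by auto

lemma kinetic_add_scaleR:
  "kinetic m (v + c *\<^sub>R w) = kinetic m v + 2 * c * kinetic_inner m v w + c\<^sup>2 * kinetic m w"
  unfolding kinetic_def kinetic_inner_def cmod_power2
  by (simp add: inner_complex_def power2_eq_square algebra_simps)

lemma bounded_linear_kinetic_inner: "bounded_linear (\<lambda>v. kinetic_inner m v w)"
  unfolding kinetic_inner_def
  by (intro bounded_linear_intros bounded_linear_compose[OF bounded_linear_inner_left bounded_linear_fst]
      bounded_linear_compose[OF bounded_linear_inner_left bounded_linear_snd])

lemma potential_measurable [measurable]: "potential m \<in> borel_measurable borel"
  and real_potential_measurable [measurable]: "real_potential m \<in> borel_measurable borel"
  and kinetic_measurable [measurable]: "kinetic m \<in> borel_measurable borel"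
proof -
  have c: "(\<lambda>z. cmod (f z)) \<in> borel_measurable borel" if "continuous_on UNIV f" for f :: "complex \<times> complex \<Rightarrow> complex"
    by (intro borel_measurable_continuous_onI continuous_on_norm that)
  have [measurable]: "(\<lambda>z::complex \<times> complex. cmod (fst z)) \<in> borel_measurable borel"
      "(\<lambda>z::complex \<times> complex. cmod (snd z)) \<in> borel_measurable borel"
      "(\<lambda>z::complex \<times> complex. cmod (fst z / 2 + snd z)) \<in> borel_measurable borel"
      "(\<lambda>z::complex \<times> complex. cmod (fst z / 2 - snd z)) \<in> borel_measurable borel"
    by (rule c, intro continuous_intros, simp?)+
  show "potential m \<in> borel_measurable borel"
    unfolding potential_def[abs_def] by measurable
  show "real_potential m \<in> borel_measurable borel"
    unfolding real_potential_def[abs_def] by measurable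
  show "kinetic m \<in> borel_measurable borel"
    unfolding kinetic_def[abs_def] by measurable
qed

lemma has_L2_derivative_measurable:
  assumes Z: "has_L2_derivative Z g"
  shows "(\<lambda>t. indicator {0..1} t *\<^sub>R Z t) \<in> borel_measurable borel"
    "(\<lambda>t. indicator {0..1} t *\<^sub>R g t) \<in> borel_measurable borel"
  using has_L2_derivativeD(1)[OF Z] borel_measurable_continuous_on_indicator[OF _ has_L2_derivative_continuous[OF Z]]
  unfolding set_borel_measurable_def by simp_all

lemma set_integrable_kinetic:
  assumes Z: "has_L2_derivative Z g"
  shows "set_integrable lborel {0..1} (\<lambda>t. kinetic m (g t))"
proof (rule set_integrable_bound)
  let ?c = "\<bar>m / 4\<bar> + \<bar>m / (2 * m + 1)\<bar>"
  show "set_integrable lborel {0..1} (\<lambda>t. ?c * (norm (g t))\<^sup>2)"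
    by (intro set_integrable_mult_right has_L2_derivativeD[OF Z])
  note [measurable] = has_L2_derivative_measurable[OF Z]
  have e: "indicat_real {0..1} t *\<^sub>R kinetic m (g t) = kinetic m (indicator {0..1} t *\<^sub>R g t)" for t
    by (auto simp: indicator_def kinetic_def)
  show "set_borel_measurable lborel {0..1} (\<lambda>t. kinetic m (g t))"
    unfolding set_borel_measurable_def e by measurable
  have "\<bar>kinetic m v\<bar> \<le> ?c * (norm v)\<^sup>2" for v
  proof -
    have n: "(cmod (fst v))\<^sup>2 \<le> (norm v)\<^sup>2" "(cmod (snd v))\<^sup>2 \<le> (norm v)\<^sup>2"
      by (auto simp: norm_prod_def)
    have "\<bar>kinetic m v\<bar> \<le> \<bar>m / 4\<bar> * (cmod (fst v))\<^sup>2 + \<bar>m / (2 * m + 1)\<bar> * (cmod (snd v))\<^sup>2"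
      unfolding kinetic_def by (rule order_trans[OF abs_triangle_ineq]) (simp add: abs_mult)
    also have "\<dots> \<le> \<bar>m / 4\<bar> * (norm v)\<^sup>2 + \<bar>m / (2 * m + 1)\<bar> * (norm v)\<^sup>2"
      by (intro add_mono mult_left_mono n) auto
    finally show ?thesis by (simp add: distrib_right)
  qed
  then show "AE x in lborel. x \<in> {0..1} \<longrightarrow> norm (kinetic m (g x)) \<le> norm (?c * (norm (g x))\<^sup>2)"
    by (auto intro: order_trans[OF _ abs_ge_self])
qed

text \<open>A finite integral has an almost everywhere finite integrand, so the collision times form
  a null set. The action then becomes a real integral whose kinetic and potential parts can be
  separated and subtracted.\<close>

lemma action_finite:
  assumes m: "m > 0" and Z: "has_L2_derivative Z g" and fin: "action m Z < \<infinity>"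
  shows "AE t in lborel. t \<in> {0..1} \<longrightarrow> collision_free (Z t)"
    and "set_integrable lborel {0..1} (\<lambda>t. real_potential m (Z t))"
    and "action m Z = ennreal (LINT t:{0..1}|lborel. kinetic m (g t) + real_potential m (Z t))"
proof -
  note [measurable] = has_L2_derivative_measurable[OF Z]
  let ?W = "\<lambda>t. indicator {0..1} t *\<^sub>R Z t" and ?h = "\<lambda>t. indicator {0..1} t *\<^sub>R g t"
  have e: "(ennreal (kinetic m (g t)) + potential m (Z t)) * indicator {0..1} t
     = (ennreal (kinetic m (?h t)) + potential m (?W t)) * indicator {0..1} t" for t :: real
    by (auto simp: indicator_def)
  have act: "action m Z = (\<integral>\<^sup>+t. (ennreal (kinetic m (?h t)) + potential m (?W t)) * indicator {0..1} t \<partial>lborel)"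
    unfolding action_eq[OF Z] e ..
  have "AE t in lborel. (ennreal (kinetic m (?h t)) + potential m (?W t)) * indicator {0..1} t \<noteq> \<infinity>"
  proof (rule nn_integral_PInf_AE)
    show "(\<lambda>t. (ennreal (kinetic m (?h t)) + potential m (?W t)) * indicator {0..1} t) \<in> borel_measurable lborel"
      by measurable
  qed (use fin act in simp)
  then show cf: "AE t in lborel. t \<in> {0..1} \<longrightarrow> collision_free (Z t)"
    by eventually_elim (use m in \<open>auto simp: indicator_def dest: potential_collision split: if_splits\<close>)
  have i1: "set_integrable lborel {0..1} (\<lambda>t. kinetic m (g t))" by (rule set_integrable_kinetic[OF Z])
  have act2: "action m Z = (\<integral>\<^sup>+t. ennreal (indicator {0..1} t *\<^sub>R (kinetic m (g t) + real_potential m (Z t))) \<partial>lborel)"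
    unfolding action_eq[OF Z]
    by (intro nn_integral_cong_AE, use cf in eventually_elim)
       (use m in \<open>auto simp: indicator_def potential_collision_free ennreal_plus[symmetric]
          kinetic_nonneg real_potential_nonneg simp del: ennreal_plus\<close>)
  have i: "integrable lborel (\<lambda>t. indicator {0..1} t *\<^sub>R (kinetic m (g t) + real_potential m (Z t)))"
  proof (rule integrableI_nonneg)
    have "(\<lambda>t. indicator {0..1} t *\<^sub>R (kinetic m (g t) + real_potential m (Z t)))
        = (\<lambda>t. indicator {0..1} t *\<^sub>R (kinetic m (?h t) + real_potential m (?W t)))"
      by (auto simp: indicator_def fun_eq_iff)
    also have "\<dots> \<in> borel_measurable lborel" by measurable
    finally show "(\<lambda>t. indicator {0..1} t *\<^sub>R (kinetic m (g t) + real_potential m (Z t))) \<in> borel_measurable lborel" .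
    show "AE t in lborel. 0 \<le> indicator {0..1} t *\<^sub>R (kinetic m (g t) + real_potential m (Z t))"
      using m by (simp add: kinetic_nonneg real_potential_nonneg)
  qed (use fin act2 in simp)
  then have "set_integrable lborel {0..1} (\<lambda>t. kinetic m (g t) + real_potential m (Z t))"
    unfolding set_integrable_def .
  from set_integral_diff(1)[OF this i1]
  show "set_integrable lborel {0..1} (\<lambda>t. real_potential m (Z t))" by simp
  show "action m Z = ennreal (LINT t:{0..1}|lborel. kinetic m (g t) + real_potential m (Z t))"
    unfolding act2 set_lebesgue_integral_def
    by (rule nn_integral_eq_integral[OF i]) (use m in \<open>simp add: kinetic_nonneg real_potential_nonneg\<close>)
qed

text \<open>An integrable majorant \<open>F\<close> spares a separate integrability proof for the
  potential of each competitor. Nonnegativity of the bound permits turning an inequality in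
  \<open>ennreal\<close> back into one between reals.\<close>

lemma action_le:
  assumes m: "m > 0" and Y: "has_L2_derivative Y h"
    and cf: "AE t in lborel. t \<in> {0..1} \<longrightarrow> collision_free (Y t)"
    and F: "set_integrable lborel {0..1} F"
    and le: "AE t in lborel. t \<in> {0..1} \<longrightarrow> real_potential m (Y t) \<le> F t"
  shows "action m Y \<le> ennreal (LINT t:{0..1}|lborel. kinetic m (h t) + F t)"
    and "0 \<le> (LINT t:{0..1}|lborel. kinetic m (h t) + F t)"
proof -
  have i: "integrable lborel (\<lambda>t. indicator {0..1} t *\<^sub>R (kinetic m (h t) + F t))"
    using set_integral_add(1)[OF set_integrable_kinetic[OF Y] F] unfolding set_integrable_def .
  have nn: "AE t in lborel. 0 \<le> indicator {0..1} t *\<^sub>R (kinetic m (h t) + F t)"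
    using le
  proof eventually_elim
    fix t assume "t \<in> {0..1} \<longrightarrow> real_potential m (Y t) \<le> F t"
    then show "0 \<le> indicator {0..1} t *\<^sub>R (kinetic m (h t) + F t)"
      using kinetic_nonneg[OF m, of "h t"] real_potential_nonneg[OF m, of "Y t"]
      by (auto simp: indicator_def)
  qed
  have "action m Y \<le> (\<integral>\<^sup>+t. ennreal (indicator {0..1} t *\<^sub>R (kinetic m (h t) + F t)) \<partial>lborel)"
    unfolding action_eq[OF Y]
  proof (intro nn_integral_mono_AE, use cf le in eventually_elim)
    fix t assume *: "t \<in> {0..1} \<longrightarrow> collision_free (Y t)" "t \<in> {0..1} \<longrightarrow> real_potential m (Y t) \<le> F t"
    show "(ennreal (kinetic m (h t)) + potential m (Y t)) * indicator {0..1} t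
        \<le> ennreal (indicator {0..1} t *\<^sub>R (kinetic m (h t) + F t))"
    proof (cases "t \<in> {0..1}")
      case True
      then have "ennreal (kinetic m (h t)) + potential m (Y t) = ennreal (kinetic m (h t) + real_potential m (Y t))"
        using * m by (simp add: potential_collision_free kinetic_nonneg real_potential_nonneg)
      also have "\<dots> \<le> ennreal (kinetic m (h t) + F t)"
        using * True by (intro ennreal_leI) simp
      finally show ?thesis using True by simp
    qed simp
  qed
  also have "\<dots> = ennreal (LINT t:{0..1}|lborel. kinetic m (h t) + F t)"
    unfolding set_lebesgue_integral_def by (rule nn_integral_eq_integral[OF i nn])
  finally show "action m Y \<le> ennreal (LINT t:{0..1}|lborel. kinetic m (h t) + F t)" .
  show "0 \<le> (LINT t:{0..1}|lborel. kinetic m (h t) + F t)"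
    unfolding set_lebesgue_integral_def by (rule integral_nonneg_AE[OF nn])
qed

section \<open>Tent-shaped variations\<close>

definition tent :: "real \<Rightarrow> real \<Rightarrow> real \<Rightarrow> real" where
  "tent c h t = (max 0 (t - (c - h)) - 2 * max 0 (t - c) + max 0 (t - (c + h))) / h"

text \<open>The ramps in \<open>tent\<close> are differentiated term by term. For
  \<open>h > 0\<close> the value is \<open>1 / h\<close> left of the peak, \<open>- 1 / h\<close>
  right of it and 0 off the support.\<close>

definition tent' :: "real \<Rightarrow> real \<Rightarrow> real \<Rightarrow> real" where
  "tent' c h t = (indicator {c - h..} t - 2 * indicator {c..} t + indicator {c + h..} t) / h"

lemma tent_bounds:
  assumes "h > 0"
  shows "0 \<le> tent c h t" "tent c h t \<le> 1" "\<bar>t - c\<bar> \<ge> h \<Longrightarrow> tent c h t = 0"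
    "tent c h c = 1" "tent c h t = max 0 (1 - \<bar>t - c\<bar> / h)"
proof -
  have *: "tent c h t = max 0 (1 - \<bar>t - c\<bar> / h)"
    using assms by (auto simp: tent_def max_def field_simps abs_if)
  then show "tent c h t = max 0 (1 - \<bar>t - c\<bar> / h)" .
  show "0 \<le> tent c h t" "tent c h t \<le> 1" unfolding * using assms by auto
  show "tent c h t = 0" if "\<bar>t - c\<bar> \<ge> h"
    unfolding * using assms that by (auto simp: max_def field_simps)
  show "tent c h c = 1" using assms by (simp add: tent_def)
qed

text \<open>The factor 4 in place of 1 is immaterial, as the bound enters only terms of order
  \<open>\<epsilon>\<^sup>2\<close>.\<close>

lemma tent'_bound: "h > 0 \<Longrightarrow> (tent' c h t)\<^sup>2 \<le> 4 / h\<^sup>2"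
  unfolding tent'_def power_divide
  by (rule divide_right_mono) (auto simp: indicator_def power2_eq_square)

lemma has_L2_derivative_tent:
  assumes h: "h > 0" "0 \<le> c - h"
  shows "has_L2_derivative (\<lambda>t. tent c h t *\<^sub>R (V :: 'a::euclidean_space)) (\<lambda>t. tent' c h t *\<^sub>R V)"
proof -
  let ?r = "\<lambda>b t. max 0 (t - b)" and ?i = "\<lambda>b t. indicat_real {b..} t"
  have s: "has_L2_derivative (\<lambda>t. k * ?r b t) (\<lambda>t. k * ?i b t)" if "0 \<le> b" for k b
    by (rule has_L2_derivative_linear[OF bounded_linear_mult_right has_L2_derivative_ramp[OF that]])
  have "has_L2_derivative (\<lambda>t. (1/h) * ?r (c-h) t + ((-2/h) * ?r c t + (1/h) * ?r (c+h) t))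
      (\<lambda>t. (1/h) * ?i (c-h) t + ((-2/h) * ?i c t + (1/h) * ?i (c+h) t))"
    using h by (intro has_L2_derivative_add s) auto
  moreover have "(\<lambda>t. (1/h) * ?r (c-h) t + ((-2/h) * ?r c t + (1/h) * ?r (c+h) t)) = tent c h"
    by (simp add: fun_eq_iff tent_def diff_divide_distrib add_divide_distrib)
  moreover have "(\<lambda>t. (1/h) * ?i (c-h) t + ((-2/h) * ?i c t + (1/h) * ?i (c+h) t)) = tent' c h"
    by (simp add: fun_eq_iff tent'_def diff_divide_distrib add_divide_distrib)
  ultimately have "has_L2_derivative (tent c h) (tent' c h)" by simp
  from has_L2_derivative_linear[OF bounded_linear_scaleR_left this] show ?thesis .
qed

text \<open>\<open>tent' c h\<close> is a combination of steps at \<open>c - h\<close>,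
  \<open>c\<close> and \<open>c + h\<close>, so integrating it against a derivative leaves a
  negative second difference divided by \<open>h\<close>. This is the discrete form of integration
  by parts on which all variations rest.\<close>

lemma integral_tent'_times:
  fixes G \<gamma> :: "real \<Rightarrow> real"
  assumes G: "has_L2_derivative G \<gamma>" and h: "h > 0" "0 \<le> c - h" "c + h \<le> 1"
  shows "set_integrable lborel {0..1} (\<lambda>t. tent' c h t * \<gamma> t)"
    and "(LINT t:{0..1}|lborel. tent' c h t * \<gamma> t) = (2 * G c - G (c - h) - G (c + h)) / h"
proof -
  have gi: "set_integrable lborel {b..1} \<gamma>" if "0 \<le> b" for b
    by (rule set_integrable_subset[OF has_L2_derivative_integrable[OF G]]) (use that in auto)
  have e: "indicat_real {0..1} t *\<^sub>R (indicator {b..} t * \<gamma> t) = indicator {b..1} t *\<^sub>R \<gamma> t" if "0 \<le> b" for b t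
    using that by (auto simp: indicator_def)
  have i: "set_integrable lborel {0..1} (\<lambda>t. indicator {b..} t * \<gamma> t)" if "0 \<le> b" for b
    using gi[OF that] unfolding set_integrable_def e[OF that] .
  have v: "(LINT t:{0..1}|lborel. indicator {b..} t * \<gamma> t) = G 1 - G b" if "0 \<le> b" "b \<le> 1" for b
  proof -
    have "(LINT t:{0..1}|lborel. indicator {b..} t * \<gamma> t) = (LINT t:{b..1}|lborel. \<gamma> t)"
      unfolding set_lebesgue_integral_def e[OF that(1)] ..
    also have "\<dots> = G 1 - G b"
      using set_borel_integral_eq_integral(2)[OF gi[OF that(1)]] has_L2_derivative_diff(1)[OF G, of b 1] that by simp
    finally show ?thesis .
  qed
  have t': "tent' c h t * \<gamma> t = (1/h) * (indicator {c-h..} t * \<gamma> t) - (2/h) * (indicator {c..} t * \<gamma> t)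
      + (1/h) * (indicator {c+h..} t * \<gamma> t)" for t
    by (simp add: tent'_def diff_divide_distrib add_divide_distrib left_diff_distrib distrib_right)
  have j: "set_integrable lborel {0..1} (\<lambda>t. k * (indicator {b..} t * \<gamma> t))" if "0 \<le> b" for k b
    by (rule set_integrable_mult_right) (rule i[OF that])
  show "set_integrable lborel {0..1} (\<lambda>t. tent' c h t * \<gamma> t)"
    unfolding t' using h by (intro set_integral_add set_integral_diff j) auto
  have "(LINT t:{0..1}|lborel. tent' c h t * \<gamma> t)
      = (1/h) * (G 1 - G (c-h)) - (2/h) * (G 1 - G c) + (1/h) * (G 1 - G (c+h))"
  proof -
    have b: "0 \<le> c - h" "c - h \<le> 1" "0 \<le> c" "c \<le> 1" "0 \<le> c + h" "c + h \<le> 1" using h by auto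
    note J = j[OF b(1), of "1/h"] j[OF b(3), of "2/h"] j[OF b(5), of "1/h"]
    show ?thesis
      unfolding t' set_integral_add(2)[OF set_integral_diff(1)[OF J(1,2)] J(3)] set_integral_diff(2)[OF J(1,2)]
        set_integral_mult_right v[OF b(1,2)] v[OF b(3,4)] v[OF b(5,6)] ..
  qed
  also have "\<dots> = (2 * G c - G (c - h) - G (c + h)) / h"
    using h by (simp add: field_simps)
  finally show "(LINT t:{0..1}|lborel. tent' c h t * \<gamma> t) = (2 * G c - G (c - h) - G (c + h)) / h" .
qed

text \<open>The weak derivative is a parameter so that it can be named in integrals; the action does
  not depend on its choice.\<close>

locale finite_minimizer =
  fixes m :: real and Z g :: "real \<Rightarrow> complex \<times> complex"
  assumes m: "m > 0" and Z: "has_L2_derivative Z g" and min: "action_minimizer m Z"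
    and fin: "action m Z < \<infinity>"
begin

text \<open>As the action of \<open>Z\<close> is finite, it can be subtracted from that of the
  competitor; \<open>f\<close> majorizes the change of the potential alone.\<close>

lemma comparison:
  assumes Y: "has_L2_derivative Y h" and ends: "Y 0 = Z 0" "Y 1 = Z 1"
    and cf: "AE t in lborel. t \<in> {0..1} \<longrightarrow> collision_free (Y t)"
    and f: "set_integrable lborel {0..1} f"
    and le: "AE t in lborel. t \<in> {0..1} \<longrightarrow> real_potential m (Y t) \<le> real_potential m (Z t) + f t"
  shows "0 \<le> (LINT t:{0..1}|lborel. kinetic m (h t) - kinetic m (g t) + f t)"
proof -
  note Zf = action_finite[OF m Z fin]
  note K = set_integrable_kinetic[OF Z, of m] set_integrable_kinetic[OF Y, of m]
  have F: "set_integrable lborel {0..1} (\<lambda>t. real_potential m (Z t) + f t)"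
    by (rule set_integral_add(1)[OF Zf(2) f])
  have "Y \<in> paths (Z 0) (Z 1)" using Y ends unfolding paths_def H1_def by auto
  then have "action m Z \<le> action m Y"
    using min unfolding action_minimizer_def by (metis INF_lower)
  also have "\<dots> \<le> ennreal (LINT t:{0..1}|lborel. kinetic m (h t) + (real_potential m (Z t) + f t))"
    by (rule action_le(1)[OF m Y cf F le])
  finally have "(LINT t:{0..1}|lborel. kinetic m (g t) + real_potential m (Z t))
     \<le> (LINT t:{0..1}|lborel. kinetic m (h t) + (real_potential m (Z t) + f t))"
    unfolding Zf(3) using action_le(2)[OF m Y cf F le] by (simp add: ennreal_le_iff)
  then show ?thesis
    using K Zf(2) f F by (simp add: set_integral_add set_integral_diff)
qed

text \<open>The kinetic change is quadratic in \<open>\<epsilon>\<close>. Its linear term integrates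
  to a second difference of \<open>Z\<close> paired with \<open>V\<close>, its quadratic term is
  bounded crudely. The tent vanishes at 0 and 1, so the ends stay fixed.\<close>

lemma tent_variation:
  assumes h: "h > 0" "0 \<le> c - h" "c + h \<le> 1"
    and cf: "AE t in lborel. t \<in> {0..1} \<longrightarrow> collision_free (Z t + (\<epsilon> * tent c h t) *\<^sub>R V)"
    and f: "set_integrable lborel {0..1} f"
    and le: "AE t in lborel. t \<in> {0..1} \<longrightarrow>
        real_potential m (Z t + (\<epsilon> * tent c h t) *\<^sub>R V) \<le> real_potential m (Z t) + f t"
  shows "0 \<le> 2 * \<epsilon> / h * kinetic_inner m (2 *\<^sub>R Z c - Z (c - h) - Z (c + h)) V
      + \<epsilon>\<^sup>2 * (4 / h\<^sup>2 * kinetic m V) + (LINT t:{0..1}|lborel. f t)"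
proof -
  let ?b = "\<lambda>t. kinetic_inner m (g t) V"
  interpret B: bounded_linear "\<lambda>v. kinetic_inner m v V" by (rule bounded_linear_kinetic_inner)
  have G: "has_L2_derivative (\<lambda>t. kinetic_inner m (Z t) V) ?b"
    by (rule has_L2_derivative_linear[OF bounded_linear_kinetic_inner Z])
  note T = integral_tent'_times[OF G h]
  have Y: "has_L2_derivative (\<lambda>t. Z t + tent c h t *\<^sub>R (\<epsilon> *\<^sub>R V)) (\<lambda>t. g t + tent' c h t *\<^sub>R (\<epsilon> *\<^sub>R V))"
    by (intro has_L2_derivative_add Z has_L2_derivative_tent h)
  have tz: "tent c h 0 = 0" "tent c h 1 = 0"
    using h by (intro tent_bounds(3); simp add: abs_if)+
  have "0 \<le> (LINT t:{0..1}|lborel. kinetic m (g t + tent' c h t *\<^sub>R (\<epsilon> *\<^sub>R V)) - kinetic m (g t) + f t)"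
    by (rule comparison[OF Y _ _ _ f]) (use tz cf le in \<open>simp_all add: mult.commute\<close>)
  also have "\<dots> \<le> (LINT t:{0..1}|lborel. 2 * \<epsilon> * (tent' c h t * ?b t) + \<epsilon>\<^sup>2 * (4 / h\<^sup>2 * kinetic m V) + f t)"
  proof (rule set_integral_mono)
    show "set_integrable lborel {0..1} (\<lambda>t. kinetic m (g t + tent' c h t *\<^sub>R (\<epsilon> *\<^sub>R V)) - kinetic m (g t) + f t)"
      by (intro set_integral_add(1) set_integral_diff(1) f set_integrable_kinetic[OF Y] set_integrable_kinetic[OF Z])
    show "set_integrable lborel {0..1} (\<lambda>t. 2 * \<epsilon> * (tent' c h t * ?b t) + \<epsilon>\<^sup>2 * (4 / h\<^sup>2 * kinetic m V) + f t)"
      by (intro set_integral_add(1) f set_integrable_mult_right T) (simp add: set_integrable_def)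
    fix t :: real
    have "\<epsilon>\<^sup>2 * ((tent' c h t)\<^sup>2 * kinetic m V) \<le> \<epsilon>\<^sup>2 * (4 / h\<^sup>2 * kinetic m V)"
      by (intro mult_left_mono mult_right_mono tent'_bound[OF h(1)] kinetic_nonneg[OF m]) simp
    then show "kinetic m (g t + tent' c h t *\<^sub>R (\<epsilon> *\<^sub>R V)) - kinetic m (g t) + f t
       \<le> 2 * \<epsilon> * (tent' c h t * ?b t) + \<epsilon>\<^sup>2 * (4 / h\<^sup>2 * kinetic m V) + f t"
      unfolding scaleR_scaleR kinetic_add_scaleR by (simp add: power_mult_distrib algebra_simps)
  qed
  also have "\<dots> = 2 * \<epsilon> * ((2 * kinetic_inner m (Z c) V - kinetic_inner m (Z (c - h)) V - kinetic_inner m (Z (c + h)) V) / h)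
     + \<epsilon>\<^sup>2 * (4 / h\<^sup>2 * kinetic m V) + (LINT t:{0..1}|lborel. f t)"
  proof -
    have c: "set_integrable lborel {0..1} (\<lambda>t::real. \<epsilon>\<^sup>2 * (4 / h\<^sup>2 * kinetic m V))"
      by (simp add: set_integrable_def)
    have a: "set_integrable lborel {0..1} (\<lambda>t. 2 * \<epsilon> * (tent' c h t * ?b t))"
      by (rule set_integrable_mult_right) (rule T)
    have "(LINT t:{0..1::real}|lborel. \<epsilon>\<^sup>2 * (4 / h\<^sup>2 * kinetic m V)) = \<epsilon>\<^sup>2 * (4 / h\<^sup>2 * kinetic m V)"
      unfolding set_lebesgue_integral_def by simp
    then show ?thesis
      unfolding set_integral_add(2)[OF set_integral_add(1)[OF a c] f] set_integral_add(2)[OF a c]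
        set_integral_mult_right T(2) by simp
  qed
  also have "2 * kinetic_inner m (Z c) V - kinetic_inner m (Z (c - h)) V - kinetic_inner m (Z (c + h)) V
     = kinetic_inner m (2 *\<^sub>R Z c - Z (c - h) - Z (c + h)) V"
    by (simp add: B.diff B.scaleR)
  finally show ?thesis by simp
qed

end

section \<open>Absence of collisions\<close>

text \<open>The limiting pair of cones \<open>a = 0\<close>, \<open>b = pi / 2\<close>, written by
  the signs of coordinates.\<close>

definition quadrants :: "(complex \<times> complex) set" where
  "quadrants = {z. 0 \<le> Re (fst z) \<and> 0 \<le> Im (fst z) \<and> Re (snd z) \<le> 0 \<and> 0 \<le> Im (snd z)}"

text \<open>A direction in which none of the three mutual distances decreases on \<^const>\<open>quadrants\<close>.\<close>

definition separating :: "complex \<times> complex" where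
  "separating = (Complex 2 2, Complex (-1) 1)"

text \<open>Along \<open>separating\<close> the vector q3 - q2 moves by
  \<open>Complex (2 * s) (2 * s)\<close>, q1 - q2 by \<open>2 * s\<close> in its imaginary part and
  q3 - q1 by \<open>2 * s\<close> in its real part. On \<open>quadrants\<close> all these
  coordinates are nonnegative, so they can only grow in modulus.\<close>

lemma separating_distances:
  assumes z: "z \<in> quadrants" and s: "s \<ge> 0"
  shows "cmod (fst z) \<le> cmod (fst (z + s *\<^sub>R separating))"
    and "cmod (fst z / 2 + snd z) \<le> cmod (fst (z + s *\<^sub>R separating) / 2 + snd (z + s *\<^sub>R separating))"
    and "cmod (fst z / 2 - snd z) \<le> cmod (fst (z + s *\<^sub>R separating) / 2 - snd (z + s *\<^sub>R separating))"
    and "2 * s \<le> cmod (fst (z + s *\<^sub>R separating))"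
    and "2 * s \<le> cmod (fst (z + s *\<^sub>R separating) / 2 + snd (z + s *\<^sub>R separating))"
    and "2 * s \<le> cmod (fst (z + s *\<^sub>R separating) / 2 - snd (z + s *\<^sub>R separating))"
proof -
  have q: "0 \<le> Re (fst z)" "0 \<le> Im (fst z)" "Re (snd z) \<le> 0" "0 \<le> Im (snd z)"
    using z by (auto simp: quadrants_def)
  have sq: "a\<^sup>2 \<le> (a + 2 * s)\<^sup>2" if "a \<ge> 0" for a
    using that s by (intro power_mono) auto
  have e0: "Re (fst (z + s *\<^sub>R separating)) = Re (fst z) + 2 * s" "Im (fst (z + s *\<^sub>R separating)) = Im (fst z) + 2 * s"
    and e1: "Re (fst (z + s *\<^sub>R separating) / 2 + snd (z + s *\<^sub>R separating)) = Re (fst z / 2 + snd z)"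
      "Im (fst (z + s *\<^sub>R separating) / 2 + snd (z + s *\<^sub>R separating)) = Im (fst z / 2 + snd z) + 2 * s"
    and e2: "Re (fst (z + s *\<^sub>R separating) / 2 - snd (z + s *\<^sub>R separating)) = Re (fst z / 2 - snd z) + 2 * s"
      "Im (fst (z + s *\<^sub>R separating) / 2 - snd (z + s *\<^sub>R separating)) = Im (fst z / 2 - snd z)"
    by (simp_all add: separating_def add_divide_distrib)
  have p: "0 \<le> Im (fst z / 2 + snd z)" "0 \<le> Re (fst z / 2 - snd z)" using q by auto
  show "cmod (fst z) \<le> cmod (fst (z + s *\<^sub>R separating))"
    unfolding cmod_def e0 by (intro real_sqrt_le_mono add_mono sq q)
  show "cmod (fst z / 2 + snd z) \<le> cmod (fst (z + s *\<^sub>R separating) / 2 + snd (z + s *\<^sub>R separating))"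
    unfolding cmod_def e1 by (intro real_sqrt_le_mono add_mono sq p order_refl)
  show "cmod (fst z / 2 - snd z) \<le> cmod (fst (z + s *\<^sub>R separating) / 2 - snd (z + s *\<^sub>R separating))"
    unfolding cmod_def e2 by (intro real_sqrt_le_mono add_mono sq p order_refl)
  show "2 * s \<le> cmod (fst (z + s *\<^sub>R separating))"
    using complex_Re_le_cmod[of "fst (z + s *\<^sub>R separating)"] q unfolding e0 by linarith
  show "2 * s \<le> cmod (fst (z + s *\<^sub>R separating) / 2 + snd (z + s *\<^sub>R separating))"
    using abs_Im_le_cmod[of "fst (z + s *\<^sub>R separating) / 2 + snd (z + s *\<^sub>R separating)"] p unfolding e1 by linarith
  show "2 * s \<le> cmod (fst (z + s *\<^sub>R separating) / 2 - snd (z + s *\<^sub>R separating))"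
    using complex_Re_le_cmod[of "fst (z + s *\<^sub>R separating) / 2 - snd (z + s *\<^sub>R separating)"] p unfolding e2 by linarith
qed

lemma collision_free_separating:
  assumes "z \<in> quadrants" "s \<ge> 0" "collision_free z \<or> s > 0"
  shows "collision_free (z + s *\<^sub>R separating)"
  using assms(3)
proof
  assume "collision_free z"
  then have "0 < cmod (fst z)" "0 < cmod (fst z / 2 + snd z)" "0 < cmod (fst z / 2 - snd z)"
    unfolding collision_free_def by auto
  from this[THEN less_le_trans] separating_distances(1-3)[OF assms(1,2)] show ?thesis
    unfolding collision_free_def by (metis norm_zero less_irrefl)
next
  assume "s > 0"
  then show ?thesis
    using separating_distances(4-6)[OF assms(1,2)] unfolding collision_free_def
    by (metis norm_zero not_less mult_pos_pos zero_less_numeral)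
qed

lemma real_potential_separating_le:
  assumes "m > 0" "z \<in> quadrants" "s > 0"
  shows "real_potential m (z + s *\<^sub>R separating) \<le> (m\<^sup>2 + 2 * m) / 2 * (1 / s)"
proof -
  have "real_potential m (z + s *\<^sub>R separating) \<le> m\<^sup>2 / (2 * s) + m / (2 * s) + m / (2 * s)"
  proof -
    have s: "s \<ge> 0" using assms by simp
    note D = separating_distances(4-6)[OF assms(2) s]
    show ?thesis
      unfolding real_potential_def
      by (intro add_mono divide_left_mono mult_pos_pos; (use D assms in \<open>linarith | simp\<close>))
  qed
  also have "\<dots> = (m\<^sup>2 + 2 * m) / 2 * (1 / s)" using assms by (simp add: field_simps)
  finally show ?thesis .
qed

text \<open>By symmetry let \<open>r\<close> be the smaller of \<open>t\<close> and
  \<open>1 - t\<close>. Since \<open>(1 - r) powr (2/3)\<close> is at least \<open>1 - r\<close>, at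
  most \<open>r = r powr (2/3) * r powr (1/3)\<close> is lost from \<open>r powr (2/3)\<close>, and
  \<open>r powr (1/3) \<le> 4/5\<close> leaves a fifth of it.\<close>

lemma powr_two_thirds_lower_bound:
  fixes t :: real
  assumes t: "0 < t" "t < 1"
  shows "0 < t powr (2/3) + ((1 - t) powr (2/3) - 1)"
    and "1 / (t powr (2/3) + ((1 - t) powr (2/3) - 1)) \<le> 5 * (t powr (-2/3) + (1 - t) powr (-2/3))"
proof -
  have aux: "r powr (2/3) / 5 \<le> r powr (2/3) + (1 - r) powr (2/3) - 1" if r: "0 < r" "r \<le> 1/2" for r :: real
  proof -
    have "(1 - r) powr 1 \<le> (1 - r) powr (2/3)" using r by (intro powr_mono') auto
    then have 1: "1 - r \<le> (1 - r) powr (2/3)" using r by simp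
    \<comment> \<open>The cube of 4/5 is 64/125, just above 1/2.\<close>
    have "r powr (1/3) \<le> ((4/5) powr 3) powr (1/3)" using r by (intro powr_mono2) (auto simp: power_divide)
    also have "((4/5::real) powr 3) powr (1/3) = 4/5" by (subst powr_powr) simp
    finally have "r powr (1/3) \<le> 4/5" .
    then have "r powr (2/3) * r powr (1/3) \<le> r powr (2/3) * (4/5)"
      by (intro mult_left_mono) auto
    moreover have "r powr (2/3) * r powr (1/3) = r" using r by (simp add: powr_add[symmetric])
    ultimately show ?thesis using 1 by simp
  qed
  consider "t \<le> 1/2" | "1 - t \<le> 1/2" by linarith
  then obtain r where r: "r = t \<or> r = 1 - t" "r powr (2/3) / 5 \<le> t powr (2/3) + ((1 - t) powr (2/3) - 1)" "0 < r"
  proof cases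
    case 1
    show ?thesis by (rule that[of t]) (use aux[OF t(1) 1] t in \<open>simp, linarith, simp\<close>)
  next
    case 2
    have "(1 - t) powr (2/3) / 5 \<le> (1 - t) powr (2/3) + t powr (2/3) - 1" using aux[OF _ 2] t by simp
    then show ?thesis by (intro that[of "1 - t"]) (simp, linarith, use t in simp)
  qed
  have p: "0 < r powr (2/3) / 5" using r(3) by simp
  show "0 < t powr (2/3) + ((1 - t) powr (2/3) - 1)" by (rule less_le_trans[OF p r(2)])
  have "1 / (t powr (2/3) + ((1 - t) powr (2/3) - 1)) \<le> 1 / (r powr (2/3) / 5)"
    by (rule divide_left_mono[OF r(2) _ mult_pos_pos[OF less_le_trans[OF p r(2)] p]]) simp
  also have "\<dots> = 5 * r powr (-2/3)" by (simp add: powr_minus_divide)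
  also have "\<dots> \<le> 5 * (t powr (-2/3) + (1 - t) powr (-2/3))" using r(1) by auto
  finally show "1 / (t powr (2/3) + ((1 - t) powr (2/3) - 1)) \<le> 5 * (t powr (-2/3) + (1 - t) powr (-2/3))" .
qed

section \<open>Finiteness of the minimal action\<close>

lemma quadrants_convex:
  assumes "x \<in> quadrants" "y \<in> quadrants" "0 \<le> t" "t \<le> 1"
  shows "x + t *\<^sub>R (y - x) \<in> quadrants"
proof -
  have *: "0 \<le> a + t * (b - a)" if "0 \<le> a" "0 \<le> b" for a b
  proof -
    have "a + t * (b - a) = (1 - t) * a + t * b" by (simp add: algebra_simps)
    then show ?thesis using that assms by simp
  qed
  show ?thesis
    using assms(1,2) *[of "Re (fst x)" "Re (fst y)"] *[of "Im (fst x)" "Im (fst y)"]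
      *[of "- Re (snd x)" "- Re (snd y)"] *[of "Im (snd x)" "Im (snd y)"]
    unfolding quadrants_def by (simp add: algebra_simps)
qed

text \<open>
  Ejecting all bodies from each other like \<open>t powr (2/3)\<close> at the ends, as in a total collision,
  keeps both the kinetic energy and the potential integrable.
\<close>

lemma exists_path_finite_action:
  assumes m: "m > 0" and x: "x \<in> quadrants" and y: "y \<in> quadrants"
  shows "\<exists>W\<in>paths x y. action m W < \<infinity>"
proof -
  \<comment> \<open>Adding -1 makes \<open>s\<close> vanish at 0 and at 1, so the perturbed affine
    path keeps its ends.\<close>
  define s :: "real \<Rightarrow> real" where "s t = t powr (2/3) + ((1 - t) powr (2/3) + (- 1))" for t
  define W where "W t = (x + (max 0 (t - 0)) *\<^sub>R (y - x)) + s t *\<^sub>R separating" for t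
  have "\<exists>h. has_L2_derivative s h"
    unfolding s_def[abs_def]
    by (rule exI, rule has_L2_derivative_add[OF has_L2_derivative_powr_two_thirds(1)
          has_L2_derivative_add[OF has_L2_derivative_powr_two_thirds(2) has_L2_derivative_const]])
  then obtain h where h: "has_L2_derivative s h" ..
  have "\<exists>g. has_L2_derivative W g"
    unfolding W_def[abs_def]
    by (rule exI, rule has_L2_derivative_add[OF has_L2_derivative_add[OF has_L2_derivative_const
          has_L2_derivative_linear[OF bounded_linear_scaleR_left has_L2_derivative_ramp[OF order_refl]]]
          has_L2_derivative_linear[OF bounded_linear_scaleR_left h]])
  then obtain g where g: "has_L2_derivative W g" ..
  have sp: "s t > 0" "1 / s t \<le> 5 * (t powr (-2/3) + (1 - t) powr (-2/3))" if "0 < t" "t < 1" for t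
    using powr_two_thirds_lower_bound[OF that] unfolding s_def by simp_all
  have q: "x + max 0 (t - 0) *\<^sub>R (y - x) \<in> quadrants" if "0 < t" "t < 1" for t
    using quadrants_convex[OF x y, of t] that by simp
  have ae: "AE t in lborel. t \<in> {0..1} \<longrightarrow> 0 < t \<and> t < (1::real)"
    using AE_lborel_singleton[of "0::real"] AE_lborel_singleton[of "1::real"] by eventually_elim auto
  let ?F = "\<lambda>t. (m\<^sup>2 + 2 * m) / 2 * (5 * (t powr (-2/3) + (1 - t) powr (-2/3)))"
  have "action m W \<le> ennreal (LINT t:{0..1}|lborel. kinetic m (g t) + ?F t)"
  proof (rule action_le(1)[OF m g])
    show "AE t in lborel. t \<in> {0..1} \<longrightarrow> collision_free (W t)"
      using ae by eventually_elim
        (auto simp: W_def intro!: collision_free_separating quadrants_convex[OF x y] sp less_imp_le[OF sp(1)])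
    show "set_integrable lborel {0..1} ?F"
      by (intro set_integrable_mult_right set_integral_add(1) has_L2_derivative_powr_two_thirds)
    show "AE t in lborel. t \<in> {0..1} \<longrightarrow> real_potential m (W t) \<le> ?F t"
      using ae
    proof eventually_elim
      fix t assume t: "t \<in> {0..1} \<longrightarrow> 0 < t \<and> t < (1::real)"
      have "real_potential m (W t) \<le> ?F t" if "0 < t" "t < 1"
      proof -
        have "real_potential m (W t) \<le> (m\<^sup>2 + 2 * m) / 2 * (1 / s t)"
          unfolding W_def by (intro real_potential_separating_le m q sp that)
        also have "\<dots> \<le> ?F t" using m by (intro mult_left_mono sp that) auto
        finally show ?thesis .
      qed
      then show "t \<in> {0..1} \<longrightarrow> real_potential m (W t) \<le> ?F t" using t by blast
    qed
  qed
  also have "\<dots> < \<infinity>" by simp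
  finally have "action m W < \<infinity>" .
  moreover have "W 0 = x" "W 1 = y" by (auto simp: W_def s_def)
  ultimately show ?thesis using g unfolding paths_def H1_def by blast
qed

text \<open>If all competitors had infinite action, minimality would carry no information; the
  ejection path excludes this.\<close>

lemma minimizer_finite:
  assumes m: "m > 0" and mi: "action_minimizer m Z" and ends: "Z 0 \<in> quadrants" "Z 1 \<in> quadrants"
  obtains g where "finite_minimizer m Z g"
proof -
  obtain W where W: "W \<in> paths (Z 0) (Z 1)" "action m W < \<infinity>"
    using exists_path_finite_action[OF m ends] by blast
  have "action m Z \<le> action m W"
    using mi W(1) unfolding action_minimizer_def by (metis INF_lower)
  then have "action m Z < \<infinity>" using W(2) by simp
  moreover obtain g where "has_L2_derivative Z g"
    using mi unfolding action_minimizer_def paths_def H1_def by blast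
  ultimately show ?thesis using m mi that[of g] by (simp add: finite_minimizer_def)
qed

text \<open>Over a time \<open>\<epsilon>\<^sup>2\<close> an H^1 path moves only by
  o(\<open>\<epsilon>\<close>), because the integral of the squared speed over a short interval is
  small by continuity. This beats the order \<open>\<epsilon>\<close> given by a mere bound of that
  integral, and collisions are excluded by this margin.\<close>

lemma L2_derivative_increment_small:
  assumes u: "has_L2_derivative u \<gamma>" and c: "0 < c" "c < 1" and \<eta>: "\<eta> > 0"
  shows "\<exists>\<delta>>0. \<forall>\<epsilon> t. 0 < \<epsilon> \<longrightarrow> \<epsilon> < \<delta> \<longrightarrow> t \<in> {0..1} \<longrightarrow> \<bar>t - c\<bar> \<le> \<epsilon>\<^sup>2 \<longrightarrow> norm (u t - u c) \<le> \<eta> * \<epsilon>"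
proof -
  let ?n = "\<lambda>x. (norm (\<gamma> x))\<^sup>2"
  have ni: "?n integrable_on {r..s}" if "0 \<le> r" "r \<le> s" "s \<le> 1" for r s
    by (rule has_L2_derivative_diff(4)[OF u that])
  have "continuous_on {0..1} (\<lambda>x. integral {0..x} ?n)"
    by (intro indefinite_integral_continuous_1 ni) auto
  then obtain d where d: "d > 0" "\<And>x. x \<in> {0..1} \<Longrightarrow> dist x c < d \<Longrightarrow> dist (integral {0..x} ?n) (integral {0..c} ?n) < \<eta>\<^sup>2"
    using c \<eta> unfolding continuous_on_iff by (metis atLeastAtMost_iff less_imp_le zero_less_power)
  have diff: "integral {0..s} ?n - integral {0..r} ?n = integral {r..s} ?n" if "0 \<le> r" "r \<le> s" "s \<le> 1" for r s
    using Henstock_Kurzweil_Integration.integral_combine[OF that(1,2) ni] that by simp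
  have bd: "norm (u s - u r) \<le> \<eta> * \<epsilon>"
    if "0 \<le> r" "r \<le> s" "s \<le> 1" "s - r \<le> \<epsilon>\<^sup>2" "0 < \<epsilon>" "integral {r..s} ?n \<le> \<eta>\<^sup>2" for r s \<epsilon>
  proof -
    \<comment> \<open>With the weight \<open>\<epsilon> / \<eta>\<close> both terms are at most
      \<open>\<eta> * \<epsilon>\<close>.\<close>
    have "norm (u s - u r) \<le> ((\<epsilon> / \<eta>) * integral {r..s} ?n + (s - r) / (\<epsilon> / \<eta>)) / 2"
      by (rule has_L2_derivative_norm_le_weighted[OF u that(1-3)]) (use that \<eta> in simp)
    also have "\<dots> \<le> ((\<epsilon> / \<eta>) * \<eta>\<^sup>2 + \<epsilon>\<^sup>2 / (\<epsilon> / \<eta>)) / 2"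
      using that \<eta> by (intro divide_right_mono add_mono mult_left_mono) auto
    also have "\<dots> = \<eta> * \<epsilon>" using that \<eta> by (simp add: field_simps power2_eq_square)
    finally show ?thesis .
  qed
  show ?thesis
  proof (intro exI[of _ "min 1 d"] conjI allI impI)
    show "0 < min 1 d" using d by simp
    fix \<epsilon> t assume \<epsilon>: "0 < \<epsilon>" "\<epsilon> < min 1 d" and t: "t \<in> {0..1}" "\<bar>t - c\<bar> \<le> \<epsilon>\<^sup>2"
    have "\<epsilon>\<^sup>2 \<le> \<epsilon>" using \<epsilon> by (simp add: power2_eq_square mult_left_le)
    then have "\<bar>t - c\<bar> < d" using \<epsilon> t by linarith
    then have D: "\<bar>integral {0..t} ?n - integral {0..c} ?n\<bar> < \<eta>\<^sup>2"
      using d(2)[OF t(1)] by (simp add: dist_real_def)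
    show "norm (u t - u c) \<le> \<eta> * \<epsilon>"
    proof (cases "t \<le> c")
      case True
      then have "norm (u c - u t) \<le> \<eta> * \<epsilon>"
        by (intro bd) (use D diff[of t c] t c \<epsilon> in auto)
      then show ?thesis by (simp add: norm_minus_commute)
    next
      case False
      then show ?thesis
        by (intro bd) (use D diff[of c t] t c \<epsilon> in auto)
    qed
  qed
qed

section \<open>Removal of interior collisions\<close>

context finite_minimizer
begin

text \<open>Here \<open>d\<close> stands for one of the three mutual position vectors. If it
  vanishes at \<open>c\<close>, it has length at most \<open>\<epsilon> / M\<close> during a time
  \<open>2 * \<epsilon>\<^sup>2\<close>, while the pushed vector has length at least
  \<open>\<epsilon>\<close>. The potential then gains \<open>2 * k * (M - 1) * \<epsilon>\<close>,
  against a kinetic cost of order \<open>\<epsilon>\<close> whose constant does not depend on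
  \<open>M\<close>.\<close>

lemma linear_distance_nonzero:
  fixes d :: "complex \<times> complex \<Rightarrow> complex"
  assumes Q: "\<And>t. t \<in> {0..1} \<Longrightarrow> Z t \<in> quadrants"
    and d: "bounded_linear d" and k: "k > 0"
    and far: "\<And>z s. z \<in> quadrants \<Longrightarrow> s \<ge> 0 \<Longrightarrow> 2 * s \<le> cmod (d (z + s *\<^sub>R separating))"
    and nz: "\<And>z. collision_free z \<Longrightarrow> d z \<noteq> 0"
    and gain: "\<And>z s. z \<in> quadrants \<Longrightarrow> s \<ge> 0 \<Longrightarrow> collision_free z \<Longrightarrow>
       real_potential m (z + s *\<^sub>R separating)
         \<le> real_potential m z - k * max 0 (1 / cmod (d z) - 1 / cmod (d (z + s *\<^sub>R separating)))"
    and c: "0 < c" "c < 1"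
  shows "d (Z c) \<noteq> 0"
proof
  assume d0: "d (Z c) = 0"
  define h where "h = min c (1 - c)"
  have h: "h > 0" "0 \<le> c - h" "c + h \<le> 1" using c by (auto simp: h_def)
  define B where "B = 2 / h * kinetic_inner m (2 *\<^sub>R Z c - Z (c - h) - Z (c + h)) separating"
  define E where "E = 4 / h\<^sup>2 * kinetic m separating"
  \<comment> \<open>Chosen so that \<open>k * (M - 1)\<close> exceeds the kinetic cost
    \<open>B + \<epsilon> * E\<close> for all \<open>\<epsilon> \<le> 1\<close>.\<close>
  define M where "M = 1 + (\<bar>B\<bar> + \<bar>E\<bar> + 1) / k"
  have M: "M > 1" using k by (simp add: M_def)
  have "1 / M > 0" using M by simp
  then obtain \<delta> where \<delta>: "\<delta> > 0" "\<And>\<epsilon> t. 0 < \<epsilon> \<Longrightarrow> \<epsilon> < \<delta> \<Longrightarrow> t \<in> {0..1} \<Longrightarrow> \<bar>t - c\<bar> \<le> \<epsilon>\<^sup>2 \<Longrightarrow>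
       norm (d (Z t) - d (Z c)) \<le> (1 / M) * \<epsilon>"
    using L2_derivative_increment_small[OF has_L2_derivative_linear[OF d Z] c] by metis
  define \<epsilon> where "\<epsilon> = min (\<delta> / 2) (min 1 (h / 2))"
  have \<epsilon>: "0 < \<epsilon>" "\<epsilon> < \<delta>" "\<epsilon> \<le> 1" "\<epsilon> \<le> h / 2" using \<delta>(1) h by (auto simp: \<epsilon>_def)
  \<comment> \<open>On the time window the tent is then at least 1/2, which together with the factor
    2 in \<open>far\<close> pushes the bodies apart by at least \<open>\<epsilon>\<close>.\<close>
  have \<epsilon>2: "\<epsilon>\<^sup>2 \<le> h / 2" using \<epsilon> mult_left_le[of \<epsilon> \<epsilon>] unfolding power2_eq_square by linarith
  let ?I = "{c - \<epsilon>\<^sup>2..c + \<epsilon>\<^sup>2}"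
  define f where "f t = indicator ?I t * (- (k * (M - 1) / \<epsilon>))" for t
  have I: "?I \<subseteq> {0..1}" using \<epsilon>2 h by auto
  have fe: "indicat_real {0..1} t *\<^sub>R f t = indicat_real ?I t *\<^sub>R (- (k * (M - 1) / \<epsilon>))" for t
    using I by (auto simp: f_def indicator_def)
  have "0 \<le> 2 * \<epsilon> / h * kinetic_inner m (2 *\<^sub>R Z c - Z (c - h) - Z (c + h)) separating
      + \<epsilon>\<^sup>2 * (4 / h\<^sup>2 * kinetic m separating) + (LINT t:{0..1}|lborel. f t)"
  proof (rule tent_variation[OF h])
    note cf = action_finite(1)[OF m Z fin]
    have te: "0 \<le> \<epsilon> * tent c h t" for t using tent_bounds(1)[OF h(1)] \<epsilon> by simp
    show "AE t in lborel. t \<in> {0..1} \<longrightarrow> collision_free (Z t + (\<epsilon> * tent c h t) *\<^sub>R separating)"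
      using cf by eventually_elim (use te Q in \<open>auto intro!: collision_free_separating\<close>)
    show "set_integrable lborel {0..1} f"
      unfolding set_integrable_def fe
      by (intro integrable_scaleR_left) (simp add: emeasure_lborel_Icc_eq)
    show "AE t in lborel. t \<in> {0..1} \<longrightarrow>
        real_potential m (Z t + (\<epsilon> * tent c h t) *\<^sub>R separating) \<le> real_potential m (Z t) + f t"
      using cf
    proof eventually_elim
      fix t assume cft: "t \<in> {0..1} \<longrightarrow> collision_free (Z t)"
      have "real_potential m (Z t + (\<epsilon> * tent c h t) *\<^sub>R separating) \<le> real_potential m (Z t) + f t" if t: "t \<in> {0..1}"
      proof (cases "t \<in> ?I")
        case False
        have "0 \<le> k * max 0 (1 / cmod (d (Z t)) - 1 / cmod (d (Z t + (\<epsilon> * tent c h t) *\<^sub>R separating)))"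
          using k by simp
        with gain[OF Q[OF t] te[of t]] cft t False show ?thesis by (simp add: f_def)
      next
        case True
        then have tc: "\<bar>t - c\<bar> \<le> \<epsilon>\<^sup>2" by (auto simp: abs_if)
        then have "\<bar>t - c\<bar> / h \<le> 1/2" using \<epsilon>2 h by (simp add: field_simps)
        then have "1/2 \<le> 1 - \<bar>t - c\<bar> / h" by linarith
        then have "tent c h t \<ge> 1/2" unfolding tent_bounds(5)[OF h(1)] by (rule max.coboundedI2)
        then have "\<epsilon> * 1 \<le> \<epsilon> * (2 * tent c h t)" using \<epsilon> by (intro mult_left_mono) auto
        then have D: "\<epsilon> \<le> cmod (d (Z t + (\<epsilon> * tent c h t) *\<^sub>R separating))"
          using far[OF Q[OF t] te[of t]] by simp
        have "cmod (d (Z t)) \<le> (1 / M) * \<epsilon>" using \<delta>(2)[OF \<epsilon>(1,2) t tc] d0 by simp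
        moreover have "0 < cmod (d (Z t))" using nz cft t by simp
        ultimately have "1 / ((1 / M) * \<epsilon>) \<le> 1 / cmod (d (Z t))"
          using \<epsilon> M by (intro divide_left_mono mult_pos_pos) auto
        moreover have "1 / cmod (d (Z t + (\<epsilon> * tent c h t) *\<^sub>R separating)) \<le> 1 / \<epsilon>"
          using D \<epsilon> by (intro divide_left_mono mult_pos_pos) auto
        ultimately have "(M - 1) / \<epsilon> \<le> max 0 (1 / cmod (d (Z t)) - 1 / cmod (d (Z t + (\<epsilon> * tent c h t) *\<^sub>R separating)))"
          using \<epsilon> M by (simp add: diff_divide_distrib)
        then have "k * ((M - 1) / \<epsilon>) \<le> k * max 0 (1 / cmod (d (Z t)) - 1 / cmod (d (Z t + (\<epsilon> * tent c h t) *\<^sub>R separating)))"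
          using k by (intro mult_left_mono) auto
        with gain[OF Q[OF t] te[of t]] cft t True show ?thesis by (simp add: f_def)
      qed
      then show "t \<in> {0..1} \<longrightarrow>
        real_potential m (Z t + (\<epsilon> * tent c h t) *\<^sub>R separating) \<le> real_potential m (Z t) + f t" by blast
    qed
  qed
  also have "(LINT t:{0..1}|lborel. f t) = - 2 * \<epsilon> * (k * (M - 1))"
    unfolding set_lebesgue_integral_def fe using \<epsilon>
    by (simp add: power2_eq_square field_simps)
  finally have "0 \<le> \<epsilon> * (B + \<epsilon> * E - 2 * (k * (M - 1)))"
    by (simp add: B_def E_def power2_eq_square algebra_simps)
  then have "0 \<le> B + \<epsilon> * E - 2 * (k * (M - 1))" using \<epsilon>(1) by (simp add: zero_le_mult_iff)
  moreover have "\<epsilon> * E \<le> \<bar>E\<bar>"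
  proof -
    have "\<epsilon> * E \<le> \<epsilon> * \<bar>E\<bar>" using \<epsilon> by (intro mult_left_mono) auto
    also have "\<dots> \<le> \<bar>E\<bar>" using \<epsilon> by (simp add: mult_left_le_one_le)
    finally show ?thesis .
  qed
  moreover have "k * (M - 1) = \<bar>B\<bar> + \<bar>E\<bar> + 1" using k by (simp add: M_def)
  ultimately show False by linarith
qed

text \<open>Pushing along \<open>separating\<close> increases none of the three terms of the
  potential, so the drop of the singular term alone can be kept as the gain.\<close>

lemma no_collision:
  assumes Q: "\<And>t. t \<in> {0..1} \<Longrightarrow> Z t \<in> quadrants" and c: "0 < c" "c < 1"
  shows "collision_free (Z c)"
proof -
  have mono: "k / b \<le> k / a - k * max 0 (1 / a - 1 / b)" "k / b \<le> k / a" if "0 < a" "a \<le> b" "0 < k" for a b k :: real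
  proof -
    have "1 / b \<le> 1 / a" using that by (intro divide_left_mono mult_pos_pos) auto
    then show "k / b \<le> k / a - k * max 0 (1 / a - 1 / b)" by (simp add: algebra_simps)
    show "k / b \<le> k / a" using that by (intro divide_left_mono mult_pos_pos) auto
  qed
  have m2: "m\<^sup>2 > 0" using m by simp
  have pos: "0 < cmod (fst z)" "0 < cmod (fst z / 2 + snd z)" "0 < cmod (fst z / 2 - snd z)" if "collision_free z" for z
    using that unfolding collision_free_def by auto
  note L = bounded_linear_fst bounded_linear_snd
  have lin: "bounded_linear (\<lambda>z::complex \<times> complex. fst z / 2 + snd z)"
    "bounded_linear (\<lambda>z::complex \<times> complex. fst z / 2 - snd z)"
    using bounded_linear_add[OF bounded_linear_compose[OF bounded_linear_divide[of 2] L(1)] L(2)]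
      bounded_linear_sub[OF bounded_linear_compose[OF bounded_linear_divide[of 2] L(1)] L(2)] by simp_all
  have "fst (Z c) \<noteq> 0"
  proof (rule linear_distance_nonzero[OF Q L(1) m2 _ _ _ c])
    fix z s assume z: "z \<in> quadrants" "(s::real) \<ge> 0" "collision_free z"
    note P = pos[OF z(3)] and D = separating_distances[OF z(1,2)]
    show "real_potential m (z + s *\<^sub>R separating) \<le> real_potential m z
       - m\<^sup>2 * max 0 (1 / cmod (fst z) - 1 / cmod (fst (z + s *\<^sub>R separating)))"
      using mono(1)[OF P(1) D(1) m2] mono(2)[OF P(2) D(2) m] mono(2)[OF P(3) D(3) m]
      unfolding real_potential_def by linarith
  qed (use separating_distances(4) in \<open>auto simp: collision_free_def\<close>)
  moreover have "fst (Z c) / 2 + snd (Z c) \<noteq> 0"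
  proof (rule linear_distance_nonzero[OF Q lin(1) m _ _ _ c])
    fix z s assume z: "z \<in> quadrants" "(s::real) \<ge> 0" "collision_free z"
    note P = pos[OF z(3)] and D = separating_distances[OF z(1,2)]
    show "real_potential m (z + s *\<^sub>R separating) \<le> real_potential m z
       - m * max 0 (1 / cmod (fst z / 2 + snd z)
           - 1 / cmod (fst (z + s *\<^sub>R separating) / 2 + snd (z + s *\<^sub>R separating)))"
      using mono(2)[OF P(1) D(1) m2] mono(1)[OF P(2) D(2) m] mono(2)[OF P(3) D(3) m]
      unfolding real_potential_def by linarith
  qed (use separating_distances(5) in \<open>auto simp: collision_free_def\<close>)
  moreover have "fst (Z c) / 2 - snd (Z c) \<noteq> 0"
  proof (rule linear_distance_nonzero[OF Q lin(2) m _ _ _ c])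
    fix z s assume z: "z \<in> quadrants" "(s::real) \<ge> 0" "collision_free z"
    note P = pos[OF z(3)] and D = separating_distances[OF z(1,2)]
    show "real_potential m (z + s *\<^sub>R separating) \<le> real_potential m z
       - m * max 0 (1 / cmod (fst z / 2 - snd z)
           - 1 / cmod (fst (z + s *\<^sub>R separating) / 2 - snd (z + s *\<^sub>R separating)))"
      using mono(2)[OF P(1) D(1) m2] mono(2)[OF P(2) D(2) m] mono(1)[OF P(3) D(3) m]
      unfolding real_potential_def by linarith
  qed (use separating_distances(6) in \<open>auto simp: collision_free_def\<close>)
  ultimately show ?thesis unfolding collision_free_def by blast
qed

end

section \<open>The first variation\<close>

text \<open>The derivative of \<open>real_potential m\<close> at a collision-free \<open>z\<close>
  in the direction \<open>V\<close>.\<close>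

definition force :: "real \<Rightarrow> complex \<times> complex \<Rightarrow> complex \<times> complex \<Rightarrow> real" where
  "force m V z = - (m\<^sup>2 * (fst z \<bullet> fst V) / cmod (fst z) ^ 3
     + m * ((fst z / 2 + snd z) \<bullet> (fst V / 2 + snd V)) / cmod (fst z / 2 + snd z) ^ 3
     + m * ((fst z / 2 - snd z) \<bullet> (fst V / 2 - snd V)) / cmod (fst z / 2 - snd z) ^ 3)"

text \<open>A Taylor estimate for the reciprocal of \<open>r\<close> as a function of
  \<open>r\<^sup>2\<close>, with an exact algebraic remainder. Squares are the right variable
  because the squared length of \<open>a + \<delta> *\<^sub>R v\<close> is a polynomial in
  \<open>\<delta>\<close>.\<close>

lemma inverse_second_order:
  fixes r r' c :: real
  assumes c: "c > 0" and r: "c \<le> r" and r': "c \<le> r'"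
  shows "1 / r' \<le> 1 / r - (r'\<^sup>2 - r\<^sup>2) / (2 * r ^ 3) + (r'\<^sup>2 - r\<^sup>2)\<^sup>2 / (2 * c ^ 5)"
proof -
  have p: "r > 0" "r' > 0" using assms by auto
  have e: "1 / r' - 1 / r + (r'\<^sup>2 - r\<^sup>2) / (2 * r ^ 3)
     = (r'\<^sup>2 - r\<^sup>2)\<^sup>2 * (r' + 2 * r) / (2 * r ^ 3 * r' * (r + r')\<^sup>2)"
  proof -
    have "r + r' \<noteq> 0" using p by simp
    then show ?thesis using p
      by (simp add: divide_simps) (simp add: algebra_simps power2_eq_square power3_eq_cube eval_nat_numeral)
  qed
  have "c ^ 5 * (r' + 2 * r) \<le> r ^ 3 * r' * (r + r')\<^sup>2"
  proof -
    have "c ^ 5 * (r' + 2 * r) = (c ^ 3 * c) * (c * (r' + 2 * r))" by (simp add: eval_nat_numeral)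
    also have "\<dots> \<le> (r ^ 3 * r') * ((r + r') * (r + r'))"
    proof (rule mult_mono)
      show "c ^ 3 * c \<le> r ^ 3 * r'" using c r r' p by (intro mult_mono power_mono) auto
      have "c * (r' + 2 * r) \<le> c * (2 * (r + r'))" using c p by (intro mult_left_mono) auto
      also have "\<dots> = (2 * c) * (r + r')" by simp
      also have "\<dots> \<le> (r + r') * (r + r')" using r r' p by (intro mult_right_mono) auto
      finally show "c * (r' + 2 * r) \<le> (r + r') * (r + r')" .
    qed (use c p in auto)
    finally show ?thesis by (simp add: power2_eq_square)
  qed
  then have "(r' + 2 * r) / (2 * r ^ 3 * r' * (r + r')\<^sup>2) \<le> 1 / (2 * c ^ 5)"
    using c p by (simp add: divide_simps add_pos_pos mult.commute mult.left_commute)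
  then have "(r'\<^sup>2 - r\<^sup>2)\<^sup>2 * ((r' + 2 * r) / (2 * r ^ 3 * r' * (r + r')\<^sup>2)) \<le> (r'\<^sup>2 - r\<^sup>2)\<^sup>2 * (1 / (2 * c ^ 5))"
    by (intro mult_left_mono) auto
  with e show ?thesis by simp
qed

lemma inverse_norm_first_order:
  fixes a v :: complex
  assumes c: "c > 0" "c \<le> cmod a" "c \<le> cmod (a + \<delta> *\<^sub>R v)" and R: "cmod a \<le> R" and N: "cmod v \<le> N"
    and \<delta>: "0 \<le> \<delta>" "\<delta> \<le> 1"
  shows "1 / cmod (a + \<delta> *\<^sub>R v) \<le> 1 / cmod a - \<delta> * ((a \<bullet> v) / cmod a ^ 3) + \<delta>\<^sup>2 * ((2 * R * N + N\<^sup>2)\<^sup>2 / (2 * c ^ 5))"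
proof -
  let ?D = "(cmod (a + \<delta> *\<^sub>R v))\<^sup>2 - (cmod a)\<^sup>2"
  have D: "?D = 2 * \<delta> * (a \<bullet> v) + \<delta>\<^sup>2 * (cmod v)\<^sup>2"
    unfolding power2_norm_eq_inner by (simp add: inner_add_left inner_add_right inner_commute power2_eq_square)
  have R0: "0 \<le> R" using R norm_ge_zero[of a] by linarith
  have av: "\<bar>a \<bullet> v\<bar> \<le> R * N"
    by (rule order_trans[OF Cauchy_Schwarz_ineq2]) (intro mult_mono R N R0 norm_ge_zero)
  have vv: "(cmod v)\<^sup>2 \<le> N\<^sup>2" by (intro power_mono N) simp
  have "\<bar>?D\<bar> \<le> 2 * \<delta> * \<bar>a \<bullet> v\<bar> + \<delta>\<^sup>2 * (cmod v)\<^sup>2"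
    unfolding D using \<delta> by (intro order_trans[OF abs_triangle_ineq]) (simp add: abs_mult)
  also have "\<dots> \<le> 2 * \<delta> * (R * N) + (\<delta> * 1) * N\<^sup>2"
    unfolding power2_eq_square[of \<delta>]
    using \<delta> by (intro add_mono mult_left_mono mult_mono av vv) auto
  also have "\<dots> = \<delta> * (2 * R * N + N\<^sup>2)" by (simp add: algebra_simps)
  finally have "\<bar>?D\<bar>\<^sup>2 \<le> (\<delta> * (2 * R * N + N\<^sup>2))\<^sup>2" by (intro power_mono) auto
  then have "?D\<^sup>2 / (2 * c ^ 5) \<le> (\<delta> * (2 * R * N + N\<^sup>2))\<^sup>2 / (2 * c ^ 5)"
    using c by (intro divide_right_mono) auto
  \<comment> \<open>The term of \<open>?D\<close> that is quadratic in \<open>\<delta>\<close>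
    enters with a favourable sign here and is dropped.\<close>
  moreover have "- (?D / (2 * cmod a ^ 3)) \<le> - (\<delta> * ((a \<bullet> v) / cmod a ^ 3))"
  proof -
    have "?D / (2 * cmod a ^ 3) = \<delta> * ((a \<bullet> v) / cmod a ^ 3) + \<delta>\<^sup>2 * (cmod v)\<^sup>2 / (2 * cmod a ^ 3)"
      unfolding D by (simp add: add_divide_distrib)
    then show ?thesis by simp
  qed
  ultimately show ?thesis
    using inverse_second_order[OF c] by (simp add: power_mult_distrib)
qed

text \<open>The error constant depends only on \<open>m\<close> and the bounds \<open>c\<close>,
  \<open>R\<close>, \<open>N\<close>, hence is uniform in time along a path that stays away from
  collisions.\<close>

lemma real_potential_first_order:
  assumes m: "m > 0" and c: "c > 0"
    and d: "c \<le> cmod (fst z)" "c \<le> cmod (fst z / 2 + snd z)" "c \<le> cmod (fst z / 2 - snd z)"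
    and d': "c \<le> cmod (fst z + \<delta> *\<^sub>R fst V)"
      "c \<le> cmod ((fst z / 2 + snd z) + \<delta> *\<^sub>R (fst V / 2 + snd V))"
      "c \<le> cmod ((fst z / 2 - snd z) + \<delta> *\<^sub>R (fst V / 2 - snd V))"
    and R: "cmod (fst z) \<le> R" "cmod (fst z / 2 + snd z) \<le> R" "cmod (fst z / 2 - snd z) \<le> R"
    and N: "cmod (fst V) \<le> N" "cmod (fst V / 2 + snd V) \<le> N" "cmod (fst V / 2 - snd V) \<le> N"
    and \<delta>: "0 \<le> \<delta>" "\<delta> \<le> 1"
  shows "real_potential m (z + \<delta> *\<^sub>R V) \<le> real_potential m z + \<delta> * force m V z
     + \<delta>\<^sup>2 * ((m\<^sup>2 + 2 * m) * ((2 * R * N + N\<^sup>2)\<^sup>2 / (2 * c ^ 5)))"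
proof -
  let ?C = "(2 * R * N + N\<^sup>2)\<^sup>2 / (2 * c ^ 5)"
  have e: "fst (z + \<delta> *\<^sub>R V) = fst z + \<delta> *\<^sub>R fst V"
    "fst (z + \<delta> *\<^sub>R V) / 2 + snd (z + \<delta> *\<^sub>R V) = (fst z / 2 + snd z) + \<delta> *\<^sub>R (fst V / 2 + snd V)"
    "fst (z + \<delta> *\<^sub>R V) / 2 - snd (z + \<delta> *\<^sub>R V) = (fst z / 2 - snd z) + \<delta> *\<^sub>R (fst V / 2 - snd V)"
    by (simp_all add: scaleR_add_right scaleR_diff_right add_divide_distrib)
  have "real_potential m (z + \<delta> *\<^sub>R V) \<le>
      m\<^sup>2 * (1 / cmod (fst z) - \<delta> * ((fst z \<bullet> fst V) / cmod (fst z) ^ 3) + \<delta>\<^sup>2 * ?C)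
    + m * (1 / cmod (fst z / 2 + snd z) - \<delta> * (((fst z / 2 + snd z) \<bullet> (fst V / 2 + snd V)) / cmod (fst z / 2 + snd z) ^ 3) + \<delta>\<^sup>2 * ?C)
    + m * (1 / cmod (fst z / 2 - snd z) - \<delta> * (((fst z / 2 - snd z) \<bullet> (fst V / 2 - snd V)) / cmod (fst z / 2 - snd z) ^ 3) + \<delta>\<^sup>2 * ?C)"
  proof -
    have k: "k / x \<le> k * y" if "1 / x \<le> y" "k \<ge> 0" for k x y :: real
      using mult_left_mono[OF that] by simp
    show ?thesis
      unfolding real_potential_def e(2,3) unfolding e(1) using m
      by (intro add_mono k inverse_norm_first_order[OF c d(1) d'(1) R(1) N(1) \<delta>]
          inverse_norm_first_order[OF c d(2) d'(2) R(2) N(2) \<delta>]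
          inverse_norm_first_order[OF c d(3) d'(3) R(3) N(3) \<delta>]) auto
  qed
  also have "\<dots> = real_potential m z + \<delta> * force m V z + \<delta>\<^sup>2 * ((m\<^sup>2 + 2 * m) * ?C)"
    unfolding real_potential_def force_def
    by (simp add: distrib_left distrib_right right_diff_distrib mult.assoc mult.left_commute[of "m\<^sup>2"] mult.left_commute[of m] add_divide_distrib)
  finally show ?thesis .
qed

lemma integral_tent:
  assumes h: "h > 0" "0 \<le> c - h" "c + h \<le> 1"
  shows "set_integrable lborel {0..1} (tent c h)"
    and "0 < (LINT t:{0..1}|lborel. tent c h t)" and "(LINT t:{0..1}|lborel. tent c h t) \<le> 1"
proof -
  have "continuous_on {0..1} (tent c h)"
    unfolding tent_def[abs_def] by (intro continuous_intros) (use h in auto)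
  then show i: "set_integrable lborel {0..1} (tent c h)"
    by (rule borel_integrable_atLeastAtMost')
  have one: "set_integrable lborel {0..1::real} (\<lambda>t. 1::real)" by (simp add: set_integrable_def)
  have "(LINT t:{0..1}|lborel. tent c h t) \<le> (LINT t:{0..1::real}|lborel. 1)"
    by (rule set_integral_mono[OF i one]) (rule tent_bounds(2)[OF h(1)])
  also have "\<dots> = 1" by (simp add: set_lebesgue_integral_def)
  finally show "(LINT t:{0..1}|lborel. tent c h t) \<le> 1" .
  have e: "indicat_real {0..1} t *\<^sub>R (indicat_real {c - h/2..c + h/2} t * (1/2)) = indicat_real {c - h/2..c + h/2} t * (1/2)" for t
    using h by (auto simp: indicator_def)
  have "0 < h * (1/2)" using h by simp
  also have "h * (1/2) = (LINT t:{0..1}|lborel. indicat_real {c - h/2..c + h/2} t * (1/2))"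
    unfolding set_lebesgue_integral_def e using h by simp
  also have "\<dots> \<le> (LINT t:{0..1}|lborel. tent c h t)"
  proof (rule set_integral_mono[OF _ i])
    show "set_integrable lborel {0..1} (\<lambda>t. indicat_real {c - h/2..c + h/2} t * (1/2))"
      unfolding set_integrable_def e by (intro integrable_mult_left) (simp add: emeasure_lborel_Icc_eq)
    fix t
    show "indicat_real {c - h/2..c + h/2} t * (1/2) \<le> tent c h t"
    proof (cases "t \<in> {c - h/2..c + h/2}")
      case True
      then have "\<bar>t - c\<bar> \<le> h / 2" by (intro abs_leI) auto
      then have "\<bar>t - c\<bar> / h \<le> 1/2" using h by (simp add: field_simps)
      then have "1/2 \<le> 1 - \<bar>t - c\<bar> / h" by linarith
      then have "1/2 \<le> tent c h t" unfolding tent_bounds(5)[OF h(1)] by (rule max.coboundedI2)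
      then show ?thesis using True by simp
    qed (use tent_bounds(1)[OF h(1)] in simp)
  qed
  finally show "0 < (LINT t:{0..1}|lborel. tent c h t)" .
qed

context finite_minimizer
begin

lemma continuous: "continuous_on {0..1} Z"
  by (rule has_L2_derivative_continuous[OF Z])

lemma isCont_interior:
  assumes "0 < c" "c < 1" shows "isCont Z c"
  by (rule continuous_on_interior[OF continuous]) (use assms in simp)

lemma eventually_distances_ge:
  assumes c: "0 < c" "c < 1" and cf: "collision_free (Z c)"
  shows "\<exists>\<rho>>0. \<exists>h>0. h \<le> c \<and> h \<le> 1 - c \<and> (\<forall>t. \<bar>t - c\<bar> \<le> h \<longrightarrow>
     \<rho> \<le> cmod (fst (Z t)) \<and> \<rho> \<le> cmod (fst (Z t) / 2 + snd (Z t)) \<and> \<rho> \<le> cmod (fst (Z t) / 2 - snd (Z t)))"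
proof -
  define D where "D t = min (cmod (fst (Z t))) (min (cmod (fst (Z t) / 2 + snd (Z t))) (cmod (fst (Z t) / 2 - snd (Z t))))" for t
  have "isCont D c"
    unfolding D_def by (intro continuous_intros isCont_interior c) auto
  moreover have "D c > 0" using cf unfolding D_def collision_free_def by simp
  ultimately have "eventually (\<lambda>t. D t > D c / 2) (nhds c)"
    unfolding isCont_def tendsto_at_iff_tendsto_nhds by (intro order_tendstoD) auto
  then obtain e where e: "e > 0" "\<And>t. dist t c < e \<Longrightarrow> D t > D c / 2"
    unfolding eventually_nhds_metric by blast
  define h where "h = min (e / 2) (min c (1 - c))"
  have "h > 0" "h \<le> c" "h \<le> 1 - c" using e c by (auto simp: h_def)
  moreover have "D t > D c / 2" if "\<bar>t - c\<bar> \<le> h" for t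
    by (rule e(2)) (use that e(1) in \<open>auto simp: h_def dist_real_def\<close>)
  ultimately show ?thesis
    using \<open>D c > 0\<close> unfolding D_def by (intro exI[of _ "D c / 2"] conjI exI[of _ h]) (auto simp: D_def intro: less_imp_le)
qed

text \<open>The tent variation divided by \<open>\<epsilon>\<close>, in the limit from the right.
  \<open>J\<close> is the integral of the tent: \<open>J \<le> 1\<close> serves for a nonnegative
  bound \<open>B\<close>, and \<open>0 < J\<close> for a negative one.\<close>

lemma first_variation:
  assumes h: "h > 0" "0 \<le> c - h" "c + h \<le> 1" and \<rho>: "\<rho> > 0"
    and far: "\<And>t. \<bar>t - c\<bar> \<le> h \<Longrightarrow> \<rho> \<le> cmod (fst (Z t))" "\<And>t. \<bar>t - c\<bar> \<le> h \<Longrightarrow> \<rho> \<le> cmod (fst (Z t) / 2 + snd (Z t))"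
      "\<And>t. \<bar>t - c\<bar> \<le> h \<Longrightarrow> \<rho> \<le> cmod (fst (Z t) / 2 - snd (Z t))"
    and F: "\<And>t. \<bar>t - c\<bar> \<le> h \<Longrightarrow> force m V (Z t) \<le> B"
  shows "\<exists>J. 0 < J \<and> J \<le> 1 \<and> 2 / h * kinetic_inner m (Z (c - h) + Z (c + h) - 2 *\<^sub>R Z c) V \<le> J * B"
proof (intro exI conjI)
  let ?J = "LINT t:{0..1}|lborel. tent c h t"
  show "0 < ?J" "?J \<le> 1" by (rule integral_tent[OF h])+
  \<comment> \<open>The summand 1 makes \<open>N\<close> positive, so that
    \<open>\<rho> / (2 * N)\<close> can bound \<open>\<epsilon>\<close>.\<close>
  define N where "N = cmod (fst V) + cmod (fst V / 2 + snd V) + cmod (fst V / 2 - snd V) + 1"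
  have N: "cmod (fst V) \<le> N" "cmod (fst V / 2 + snd V) \<le> N" "cmod (fst V / 2 - snd V) \<le> N" "N > 0"
    unfolding N_def by (auto intro: add_nonneg_pos)
  obtain R where R: "cmod (fst (Z t)) \<le> R" "cmod (fst (Z t) / 2 + snd (Z t)) \<le> R" "cmod (fst (Z t) / 2 - snd (Z t)) \<le> R"
    if "t \<in> {0..1}" for t
  proof -
    have "bounded (Z ` {0..1})"
      by (intro compact_imp_bounded compact_continuous_image continuous) simp
    then obtain M where M: "\<And>t. t \<in> {0..1} \<Longrightarrow> norm (Z t) \<le> M" unfolding bounded_iff by blast
    show thesis
    proof (rule that[of "2 * M"])
      fix t :: real assume "t \<in> {0..1}"
      have n: "cmod (fst (Z t)) \<le> M" "cmod (snd (Z t)) \<le> M"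
        using M[OF \<open>t \<in> {0..1}\<close>] norm_fst_le[of "fst (Z t)" "snd (Z t)"] norm_snd_le[of "snd (Z t)" "fst (Z t)"]
        by simp_all
      have "cmod (fst (Z t) / 2) = cmod (fst (Z t)) / 2" by (simp add: norm_divide)
      then have n2: "cmod (fst (Z t) / 2) \<le> M" using n norm_ge_zero[of "fst (Z t)"] by linarith
      show "cmod (fst (Z t)) \<le> 2 * M" using n norm_ge_zero[of "fst (Z t)"] by linarith
      show "cmod (fst (Z t) / 2 + snd (Z t)) \<le> 2 * M" using norm_triangle_ineq[of "fst (Z t) / 2" "snd (Z t)"] n n2 by linarith
      show "cmod (fst (Z t) / 2 - snd (Z t)) \<le> 2 * M" using norm_triangle_ineq4[of "fst (Z t) / 2" "snd (Z t)"] n n2 by linarith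
    qed
  qed
  \<comment> \<open>The variation shortens each distance by at most \<open>\<epsilon> * N\<close>,
    hence the lower bound \<open>\<rho> / 2\<close> for the distances.\<close>
  define C where "C = (m\<^sup>2 + 2 * m) * ((2 * R * N + N\<^sup>2)\<^sup>2 / (2 * (\<rho> / 2) ^ 5))"
  have C: "C \<ge> 0" unfolding C_def using m \<rho> by simp
  define E where "E = 4 / h\<^sup>2 * kinetic m V"
  define K where "K = kinetic_inner m (2 *\<^sub>R Z c - Z (c - h) - Z (c + h)) V"
  have main: "0 \<le> 2 / h * K + ?J * B + \<epsilon> * (E + C)" if \<epsilon>: "0 < \<epsilon>" "\<epsilon> \<le> 1" "\<epsilon> \<le> \<rho> / (2 * N)" for \<epsilon>
  proof -
    have te: "0 \<le> \<epsilon> * tent c h t" "\<epsilon> * tent c h t \<le> \<epsilon>" for t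
      using tent_bounds(1,2)[OF h(1), of c t] \<epsilon> by (auto simp: mult_left_le)
    have keep: "\<rho> / 2 \<le> cmod (a + (\<epsilon> * tent c h t) *\<^sub>R v)" if "\<rho> \<le> cmod a" "cmod v \<le> N" for a v t
    proof -
      have "cmod ((\<epsilon> * tent c h t) *\<^sub>R v) = (\<epsilon> * tent c h t) * cmod v" using te[of t] by simp
      also have "\<dots> \<le> (\<rho> / (2 * N)) * N" using order_trans[OF te(2)[of t] \<epsilon>(3)] that N \<rho>
        by (intro mult_mono) auto
      also have "\<dots> = \<rho> / 2" using N by simp
      finally show ?thesis using that(1) norm_diff_ineq[of a "(\<epsilon> * tent c h t) *\<^sub>R v"] by linarith
    qed
    let ?f = "\<lambda>t. (\<epsilon> * B) * tent c h t + \<epsilon>\<^sup>2 * C"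
    have const: "set_integrable lborel {0..1::real} (\<lambda>t. \<epsilon>\<^sup>2 * C)" by (simp add: set_integrable_def)
    have tenti: "set_integrable lborel {0..1} (\<lambda>t. (\<epsilon> * B) * tent c h t)"
      by (rule set_integrable_mult_right) (rule integral_tent[OF h])
    have "0 \<le> 2 * \<epsilon> / h * kinetic_inner m (2 *\<^sub>R Z c - Z (c - h) - Z (c + h)) V
      + \<epsilon>\<^sup>2 * (4 / h\<^sup>2 * kinetic m V) + (LINT t:{0..1}|lborel. ?f t)"
    proof (rule tent_variation[OF h])
      show "set_integrable lborel {0..1} ?f" by (rule set_integral_add(1)[OF tenti const])
      note cf = action_finite(1)[OF m Z fin]
      have *: "collision_free (Z t + (\<epsilon> * tent c h t) *\<^sub>R V) \<and>
           real_potential m (Z t + (\<epsilon> * tent c h t) *\<^sub>R V) \<le> real_potential m (Z t) + ?f t"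
        if t: "t \<in> {0..1}" and cft: "collision_free (Z t)" for t
      proof (cases "\<bar>t - c\<bar> \<le> h")
        case False
        then have "tent c h t = 0" by (intro tent_bounds(3)[OF h(1)]) simp
        then show ?thesis using cft C by simp
      next
        case True
        note k = keep[OF far(1)[OF True] N(1), of t] keep[OF far(2)[OF True] N(2), of t] keep[OF far(3)[OF True] N(3), of t]
        have r2: "\<rho> / 2 \<le> cmod (fst (Z t))" "\<rho> / 2 \<le> cmod (fst (Z t) / 2 + snd (Z t))" "\<rho> / 2 \<le> cmod (fst (Z t) / 2 - snd (Z t))"
          using far[OF True] \<rho> by linarith+
        have e: "fst (Z t + (\<epsilon> * tent c h t) *\<^sub>R V) = fst (Z t) + (\<epsilon> * tent c h t) *\<^sub>R fst V"
          "fst (Z t + (\<epsilon> * tent c h t) *\<^sub>R V) / 2 + snd (Z t + (\<epsilon> * tent c h t) *\<^sub>R V)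
            = (fst (Z t) / 2 + snd (Z t)) + (\<epsilon> * tent c h t) *\<^sub>R (fst V / 2 + snd V)"
          "fst (Z t + (\<epsilon> * tent c h t) *\<^sub>R V) / 2 - snd (Z t + (\<epsilon> * tent c h t) *\<^sub>R V)
            = (fst (Z t) / 2 - snd (Z t)) + (\<epsilon> * tent c h t) *\<^sub>R (fst V / 2 - snd V)"
          by (simp_all add: scaleR_add_right scaleR_diff_right add_divide_distrib)
        have nz: "x \<noteq> 0" if "\<rho> / 2 \<le> cmod x" for x using that \<rho> by auto
        have "collision_free (Z t + (\<epsilon> * tent c h t) *\<^sub>R V)"
          unfolding collision_free_def e(2,3) unfolding e(1) using k by (intro conjI nz)
        moreover have "real_potential m (Z t + (\<epsilon> * tent c h t) *\<^sub>R V) \<le> real_potential m (Z t)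
          + (\<epsilon> * tent c h t) * force m V (Z t) + (\<epsilon> * tent c h t)\<^sup>2 * C"
          unfolding C_def
          by (rule real_potential_first_order[OF m _ r2 k R[OF t] N(1-3) te(1)]) (use order_trans[OF te(2)[of t] \<epsilon>(2)] \<rho> in auto)
        moreover have "(\<epsilon> * tent c h t) * force m V (Z t) \<le> (\<epsilon> * tent c h t) * B"
          by (intro mult_left_mono F[OF True] te)
        moreover have "(\<epsilon> * tent c h t)\<^sup>2 * C \<le> \<epsilon>\<^sup>2 * C"
          by (intro mult_right_mono power_mono te C)
        ultimately show ?thesis by (simp add: mult.commute mult.left_commute)
      qed
      show "AE t in lborel. t \<in> {0..1} \<longrightarrow> collision_free (Z t + (\<epsilon> * tent c h t) *\<^sub>R V)"
        using cf by eventually_elim (use * in blast)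
      show "AE t in lborel. t \<in> {0..1} \<longrightarrow> real_potential m (Z t + (\<epsilon> * tent c h t) *\<^sub>R V) \<le> real_potential m (Z t) + ?f t"
        using cf by eventually_elim (use * in blast)
    qed
    also have "(LINT t:{0..1}|lborel. ?f t) = (\<epsilon> * B) * ?J + \<epsilon>\<^sup>2 * C"
    proof -
      have "(LINT t:{0..1::real}|lborel. \<epsilon>\<^sup>2 * C) = \<epsilon>\<^sup>2 * C" by (simp add: set_lebesgue_integral_def)
      then show ?thesis unfolding set_integral_add(2)[OF tenti const] set_integral_mult_right by simp
    qed
    finally have "0 \<le> \<epsilon> * (2 / h * K + ?J * B + \<epsilon> * (E + C))"
      by (simp add: K_def E_def power2_eq_square algebra_simps)
    then show ?thesis using \<epsilon> by (simp add: zero_le_mult_iff)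
  qed
  have lim: "((\<lambda>\<epsilon>. 2 / h * K + ?J * B + \<epsilon> * (E + C)) \<longlongrightarrow> 2 / h * K + ?J * B + 0 * (E + C)) (at_right 0)"
    by (intro tendsto_intros)
  define \<epsilon>0 where "\<epsilon>0 = min 1 (\<rho> / (2 * N))"
  have "\<epsilon>0 > 0" using \<rho> N by (simp add: \<epsilon>0_def)
  then have "eventually (\<lambda>\<epsilon>. 0 \<le> 2 / h * K + ?J * B + \<epsilon> * (E + C)) (at_right 0)"
    unfolding eventually_at_right_field
  proof (intro exI[of _ \<epsilon>0] conjI allI impI)
    fix \<epsilon> assume "0 < \<epsilon>" "\<epsilon> < \<epsilon>0"
    then show "0 \<le> 2 / h * K + ?J * B + \<epsilon> * (E + C)"
      by (intro main) (auto simp: \<epsilon>0_def)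
  qed
  from tendsto_lowerbound[OF lim this] have "0 \<le> 2 / h * K + ?J * B" by simp
  moreover have "kinetic_inner m (Z (c - h) + Z (c + h) - 2 *\<^sub>R Z c) V = - K"
    unfolding K_def kinetic_inner_def by (simp add: inner_diff_left inner_add_left algebra_simps)
  ultimately show "2 / h * kinetic_inner m (Z (c - h) + Z (c + h) - 2 *\<^sub>R Z c) V \<le> ?J * B" by simp
qed

end

section \<open>Vanishing coordinates\<close>

text \<open>The force contains inverse cubes of distances, whereas the difference of their squares
  is bilinear in the Jacobi vectors. The factorization links the two with a positive and bounded
  factor.\<close>

lemma inverse_cube_diff:
  fixes r s \<rho> :: real
  assumes "0 < \<rho>" "\<rho> \<le> r" "\<rho> \<le> s"
  shows "\<exists>k>0. k \<le> 2 / \<rho> ^ 5 \<and> 1 / s ^ 3 - 1 / r ^ 3 = k * (r\<^sup>2 - s\<^sup>2)"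
proof (intro exI conjI)
  have p: "r > 0" "s > 0" "r + s > 0" using assms by auto
  let ?k = "(r\<^sup>2 + r * s + s\<^sup>2) / ((r + s) * (r ^ 3 * s ^ 3))"
  show "0 < ?k" using p by (intro divide_pos_pos mult_pos_pos add_pos_pos) auto
  have "r\<^sup>2 + r * s + s\<^sup>2 \<le> (r + s) * (r + s)" using p by (simp add: power2_eq_square algebra_simps)
  then have "?k \<le> ((r + s) * (r + s)) / ((r + s) * (r ^ 3 * s ^ 3))"
    using p by (intro divide_right_mono) auto
  also have "\<dots> = 1 / (r\<^sup>2 * s ^ 3) + 1 / (r ^ 3 * s\<^sup>2)"
  proof -
    have "((r + s) * (r + s)) / ((r + s) * (r ^ 3 * s ^ 3)) = r / (r ^ 3 * s ^ 3) + s / (r ^ 3 * s ^ 3)"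
      using p by (simp add: add_divide_distrib)
    also have "r / (r ^ 3 * s ^ 3) = 1 / (r\<^sup>2 * s ^ 3)"
      using p by (simp add: power2_eq_square power3_eq_cube)
    also have "s / (r ^ 3 * s ^ 3) = 1 / (r ^ 3 * s\<^sup>2)"
      using p by (simp add: power2_eq_square power3_eq_cube)
    finally show ?thesis .
  qed
  also have "\<dots> \<le> 1 / (\<rho>\<^sup>2 * \<rho> ^ 3) + 1 / (\<rho> ^ 3 * \<rho>\<^sup>2)"
    using assms p by (intro add_mono divide_left_mono mult_mono power_mono mult_pos_pos) auto
  also have "\<dots> = 2 / \<rho> ^ 5" by (simp add: power_add[symmetric])
  finally show "?k \<le> 2 / \<rho> ^ 5" .
  have "(1 / s ^ 3 - 1 / r ^ 3) * ((r + s) * (r ^ 3 * s ^ 3)) = (r + s) * (r ^ 3 - s ^ 3)"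
    using p by (simp add: field_simps)
  also have "\<dots> = (r\<^sup>2 + r * s + s\<^sup>2) * (r\<^sup>2 - s\<^sup>2)"
    by (simp add: algebra_simps power2_eq_square power3_eq_cube)
  finally show "1 / s ^ 3 - 1 / r ^ 3 = ?k * (r\<^sup>2 - s\<^sup>2)"
    using p by (simp add: eq_divide_eq)
qed

text \<open>Each component is a nonpositive multiple of its own coordinate plus a multiple of the
  difference of the inverse cubes \<open>B\<close> and \<open>C\<close>. That difference is a
  multiple of \<open>y * q - x * p\<close> with one factor \<open>k\<close> for all four components.
  The direction \<open>(0, -1)\<close> is the one in which \<open>p\<close> grows.\<close>

lemma force_bounds:
  assumes m: "m > 0" and z: "z \<in> quadrants" and \<rho>: "0 < \<rho>"
    and d: "\<rho> \<le> cmod (fst z / 2 + snd z)" "\<rho> \<le> cmod (fst z / 2 - snd z)"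
  defines "x \<equiv> Re (fst z)" and "y \<equiv> Im (fst z)" and "p \<equiv> - Re (snd z)" and "q \<equiv> Im (snd z)"
  shows "\<exists>k>0. k \<le> 2 / \<rho> ^ 5 \<and>
     force m (1, 0) z \<le> m * k * (p * (x * p - y * q)) \<and>
     force m (\<i>, 0) z \<le> m * k * (q * (y * q - x * p)) \<and>
     force m (0, -1) z \<le> m * k * (x * (p * x - y * q)) \<and>
     force m (0, \<i>) z \<le> m * k * (y * (q * y - x * p))"
proof -
  define A where "A = 1 / cmod (fst z) ^ 3"
  define B where "B = 1 / cmod (fst z / 2 + snd z) ^ 3"
  define C where "C = 1 / cmod (fst z / 2 - snd z) ^ 3"
  have nn: "0 \<le> A" "0 \<le> B" "0 \<le> C" by (simp_all add: A_def B_def C_def)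
  have q: "0 \<le> x" "0 \<le> y" "0 \<le> p" "0 \<le> q" using z by (auto simp: quadrants_def x_def y_def p_def q_def)
  obtain k where k: "k > 0" "k \<le> 2 / \<rho> ^ 5"
    "C - B = k * ((cmod (fst z / 2 + snd z))\<^sup>2 - (cmod (fst z / 2 - snd z))\<^sup>2)"
    using inverse_cube_diff[OF \<rho> d] unfolding B_def C_def by blast
  have e: "(cmod (fst z / 2 + snd z))\<^sup>2 - (cmod (fst z / 2 - snd z))\<^sup>2 = 2 * (y * q - x * p)"
    unfolding cmod_power2 x_def y_def p_def q_def by (simp add: power2_eq_square algebra_simps)
  have CB: "C = B + 2 * k * (y * q - x * p)" using k(3) unfolding e by (simp add: algebra_simps)
  have F: "force m (1, 0) z = - (m\<^sup>2 * x * A + m * x / 4 * (B + C)) + m / 2 * p * (B - C)"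
    "force m (\<i>, 0) z = - (m\<^sup>2 * y * A + m * y / 4 * (B + C)) + m / 2 * q * (C - B)"
    "force m (0, -1) z = - (m * p * (B + C)) + m / 2 * x * (B - C)"
    "force m (0, \<i>) z = - (m * q * (B + C)) + m / 2 * y * (C - B)"
    unfolding force_def A_def B_def C_def x_def y_def p_def q_def
    by (simp_all add: inner_complex_def diff_divide_distrib add_divide_distrib algebra_simps)
  have "0 \<le> m\<^sup>2 * x * A + m * x / 4 * (B + C)" "0 \<le> m\<^sup>2 * y * A + m * y / 4 * (B + C)"
    "0 \<le> m * p * (B + C)" "0 \<le> m * q * (B + C)"
    using m nn q by simp_all
  then have "force m (1, 0) z \<le> m / 2 * p * (B - C)" "force m (\<i>, 0) z \<le> m / 2 * q * (C - B)"
    "force m (0, -1) z \<le> m / 2 * x * (B - C)" "force m (0, \<i>) z \<le> m / 2 * y * (C - B)"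
    unfolding F by linarith+
  moreover have "m / 2 * p * (B - C) = m * k * (p * (x * p - y * q))" "m / 2 * q * (C - B) = m * k * (q * (y * q - x * p))"
    "m / 2 * x * (B - C) = m * k * (x * (p * x - y * q))" "m / 2 * y * (C - B) = m * k * (y * (q * y - x * p))"
    unfolding CB by (simp_all add: algebra_simps)
  ultimately show ?thesis using k(1,2) by metis
qed

context finite_minimizer
begin

text \<open>
  In the next two lemmas \<open>u\<close> is one of the four real coordinates of a configuration in
  \<^const>\<open>quadrants\<close>, \<open>p\<close> is the corresponding coordinate of the other Jacobi vector and \<open>w\<close>
  is the product of the remaining two.
\<close>

lemma coordinate_vanishes_locally:
  fixes u p w :: "complex \<times> complex \<Rightarrow> real"
  assumes u: "bounded_linear u" and p: "continuous_on UNIV p"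
    and \<kappa>: "\<kappa> > 0" "\<And>v. kinetic_inner m v V = \<kappa> * u v"
    and Q: "\<And>t. t \<in> {0..1} \<Longrightarrow> Z t \<in> quadrants"
    and nn: "\<And>z. z \<in> quadrants \<Longrightarrow> 0 \<le> u z \<and> 0 \<le> p z \<and> 0 \<le> w z"
    and F: "\<And>z \<rho>. z \<in> quadrants \<Longrightarrow> 0 < \<rho> \<Longrightarrow> \<rho> \<le> cmod (fst z / 2 + snd z) \<Longrightarrow> \<rho> \<le> cmod (fst z / 2 - snd z) \<Longrightarrow>
        \<exists>k>0. k \<le> 2 / \<rho> ^ 5 \<and> force m V z \<le> m * k * (p z * (u z * p z - w z))"
    and c: "0 < c" "c < 1" "u (Z c) = 0"
  shows "\<exists>H>0. \<forall>t. \<bar>t - c\<bar> \<le> H \<longrightarrow> u (Z t) = 0"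
proof -
  obtain \<rho> h1 where \<rho>: "\<rho> > 0" and h1: "h1 > 0" "h1 \<le> c" "h1 \<le> 1 - c"
    and far: "\<And>t. \<bar>t - c\<bar> \<le> h1 \<Longrightarrow> \<rho> \<le> cmod (fst (Z t)) \<and> \<rho> \<le> cmod (fst (Z t) / 2 + snd (Z t)) \<and> \<rho> \<le> cmod (fst (Z t) / 2 - snd (Z t))"
    using eventually_distances_ge[OF c(1,2) no_collision[OF Q c(1,2)]] by metis
  have "bounded ((\<lambda>t. p (Z t)) ` {0..1})"
    by (intro compact_imp_bounded compact_continuous_image continuous_on_compose2[OF p continuous]) auto
  then obtain R where R': "\<And>v. v \<in> (\<lambda>t. p (Z t)) ` {0..1} \<Longrightarrow> norm v \<le> R" unfolding bounded_iff by blast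
  have R: "\<bar>p (Z t)\<bar> \<le> R" if "t \<in> {0..1}" for t
    using R'[OF imageI[OF that]] by simp
  interpret u: bounded_linear u by (rule u)
  define L where "L = m * (2 / \<rho> ^ 5) * R\<^sup>2"
  have L: "L \<ge> 0" using m \<rho> by (simp add: L_def)
  \<comment> \<open>Small enough for \<open>h * L \<le> \<kappa>\<close> whenever
    \<open>h \<le> H\<close>, against \<open>2 * \<kappa> \<le> h * L\<close>, which a positive
    maximum would imply.\<close>
  define H where "H = min h1 (\<kappa> / (L + 1))"
  have H: "H > 0" "H \<le> h1" "H \<le> \<kappa> / (L + 1)" using h1 \<kappa> L by (auto simp: H_def)
  have sub: "{c - H..c + H} \<subseteq> {0..1}" using H h1 by auto
  have "continuous_on {c - H..c + H} (\<lambda>t. u (Z t))"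
    by (rule u.continuous_on[OF continuous_on_subset[OF continuous sub]])
  then obtain s where s: "s \<in> {c - H..c + H}" "\<And>t. t \<in> {c - H..c + H} \<Longrightarrow> u (Z t) \<le> u (Z s)"
    using continuous_attains_sup[of "{c - H..c + H}" "\<lambda>t. u (Z t)"] H by auto
  let ?M = "u (Z s)"
  have "?M \<le> 0"
  proof (rule ccontr)
    assume "\<not> ?M \<le> 0"
    then have M: "?M > 0" by simp
    \<comment> \<open>With this width the maximum point \<open>s\<close> is \<open>c - h\<close> or
      \<open>c + h\<close>. As \<open>u\<close> vanishes at \<open>c\<close> and is nonnegative at
      the opposite point, the second difference is at least \<open>?M\<close>.\<close>
    define h where "h = \<bar>s - c\<bar>"
    have "s \<noteq> c" using M c(3) by auto
    then have h: "h > 0" "h \<le> H" using s(1) by (auto simp: h_def)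
    have hc: "0 \<le> c - h" "c + h \<le> 1" using h H h1 by auto
    have win: "t \<in> {c - H..c + H}" "\<bar>t - c\<bar> \<le> h1" "t \<in> {0..1}" if "\<bar>t - c\<bar> \<le> h" for t
      using that h H h1 by (auto simp: abs_le_iff)
    obtain J where J: "0 < J" "J \<le> 1" "2 / h * kinetic_inner m (Z (c - h) + Z (c + h) - 2 *\<^sub>R Z c) V \<le> J * (L * ?M)"
    proof -
      have "force m V (Z t) \<le> L * ?M" if t: "\<bar>t - c\<bar> \<le> h" for t
      proof -
        note zq = Q[OF win(3)[OF t]]
        from far[OF win(2)[OF t]] F[OF zq \<rho>] obtain k where k: "k > 0" "k \<le> 2 / \<rho> ^ 5"
            "force m V (Z t) \<le> m * k * (p (Z t) * (u (Z t) * p (Z t) - w (Z t)))" by blast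
        \<comment> \<open>The product \<open>p * w\<close> has the good sign and is discarded; what
          remains is linear in \<open>u\<close>.\<close>
        have "p (Z t) * (u (Z t) * p (Z t) - w (Z t)) \<le> (p (Z t))\<^sup>2 * u (Z t)"
          using nn[OF zq] mult_nonneg_nonneg[of "p (Z t)" "w (Z t)"] by (simp add: algebra_simps power2_eq_square)
        also have "\<dots> \<le> R\<^sup>2 * ?M"
          using nn[OF zq] s(2)[OF win(1)[OF t]] power_mono[OF R[OF win(3)[OF t]], of 2]
          by (intro mult_mono) auto
        finally have "m * k * (p (Z t) * (u (Z t) * p (Z t) - w (Z t))) \<le> m * k * (R\<^sup>2 * ?M)"
          using m k by (intro mult_left_mono) auto
        also have "\<dots> \<le> m * (2 / \<rho> ^ 5) * (R\<^sup>2 * ?M)"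
          using m k M by (intro mult_right_mono mult_left_mono) auto
        finally show ?thesis using k(3) by (simp add: L_def mult.assoc)
      qed
      then show thesis
        using first_variation[OF h(1) hc \<rho>, of V "L * ?M"] far win(2) that by blast
    qed
    have ku: "kinetic_inner m (Z (c - h) + Z (c + h) - 2 *\<^sub>R Z c) V = \<kappa> * (u (Z (c - h)) + u (Z (c + h)))"
      unfolding \<kappa>(2) using c(3) by (simp add: u.add u.diff u.scaleR)
    have "?M \<le> u (Z (c - h)) + u (Z (c + h))"
    proof -
      have "s = c - h \<or> s = c + h" by (auto simp: h_def)
      moreover have "0 \<le> u (Z (c - h))" "0 \<le> u (Z (c + h))" using nn[OF Q] hc h by auto
      ultimately show ?thesis by auto
    qed
    then have "2 / h * (\<kappa> * ?M) \<le> 2 / h * kinetic_inner m (Z (c - h) + Z (c + h) - 2 *\<^sub>R Z c) V"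
      unfolding ku using h \<kappa> by (intro mult_left_mono) auto
    also have "\<dots> \<le> 1 * (L * ?M)"
      using J L M by (intro order_trans[OF J(3)] mult_right_mono) auto
    finally have "2 * \<kappa> * ?M \<le> (h * L) * ?M" using h by (simp add: field_simps)
    then have "2 * \<kappa> \<le> h * L" using M by simp
    also have "\<dots> \<le> (\<kappa> / (L + 1)) * L" using h H L by (intro mult_right_mono) auto
    also have "\<dots> \<le> \<kappa>" using L \<kappa> by (simp add: field_simps)
    finally show False using \<kappa> by simp
  qed
  then have "u (Z t) = 0" if "\<bar>t - c\<bar> \<le> H" for t
    using s(2)[of t] nn[OF Q, of t] that sub by (force simp: abs_le_iff)
  then show ?thesis using H(1) by blast
qed

lemma coordinate_vanishes:
  fixes u p w :: "complex \<times> complex \<Rightarrow> real"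
  assumes u: "bounded_linear u" and p: "continuous_on UNIV p"
    and \<kappa>: "\<kappa> > 0" "\<And>v. kinetic_inner m v V = \<kappa> * u v"
    and Q: "\<And>t. t \<in> {0..1} \<Longrightarrow> Z t \<in> quadrants"
    and nn: "\<And>z. z \<in> quadrants \<Longrightarrow> 0 \<le> u z \<and> 0 \<le> p z \<and> 0 \<le> w z"
    and F: "\<And>z \<rho>. z \<in> quadrants \<Longrightarrow> 0 < \<rho> \<Longrightarrow> \<rho> \<le> cmod (fst z / 2 + snd z) \<Longrightarrow> \<rho> \<le> cmod (fst z / 2 - snd z) \<Longrightarrow>
        \<exists>k>0. k \<le> 2 / \<rho> ^ 5 \<and> force m V z \<le> m * k * (p z * (u z * p z - w z))"
    and c: "0 < c" "c < 1" "u (Z c) = 0" and t: "0 < t" "t < 1"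
  shows "u (Z t) = 0" and "p (Z t) * w (Z t) = 0"
proof -
  interpret u: bounded_linear u by (rule u)
  note loc = coordinate_vanishes_locally[OF u p \<kappa> Q nn F]
  have z: "u (Z s) = 0" if "0 < s" "s < 1" for s
  proof -
    have "(u (Z c) = 0) = (u (Z s) = 0)"
    \<comment> \<open>The zeros of \<open>u\<close> form an open set by the local result, the
      remaining times one by continuity, and the open unit interval is connected.\<close>
    proof (rule connected_equivalence_relation[of "{0<..<1}" c s "\<lambda>a b. (u (Z a) = 0) = (u (Z b) = 0)"])
      fix a :: real assume a: "a \<in> {0<..<1}"
      show "\<exists>T. openin (top_of_set {0<..<1}) T \<and> a \<in> T \<and> (\<forall>x\<in>T. (u (Z a) = 0) = (u (Z x) = 0))"
      proof (cases "u (Z a) = 0")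
        case True
        then obtain H where H: "H > 0" "\<And>t. \<bar>t - a\<bar> \<le> H \<Longrightarrow> u (Z t) = 0" using loc[of a] a by auto
        then show ?thesis
          using a by (intro exI[of _ "{0<..<1} \<inter> ball a H"])
             (auto simp: dist_real_def abs_minus_commute True intro!: openin_open_Int less_imp_le)
      next
        case False
        have "isCont (\<lambda>t. u (Z t)) a" using a by (intro u.isCont isCont_interior) auto
        then have "((\<lambda>t. u (Z t)) \<longlongrightarrow> u (Z a)) (nhds a)"
          using tendsto_at_iff_tendsto_nhds[of "\<lambda>t. u (Z t)" a] by (simp add: isCont_def)
        then have "eventually (\<lambda>t. u (Z t) \<noteq> 0) (nhds a)"
          using False by (rule tendsto_imp_eventually_ne)
        then obtain H where H: "H > 0" "\<And>t. dist t a < H \<Longrightarrow> u (Z t) \<noteq> 0"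
          unfolding eventually_nhds_metric by blast
        then show ?thesis
          using a by (intro exI[of _ "{0<..<1} \<inter> ball a H"])
             (auto simp: dist_commute False intro!: openin_open_Int)
      qed
    qed (use c that in auto)
    then show ?thesis using c(3) by simp
  qed
  show "u (Z t) = 0" by (rule z[OF t])
  show "p (Z t) * w (Z t) = 0"
  proof (rule ccontr)
    assume ne: "p (Z t) * w (Z t) \<noteq> 0"
    have zq: "Z t \<in> quadrants" using Q t by simp
    note cf = no_collision[OF Q t]
    obtain \<rho> h1 where \<rho>: "\<rho> > 0" and h1: "h1 > 0" "h1 \<le> t" "h1 \<le> 1 - t"
      and far: "\<And>s. \<bar>s - t\<bar> \<le> h1 \<Longrightarrow> \<rho> \<le> cmod (fst (Z s)) \<and> \<rho> \<le> cmod (fst (Z s) / 2 + snd (Z s)) \<and> \<rho> \<le> cmod (fst (Z s) / 2 - snd (Z s))"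
      using eventually_distances_ge[OF t cf] by metis
    have "\<bar>t - t\<bar> \<le> h1" using h1 by simp
    from far[OF this] F[OF zq \<rho>] obtain k where k: "k > 0" "force m V (Z t) \<le> m * k * (p (Z t) * (u (Z t) * p (Z t) - w (Z t)))"
      by blast
    have "p (Z t) * w (Z t) > 0" using nn[OF zq] ne by (simp add: less_le)
    then have "0 < m * k * (p (Z t) * w (Z t))" using m k by simp
    then have neg: "force m V (Z t) < 0" using k(2) z[OF t] by simp
    have "isCont (\<lambda>s. force m V (Z s)) t"
      unfolding force_def using cf unfolding collision_free_def
      by (intro continuous_intros isCont_interior t) auto
    then have "((\<lambda>s. force m V (Z s)) \<longlongrightarrow> force m V (Z t)) (nhds t)"
      using tendsto_at_iff_tendsto_nhds[of "\<lambda>s. force m V (Z s)" t] by (simp add: isCont_def)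
    then have "eventually (\<lambda>s. force m V (Z s) < force m V (Z t) / 2) (nhds t)"
      using neg by (intro order_tendstoD) auto
    then obtain e where e: "e > 0" "\<And>s. dist s t < e \<Longrightarrow> force m V (Z s) < force m V (Z t) / 2"
      unfolding eventually_nhds_metric by blast
    define h where "h = min (min e h1) (min t (1 - t)) / 2"
    have "0 < min (min e h1) (min t (1 - t))" using e(1) h1 t by simp
    moreover have "min (min e h1) (min t (1 - t)) \<le> e" "min (min e h1) (min t (1 - t)) \<le> h1"
      "min (min e h1) (min t (1 - t)) \<le> t" "min (min e h1) (min t (1 - t)) \<le> 1 - t" by auto
    ultimately have h: "h > 0" "h \<le> h1" "h < e" "h < t" "h < 1 - t"
      unfolding h_def by linarith+
    obtain J where J: "0 < J" "2 / h * kinetic_inner m (Z (t - h) + Z (t + h) - 2 *\<^sub>R Z t) V \<le> J * (force m V (Z t) / 2)"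
    proof -
      have "force m V (Z s) \<le> force m V (Z t) / 2" if "\<bar>s - t\<bar> \<le> h" for s
        using e(2)[of s] that h by (simp add: dist_real_def)
      moreover have "0 \<le> t - h" "t + h \<le> 1" using h by auto
      moreover have "\<bar>s - t\<bar> \<le> h1" if "\<bar>s - t\<bar> \<le> h" for s using that h by simp
      ultimately show thesis
        using first_variation[OF h(1) _ _ \<rho>, of t V "force m V (Z t) / 2"] far that by blast
    qed
    \<comment> \<open>Since \<open>u\<close> vanishes identically, its second difference cannot
      balance a strictly negative force.\<close>
    have "kinetic_inner m (Z (t - h) + Z (t + h) - 2 *\<^sub>R Z t) V = 0"
      unfolding \<kappa>(2) using z[of "t - h"] z[of "t + h"] z[OF t] h by (simp add: u.add u.diff u.scaleR)
    with J neg show False by (simp add: zero_le_mult_iff)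
  qed
qed

text \<open>The partners are \<open>x\<close> with \<open>p\<close> and \<open>y\<close> with
  \<open>q\<close>, as in the inner product \<open>y * q - x * p\<close>. The vanishing product
  serves to transfer a zero: when two of its factors are positive, the third one vanishes.\<close>

lemma coordinates_vanish:
  assumes Q: "\<And>t. t \<in> {0..1} \<Longrightarrow> Z t \<in> quadrants"
    and c: "0 < c" "c < 1" and t: "0 < t" "t < 1"
  defines "x \<equiv> \<lambda>z::complex \<times> complex. Re (fst z)" and "y \<equiv> \<lambda>z::complex \<times> complex. Im (fst z)"
    and "p \<equiv> \<lambda>z::complex \<times> complex. - Re (snd z)" and "q \<equiv> \<lambda>z::complex \<times> complex. Im (snd z)"
  shows "x (Z c) = 0 \<Longrightarrow> x (Z t) = 0 \<and> p (Z t) * (y (Z t) * q (Z t)) = 0"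
    and "y (Z c) = 0 \<Longrightarrow> y (Z t) = 0 \<and> q (Z t) * (x (Z t) * p (Z t)) = 0"
    and "p (Z c) = 0 \<Longrightarrow> p (Z t) = 0 \<and> x (Z t) * (y (Z t) * q (Z t)) = 0"
    and "q (Z c) = 0 \<Longrightarrow> q (Z t) = 0 \<and> y (Z t) * (x (Z t) * p (Z t)) = 0"
proof -
  have lin: "bounded_linear x" "bounded_linear y" "bounded_linear p" "bounded_linear q"
    unfolding x_def y_def p_def q_def
    by (intro bounded_linear_minus bounded_linear_compose[OF bounded_linear_Re] bounded_linear_compose[OF bounded_linear_Im]
        bounded_linear_fst bounded_linear_snd)+
  have con: "continuous_on UNIV x" "continuous_on UNIV y" "continuous_on UNIV p" "continuous_on UNIV q"
    using lin by (auto intro: linear_continuous_on)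
  have nn: "0 \<le> x z" "0 \<le> y z" "0 \<le> p z" "0 \<le> q z" if "z \<in> quadrants" for z
    using that by (auto simp: quadrants_def x_def y_def p_def q_def)
  note fb = force_bounds[OF m]
  have k: "kinetic_inner m v (1, 0) = (m / 4) * x v" "kinetic_inner m v (\<i>, 0) = (m / 4) * y v"
    "kinetic_inner m v (0, -1) = (m / (2 * m + 1)) * p v" "kinetic_inner m v (0, \<i>) = (m / (2 * m + 1)) * q v" for v
    by (simp_all add: kinetic_inner_def x_def y_def p_def q_def inner_complex_def)
  have kp: "m / 4 > 0" "m / (2 * m + 1) > 0" using m by simp_all
  show "x (Z c) = 0 \<Longrightarrow> x (Z t) = 0 \<and> p (Z t) * (y (Z t) * q (Z t)) = 0"
  proof -
    assume 0: "x (Z c) = 0"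
    have n: "0 \<le> x z \<and> 0 \<le> p z \<and> 0 \<le> y z * q z" if "z \<in> quadrants" for z
      using nn[OF that] by simp
    have F: "\<exists>k>0. k \<le> 2 / \<rho> ^ 5 \<and> force m (1, 0) z \<le> m * k * (p z * (x z * p z - y z * q z))"
      if "z \<in> quadrants" "0 < \<rho>" "\<rho> \<le> cmod (fst z / 2 + snd z)" "\<rho> \<le> cmod (fst z / 2 - snd z)" for z \<rho>
      using fb[OF that] unfolding x_def y_def p_def q_def by blast
    show ?thesis
      using coordinate_vanishes[OF lin(1) con(3) kp(1) k(1) Q n F c 0 t] by blast
  qed
  show "y (Z c) = 0 \<Longrightarrow> y (Z t) = 0 \<and> q (Z t) * (x (Z t) * p (Z t)) = 0"
  proof -
    assume 0: "y (Z c) = 0"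
    have n: "0 \<le> y z \<and> 0 \<le> q z \<and> 0 \<le> x z * p z" if "z \<in> quadrants" for z
      using nn[OF that] by simp
    have F: "\<exists>k>0. k \<le> 2 / \<rho> ^ 5 \<and> force m (\<i>, 0) z \<le> m * k * (q z * (y z * q z - x z * p z))"
      if "z \<in> quadrants" "0 < \<rho>" "\<rho> \<le> cmod (fst z / 2 + snd z)" "\<rho> \<le> cmod (fst z / 2 - snd z)" for z \<rho>
      using fb[OF that] unfolding x_def y_def p_def q_def by blast
    show ?thesis
      using coordinate_vanishes[OF lin(2) con(4) kp(1) k(2) Q n F c 0 t] by blast
  qed
  show "p (Z c) = 0 \<Longrightarrow> p (Z t) = 0 \<and> x (Z t) * (y (Z t) * q (Z t)) = 0"
  proof -
    assume 0: "p (Z c) = 0"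
    have n: "0 \<le> p z \<and> 0 \<le> x z \<and> 0 \<le> y z * q z" if "z \<in> quadrants" for z
      using nn[OF that] by simp
    have F: "\<exists>k>0. k \<le> 2 / \<rho> ^ 5 \<and> force m (0, -1) z \<le> m * k * (x z * (p z * x z - y z * q z))"
      if "z \<in> quadrants" "0 < \<rho>" "\<rho> \<le> cmod (fst z / 2 + snd z)" "\<rho> \<le> cmod (fst z / 2 - snd z)" for z \<rho>
      using fb[OF that] unfolding x_def y_def p_def q_def by blast
    show ?thesis
      using coordinate_vanishes[OF lin(3) con(1) kp(2) k(3) Q n F c 0 t] by blast
  qed
  show "q (Z c) = 0 \<Longrightarrow> q (Z t) = 0 \<and> y (Z t) * (x (Z t) * p (Z t)) = 0"
  proof -
    assume 0: "q (Z c) = 0"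
    have n: "0 \<le> q z \<and> 0 \<le> y z \<and> 0 \<le> x z * p z" if "z \<in> quadrants" for z
      using nn[OF that] by simp
    have F: "\<exists>k>0. k \<le> 2 / \<rho> ^ 5 \<and> force m (0, \<i>) z \<le> m * k * (y z * (q z * y z - x z * p z))"
      if "z \<in> quadrants" "0 < \<rho>" "\<rho> \<le> cmod (fst z / 2 + snd z)" "\<rho> \<le> cmod (fst z / 2 - snd z)" for z \<rho>
      using fb[OF that] unfolding x_def y_def p_def q_def by blast
    show ?thesis
      using coordinate_vanishes[OF lin(4) con(2) kp(2) k(4) Q n F c 0 t] by blast
  qed
qed

end

section \<open>Symmetries and folding\<close>

lemma action_minimizerI:
  assumes "Z \<in> paths (Z 0) (Z 1)" "\<And>W. W \<in> paths (Z 0) (Z 1) \<Longrightarrow> action m Z \<le> action m W"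
  shows "action_minimizer m Z"
  unfolding action_minimizer_def using assms
  by (auto intro!: antisym INF_greatest INF_lower)

text \<open>The inverse \<open>S\<close> carries competitors of the image back to those of
  \<open>Z\<close>. It is applied to rotations and to the reflection of the second Jacobi
  vector.\<close>

lemma action_minimizer_isometry:
  assumes Z: "action_minimizer m Z" and T: "bounded_linear T" and S: "bounded_linear S"
    and ST: "\<And>z. S (T z) = z" "\<And>z. T (S z) = z"
    and K: "\<And>v. kinetic m (T v) = kinetic m v" and U: "\<And>z. potential m (T z) = potential m z"
  shows "action_minimizer m (\<lambda>t. T (Z t))"
proof (rule action_minimizerI)
  have act: "action m (\<lambda>t. T (W t)) = action m W" if "W \<in> H1" for W
  proof -
    obtain g where g: "has_L2_derivative W g" using \<open>W \<in> H1\<close> unfolding H1_def by blast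
    show ?thesis
      unfolding action_eq[OF g] action_eq[OF has_L2_derivative_linear[OF T g]] K U ..
  qed
  have lin: "(\<lambda>t. L (W t)) \<in> H1" if "W \<in> H1" "bounded_linear L" for W and L :: "complex \<times> complex \<Rightarrow> complex \<times> complex"
    using that has_L2_derivative_linear unfolding H1_def by blast
  have ZP: "Z \<in> paths (Z 0) (Z 1)" using Z unfolding action_minimizer_def by blast
  then have ZH: "Z \<in> H1" by (simp add: paths_def)
  show "(\<lambda>t. T (Z t)) \<in> paths (T (Z 0)) (T (Z 1))"
    using lin[OF ZH T] by (simp add: paths_def)
  fix W assume W: "W \<in> paths (T (Z 0)) (T (Z 1))"
  then have SW: "(\<lambda>t. S (W t)) \<in> paths (Z 0) (Z 1)"
    using lin[OF _ S] by (simp add: paths_def ST)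
  have "action m (\<lambda>t. T (Z t)) = action m Z" by (rule act[OF ZH])
  also have "\<dots> \<le> action m (\<lambda>t. S (W t))"
    using Z SW unfolding action_minimizer_def by (metis INF_lower)
  also have "\<dots> = action m (\<lambda>t. T (S (W t)))"
    using SW by (intro act[symmetric]) (simp add: paths_def)
  finally show "action m (\<lambda>t. T (Z t)) \<le> action m W" by (simp add: ST)
qed

text \<open>For a fixed sum of squares, \<open>4 * (r * s)\<^sup>2\<close> is the squared sum minus
  the squared difference of the squares. A smaller difference thus enlarges the product, and the
  square of \<open>1 / r + 1 / s\<close> decreases in the product.\<close>

lemma inverse_sum_le_if_closer:
  fixes r s r' s' :: real
  assumes p: "r > 0" "s > 0" "r' \<ge> 0" "s' \<ge> 0"
    and eq: "r'\<^sup>2 + s'\<^sup>2 = r\<^sup>2 + s\<^sup>2" and le: "\<bar>r'\<^sup>2 - s'\<^sup>2\<bar> \<le> \<bar>r\<^sup>2 - s\<^sup>2\<bar>"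
  shows "r' > 0" "s' > 0" "1 / r' + 1 / s' \<le> 1 / r + 1 / s"
proof -
  have "(r'\<^sup>2 - s'\<^sup>2)\<^sup>2 \<le> (r\<^sup>2 - s\<^sup>2)\<^sup>2" using le by (simp add: abs_le_square_iff)
  moreover have "4 * (r * s)\<^sup>2 = (r\<^sup>2 + s\<^sup>2)\<^sup>2 - (r\<^sup>2 - s\<^sup>2)\<^sup>2" for r s :: real
    by (simp add: power2_eq_square algebra_simps)
  from this[of r s] this[of r' s'] have "4 * (r' * s')\<^sup>2 - 4 * (r * s)\<^sup>2 = (r\<^sup>2 - s\<^sup>2)\<^sup>2 - (r'\<^sup>2 - s'\<^sup>2)\<^sup>2"
    using eq by simp
  ultimately have "(r * s)\<^sup>2 \<le> (r' * s')\<^sup>2" by simp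
  then have P: "r * s \<le> r' * s'" by (rule power2_le_imp_le) (use p in simp)
  have P0: "0 < r * s" using p by simp
  then have P1: "0 < r' * s'" using P by linarith
  then show pos: "r' > 0" "s' > 0" using p by (auto simp: zero_less_mult_iff)
  have sq: "(1 / r + 1 / s)\<^sup>2 = (r\<^sup>2 + s\<^sup>2) * (1 / (r * s)\<^sup>2) + 2 * (1 / (r * s))" if "r > 0" "s > 0" for r s :: real
    using that by (simp add: power2_eq_square field_simps)
  have "(1 / r' + 1 / s')\<^sup>2 \<le> (1 / r + 1 / s)\<^sup>2"
    unfolding sq[OF pos] sq[OF p(1,2)] eq using P P0 P1 p pos
    by (intro add_mono mult_left_mono divide_left_mono power_mono mult_pos_pos zero_less_power) auto
  then show "1 / r' + 1 / s' \<le> 1 / r + 1 / s"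
    by (rule power2_le_imp_le) (use p in simp)
qed

definition fold_quadrants :: "complex \<times> complex \<Rightarrow> complex \<times> complex" where
  "fold_quadrants z = (Complex \<bar>Re (fst z)\<bar> \<bar>Im (fst z)\<bar>, Complex (- \<bar>Re (snd z)\<bar>) \<bar>Im (snd z)\<bar>)"

lemma fold_quadrants_mem: "fold_quadrants z \<in> quadrants"
  by (simp add: fold_quadrants_def quadrants_def)

lemma fold_quadrants_eq: "z \<in> quadrants \<Longrightarrow> fold_quadrants z = z"
  by (auto simp: fold_quadrants_def quadrants_def prod_eq_iff complex_eq_iff)

text \<open>
  The squares of the distances of the first body to the other two have a sum that is invariant
  under folding, and a difference that does not grow.
\<close>

lemma potential_fold_le:
  assumes m: "m > 0"
  shows "potential m (fold_quadrants z) \<le> potential m z"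
proof (cases "collision_free z")
  case False
  then show ?thesis using potential_collision[OF m] by simp
next
  case True
  let ?f = "fold_quadrants z"
  have f0: "cmod (fst ?f) = cmod (fst z)" by (simp add: cmod_def fold_quadrants_def)
  have dist: "(cmod (fst w / 2 + snd w))\<^sup>2 + (cmod (fst w / 2 - snd w))\<^sup>2 = (cmod (fst w))\<^sup>2 / 2 + 2 * (cmod (snd w))\<^sup>2"
    "(cmod (fst w / 2 + snd w))\<^sup>2 - (cmod (fst w / 2 - snd w))\<^sup>2 = 2 * (Re (fst w) * Re (snd w) + Im (fst w) * Im (snd w))" for w
    unfolding cmod_power2 by (simp_all add: power2_eq_square field_simps)
  have "cmod (snd ?f) = cmod (snd z)" by (simp add: cmod_def fold_quadrants_def)
  then have sum: "(cmod (fst ?f / 2 + snd ?f))\<^sup>2 + (cmod (fst ?f / 2 - snd ?f))\<^sup>2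
      = (cmod (fst z / 2 + snd z))\<^sup>2 + (cmod (fst z / 2 - snd z))\<^sup>2"
    unfolding dist f0 by simp
  \<comment> \<open>Folding gives the two products in the inner product opposite signs, so its
    modulus is the least possible for given moduli of the products. This dictates the choice of
    consecutive quadrants.\<close>
  have "\<bar>\<bar>a\<bar> * (- \<bar>b\<bar>) + \<bar>c\<bar> * \<bar>d\<bar>\<bar> \<le> \<bar>a * b + c * d\<bar>" for a b c d :: real
  proof -
    have "\<bar>\<bar>c * d\<bar> - \<bar>a * b\<bar>\<bar> \<le> \<bar>a * b + c * d\<bar>" by linarith
    then show ?thesis by (simp add: abs_mult)
  qed
  then have diff: "\<bar>(cmod (fst ?f / 2 + snd ?f))\<^sup>2 - (cmod (fst ?f / 2 - snd ?f))\<^sup>2\<bar>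
      \<le> \<bar>(cmod (fst z / 2 + snd z))\<^sup>2 - (cmod (fst z / 2 - snd z))\<^sup>2\<bar>"
    unfolding dist abs_mult by (simp add: fold_quadrants_def)
  have pos: "0 < cmod (fst z / 2 + snd z)" "0 < cmod (fst z / 2 - snd z)"
    using True by (auto simp: collision_free_def)
  note I = inverse_sum_le_if_closer[OF pos norm_ge_zero norm_ge_zero sum diff]
  have cf: "collision_free ?f"
    using True f0 I(1,2) unfolding collision_free_def by (metis norm_eq_zero less_irrefl)
  have "m * (1 / cmod (fst ?f / 2 + snd ?f) + 1 / cmod (fst ?f / 2 - snd ?f))
     \<le> m * (1 / cmod (fst z / 2 + snd z) + 1 / cmod (fst z / 2 - snd z))"
    using I(3) m by (intro mult_left_mono) auto
  then have "real_potential m ?f \<le> real_potential m z"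
    unfolding real_potential_def f0 by (simp add: distrib_left)
  then show ?thesis
    unfolding potential_collision_free[OF m cf] potential_collision_free[OF m True] by (rule ennreal_leI)
qed

text \<open>The ends lie in \<open>quadrants\<close> and are fixed by the folding, so the path and
  its folding have the same competitors.\<close>

lemma action_minimizer_fold:
  assumes m: "m > 0" and Z: "action_minimizer m Z" and ends: "Z 0 \<in> quadrants" "Z 1 \<in> quadrants"
  shows "action_minimizer m (\<lambda>t. fold_quadrants (Z t))"
proof (rule action_minimizerI)
  obtain g where g: "has_L2_derivative Z g"
    using Z unfolding action_minimizer_def paths_def H1_def by blast
  have c: "has_L2_derivative (\<lambda>t. \<bar>L (Z t)\<bar> *\<^sub>R V) (\<lambda>t. (sgn (L (Z t)) * L (g t)) *\<^sub>R V)"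
    if "bounded_linear L" for L :: "complex \<times> complex \<Rightarrow> real" and V :: "complex \<times> complex"
    by (rule has_L2_derivative_linear[OF bounded_linear_scaleR_left
          has_L2_derivative_abs[OF has_L2_derivative_linear[OF that g]]])
  have lin: "bounded_linear (\<lambda>z::complex \<times> complex. Re (fst z))" "bounded_linear (\<lambda>z::complex \<times> complex. Im (fst z))"
     "bounded_linear (\<lambda>z::complex \<times> complex. Re (snd z))" "bounded_linear (\<lambda>z::complex \<times> complex. Im (snd z))"
    by (intro bounded_linear_compose[OF bounded_linear_Re] bounded_linear_compose[OF bounded_linear_Im]
        bounded_linear_fst bounded_linear_snd)+
  define h where "h t = (sgn (Re (fst (Z t))) * Re (fst (g t))) *\<^sub>R (1, 0) + (sgn (Im (fst (Z t))) * Im (fst (g t))) *\<^sub>R (\<i>, 0)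
     + (sgn (Re (snd (Z t))) * Re (snd (g t))) *\<^sub>R (0, -1) + (sgn (Im (snd (Z t))) * Im (snd (g t))) *\<^sub>R (0, \<i>)" for t
  have "has_L2_derivative (\<lambda>t. \<bar>Re (fst (Z t))\<bar> *\<^sub>R (1, 0) + \<bar>Im (fst (Z t))\<bar> *\<^sub>R (\<i>, 0)
     + \<bar>Re (snd (Z t))\<bar> *\<^sub>R (0, -1) + \<bar>Im (snd (Z t))\<bar> *\<^sub>R (0, \<i>)) h"
    unfolding h_def[abs_def]
    by (rule has_L2_derivative_add[OF has_L2_derivative_add[OF has_L2_derivative_add[OF
          c[OF lin(1)] c[OF lin(2)]] c[OF lin(3)]] c[OF lin(4)]])
  moreover have "(\<lambda>t. \<bar>Re (fst (Z t))\<bar> *\<^sub>R (1, 0) + \<bar>Im (fst (Z t))\<bar> *\<^sub>R (\<i>, 0)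
     + \<bar>Re (snd (Z t))\<bar> *\<^sub>R (0, -1) + \<bar>Im (snd (Z t))\<bar> *\<^sub>R (0, \<i>)) = (\<lambda>t. fold_quadrants (Z t))"
    by (simp add: fun_eq_iff fold_quadrants_def prod_eq_iff complex_eq_iff)
  ultimately have h: "has_L2_derivative (\<lambda>t. fold_quadrants (Z t)) h" by simp
  show P: "(\<lambda>t. fold_quadrants (Z t)) \<in> paths (fold_quadrants (Z 0)) (fold_quadrants (Z 1))"
    using h unfolding paths_def H1_def by blast
  have K: "kinetic m (h t) \<le> kinetic m (g t)" for t
  proof -
    \<comment> \<open>As \<open>sgn 0 = 0\<close>, the chosen derivative drops the velocity at zeros
      of a coordinate; hence an inequality.\<close>
    have s: "(sgn a * b)\<^sup>2 \<le> b\<^sup>2" for a b :: real by (auto simp: sgn_if)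
    have "kinetic m (h t) = m / 4 * ((sgn (Re (fst (Z t))) * Re (fst (g t)))\<^sup>2 + (sgn (Im (fst (Z t))) * Im (fst (g t)))\<^sup>2)
       + m / (2 * m + 1) * ((sgn (Re (snd (Z t))) * Re (snd (g t)))\<^sup>2 + (sgn (Im (snd (Z t))) * Im (snd (g t)))\<^sup>2)"
      unfolding kinetic_def cmod_power2 by (simp add: h_def)
    also have "\<dots> \<le> kinetic m (g t)"
      unfolding kinetic_def cmod_power2 using m by (intro add_mono mult_left_mono s) auto
    finally show ?thesis .
  qed
  have le: "action m (\<lambda>t. fold_quadrants (Z t)) \<le> action m Z"
    unfolding action_eq[OF h] action_eq[OF g]
    by (intro nn_integral_mono mult_right_mono add_mono ennreal_leI K potential_fold_le[OF m]) auto
  fix W assume "W \<in> paths (fold_quadrants (Z 0)) (fold_quadrants (Z 1))"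
  then have "W \<in> paths (Z 0) (Z 1)" using ends by (simp add: fold_quadrants_eq)
  then have "action m Z \<le> action m W"
    using Z unfolding action_minimizer_def by (metis INF_lower)
  with le show "action m (\<lambda>t. fold_quadrants (Z t)) \<le> action m W" by (rule order_trans)
qed

section \<open>Positivity of the coordinates at interior times\<close>

lemma zero_on_closed_unit_interval:
  fixes f :: "real \<Rightarrow> real"
  assumes "continuous_on {0..1} f" "\<And>t. 0 < t \<Longrightarrow> t < 1 \<Longrightarrow> f t = 0" "t \<in> {0..1}"
  shows "f t = 0"
  by (rule continuous_constant_on_closure[of "{0<..<1}" f]) (use assms in auto)

lemma positive_inside_if_nonvanishing:
  fixes f :: "real \<Rightarrow> real"
  assumes f: "continuous_on {0..1} f" and nz: "\<And>s. 0 < s \<Longrightarrow> s < 1 \<Longrightarrow> f s \<noteq> 0"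
    and ends: "f 0 > 0 \<or> f 1 > 0" and t: "0 < t" "t < 1"
  shows "f t > 0"
proof (rule ccontr)
  assume "\<not> f t > 0"
  then have neg: "f t < 0" using nz[OF t] by simp
  from ends show False
  proof
    assume "f 0 > 0"
    then obtain x where x: "0 \<le> x" "x \<le> t" "f x = 0"
      using IVT2'[of f t 0 0] neg t continuous_on_subset[OF f, of "{0..t}"] by auto
    moreover have "x \<noteq> 0" "x \<noteq> t" using x(3) neg \<open>f 0 > 0\<close> by auto
    ultimately show False using nz[of x] t by auto
  next
    assume "f 1 > 0"
    then obtain x where x: "t \<le> x" "x \<le> 1" "f x = 0"
      using IVT'[of f t 0 1] neg t continuous_on_subset[OF f, of "{t..1}"] by auto
    moreover have "x \<noteq> 1" "x \<noteq> t" using x(3) neg \<open>f 1 > 0\<close> by auto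
    ultimately show False using nz[of x] t by auto
  qed
qed

text \<open>An interior zero of a coordinate of the folded path would spread to the closed interval
  and contradict positivity at one end. The original coordinate has the same zeros, so the
  intermediate value theorem fixes its sign and the original path itself stays in the
  quadrants.\<close>

lemma minimizer_interior_quadrants:
  assumes m: "m > 0" and Z: "action_minimizer m Z" and ends: "Z 0 \<in> quadrants" "Z 1 \<in> quadrants"
    and pos: "Re (fst (Z 0)) > 0 \<or> Re (fst (Z 1)) > 0" "Im (fst (Z 0)) > 0 \<or> Im (fst (Z 1)) > 0"
      "- Re (snd (Z 0)) > 0 \<or> - Re (snd (Z 1)) > 0" "Im (snd (Z 0)) > 0 \<or> Im (snd (Z 1)) > 0"
    and t: "0 < t" "t < 1"
  shows "Re (fst (Z t)) > 0" "Im (fst (Z t)) > 0" "- Re (snd (Z t)) > 0" "Im (snd (Z t)) > 0"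
proof -
  let ?W = "\<lambda>t. fold_quadrants (Z t)"
  obtain g where "finite_minimizer m Z g" using minimizer_finite[OF m Z ends] .
  then interpret Z: finite_minimizer m Z g .
  obtain h where "finite_minimizer m ?W h"
    by (rule minimizer_finite[OF m action_minimizer_fold[OF m Z ends]]) (rule fold_quadrants_mem)+
  then interpret W: finite_minimizer m ?W h .
  have nz: "L (?W s) \<noteq> 0" if L: "continuous_on UNIV L" and ne: "L (Z 0) > 0 \<or> L (Z 1) > 0" and s: "0 < s" "s < 1"
     and van: "\<And>r s. 0 < r \<Longrightarrow> r < 1 \<Longrightarrow> 0 < s \<Longrightarrow> s < 1 \<Longrightarrow> L (?W r) = 0 \<Longrightarrow> L (?W s) = 0"
   for L :: "complex \<times> complex \<Rightarrow> real" and s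
  proof
    assume 0: "L (?W s) = 0"
    have "continuous_on {0..1} (\<lambda>t. L (?W t))"
      by (rule continuous_on_compose2[OF L W.continuous]) auto
    have "L (?W r) = 0" if "r \<in> {0..1}" for r
      by (rule zero_on_closed_unit_interval[OF \<open>continuous_on {0..1} (\<lambda>t. L (?W t))\<close> _ that]) (rule van[OF s _ _ 0])
    from this[of 0] this[of 1] show False using ne ends by (simp add: fold_quadrants_eq)
  qed
  note van = W.coordinates_vanish[OF fold_quadrants_mem]
  have con: "continuous_on UNIV (\<lambda>z::complex \<times> complex. Re (fst z))" "continuous_on UNIV (\<lambda>z::complex \<times> complex. Im (fst z))"
     "continuous_on UNIV (\<lambda>z::complex \<times> complex. - Re (snd z))" "continuous_on UNIV (\<lambda>z::complex \<times> complex. Im (snd z))"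
    by (intro continuous_intros)+
  have conZ: "continuous_on {0..1} (\<lambda>t. L (Z t))" if "continuous_on UNIV L" for L :: "complex \<times> complex \<Rightarrow> real"
    by (rule continuous_on_compose2[OF that Z.continuous]) auto
  have "Re (fst (Z s)) \<noteq> 0" if s: "0 < s" "s < 1" for s
  proof -
    have "Re (fst (?W s)) \<noteq> 0"
    proof (rule nz[OF con(1) pos(1) s])
      fix r s :: real assume *: "0 < r" "r < 1" "0 < s" "s < 1" "Re (fst (?W r)) = 0"
      show "Re (fst (?W s)) = 0" by (rule van(1)[OF *, THEN conjunct1])
    qed
    then show ?thesis by (simp add: fold_quadrants_def)
  qed
  then show "Re (fst (Z t)) > 0"
    by (rule positive_inside_if_nonvanishing[OF conZ[OF con(1)] _ pos(1) t])
  have "Im (fst (Z s)) \<noteq> 0" if s: "0 < s" "s < 1" for s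
  proof -
    have "Im (fst (?W s)) \<noteq> 0"
    proof (rule nz[OF con(2) pos(2) s])
      fix r s :: real assume *: "0 < r" "r < 1" "0 < s" "s < 1" "Im (fst (?W r)) = 0"
      show "Im (fst (?W s)) = 0" by (rule van(2)[OF *, THEN conjunct1])
    qed
    then show ?thesis by (simp add: fold_quadrants_def)
  qed
  then show "Im (fst (Z t)) > 0"
    by (rule positive_inside_if_nonvanishing[OF conZ[OF con(2)] _ pos(2) t])
  have "- Re (snd (Z s)) \<noteq> 0" if s: "0 < s" "s < 1" for s
  proof -
    have "- Re (snd (?W s)) \<noteq> 0"
    proof (rule nz[OF con(3) pos(3) s])
      fix r s :: real assume *: "0 < r" "r < 1" "0 < s" "s < 1" "- Re (snd (?W r)) = 0"
      show "- Re (snd (?W s)) = 0" by (rule van(3)[OF *, THEN conjunct1])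
    qed
    then show ?thesis by (simp add: fold_quadrants_def)
  qed
  then show "- Re (snd (Z t)) > 0"
    by (rule positive_inside_if_nonvanishing[OF conZ[OF con(3)] _ pos(3) t])
  have "Im (snd (Z s)) \<noteq> 0" if s: "0 < s" "s < 1" for s
  proof -
    have "Im (snd (?W s)) \<noteq> 0"
    proof (rule nz[OF con(4) pos(4) s])
      fix r s :: real assume *: "0 < r" "r < 1" "0 < s" "s < 1" "Im (snd (?W r)) = 0"
      show "Im (snd (?W s)) = 0" by (rule van(4)[OF *, THEN conjunct1])
    qed
    then show ?thesis by (simp add: fold_quadrants_def)
  qed
  then show "Im (snd (Z t)) > 0"
    by (rule positive_inside_if_nonvanishing[OF conZ[OF con(4)] _ pos(4) t])
qed

section \<open>Cones\<close>

lemma angular_cone_rotate: "cis c * w \<in> angular_cone (a + c) (b + c) \<longleftrightarrow> w \<in> angular_cone a b"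
  and cone_boundary_rotate: "cis c * w \<in> cone_boundary (a + c) (b + c) \<longleftrightarrow> w \<in> cone_boundary a b"
proof -
  have 1: "cis c * w = complex_of_real r * cis (\<theta> + c) \<longleftrightarrow> w = complex_of_real r * cis \<theta>" for r \<theta>
  proof -
    have "cis c * w = complex_of_real r * cis (\<theta> + c) \<longleftrightarrow> cis c * w = cis c * (complex_of_real r * cis \<theta>)"
      by (simp add: cis_mult[symmetric] mult_ac)
    then show ?thesis by simp
  qed
  have 2: "w = complex_of_real r * cis (\<theta> - c) \<longleftrightarrow> cis c * w = complex_of_real r * cis \<theta>" for r \<theta>
    using 1[of r "\<theta> - c"] by simp
  show "cis c * w \<in> angular_cone (a + c) (b + c) \<longleftrightarrow> w \<in> angular_cone a b"
  proof
    assume "cis c * w \<in> angular_cone (a + c) (b + c)"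
    then obtain r \<theta> where "r \<ge> 0" "\<theta> \<in> {a + c..b + c}" "cis c * w = complex_of_real r * cis \<theta>"
      unfolding angular_cone_def by blast
    then show "w \<in> angular_cone a b"
      unfolding angular_cone_def using 2[of r \<theta>] by (intro CollectI exI[of _ r] exI[of _ "\<theta> - c"]) auto
  next
    assume "w \<in> angular_cone a b"
    then obtain r \<theta> where "r \<ge> 0" "\<theta> \<in> {a..b}" "w = complex_of_real r * cis \<theta>"
      unfolding angular_cone_def by blast
    then show "cis c * w \<in> angular_cone (a + c) (b + c)"
      unfolding angular_cone_def using 1[of r \<theta>] by (intro CollectI exI[of _ r] exI[of _ "\<theta> + c"]) auto
  qed
  show "cis c * w \<in> cone_boundary (a + c) (b + c) \<longleftrightarrow> w \<in> cone_boundary a b"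
  proof
    assume "cis c * w \<in> cone_boundary (a + c) (b + c)"
    then obtain r \<theta> where "r \<ge> 0" "\<theta> \<in> {a + c, b + c}" "cis c * w = complex_of_real r * cis \<theta>"
      unfolding cone_boundary_def by blast
    then show "w \<in> cone_boundary a b"
      unfolding cone_boundary_def using 2[of r \<theta>] by (intro CollectI exI[of _ r] exI[of _ "\<theta> - c"]) auto
  next
    assume "w \<in> cone_boundary a b"
    then obtain r \<theta> where "r \<ge> 0" "\<theta> \<in> {a, b}" "w = complex_of_real r * cis \<theta>"
      unfolding cone_boundary_def by blast
    then show "cis c * w \<in> cone_boundary (a + c) (b + c)"
      unfolding cone_boundary_def using 1[of r \<theta>] by (intro CollectI exI[of _ r] exI[of _ "\<theta> + c"]) auto
  qed
qed

lemma rotate_polar: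
  "Re (cis c * (complex_of_real r * cis \<theta>)) = r * cos (\<theta> + c)"
  "Im (cis c * (complex_of_real r * cis \<theta>)) = r * sin (\<theta> + c)"
proof -
  have e: "cis c * (complex_of_real r * cis \<theta>) = complex_of_real r * cis (\<theta> + c)"
    by (simp add: cis_mult[symmetric] mult_ac)
  show "Re (cis c * (complex_of_real r * cis \<theta>)) = r * cos (\<theta> + c)"
    "Im (cis c * (complex_of_real r * cis \<theta>)) = r * sin (\<theta> + c)"
    unfolding e by simp_all
qed

text \<open>The rotated cone has its angles between \<open>\<delta>\<close> and
  \<open>b - a + \<delta>\<close>, strictly between 0 and \<open>pi / 2\<close>.\<close>

lemma angular_cone_interior_rotation:
  assumes ab: "0 \<le> b - a" "b - a < pi / 2" and z: "z \<in> angular_cone a b"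
    and \<delta>: "0 < \<delta>" "\<delta> < pi / 2 - (b - a)"
  shows "0 \<le> Re (cis (\<delta> - a) * z)" "0 \<le> Im (cis (\<delta> - a) * z)"
    and "z \<noteq> 0 \<Longrightarrow> 0 < Re (cis (\<delta> - a) * z)" "z \<noteq> 0 \<Longrightarrow> 0 < Im (cis (\<delta> - a) * z)"
proof -
  obtain r \<theta> where r: "r \<ge> 0" "\<theta> \<in> {a..b}" and zr: "z = complex_of_real r * cis \<theta>"
    using z unfolding angular_cone_def by blast
  have p: "0 < cos (\<theta> + (\<delta> - a))" "0 < sin (\<theta> + (\<delta> - a))"
    using r ab \<delta> pi_gt_zero by (auto intro!: cos_gt_zero_pi sin_gt_zero)
  show "0 \<le> Re (cis (\<delta> - a) * z)" "0 \<le> Im (cis (\<delta> - a) * z)"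
    unfolding zr rotate_polar using r p by auto
  assume "z \<noteq> 0"
  then have "r > 0" using r zr by (auto simp: less_le)
  then show "0 < Re (cis (\<delta> - a) * z)" "0 < Im (cis (\<delta> - a) * z)"
    unfolding zr rotate_polar using p by auto
qed

text \<open>The rotations by \<open>- a\<close> and \<open>- b\<close> each move one extreme ray to
  the positive real axis; the cone is too narrow to meet that axis anywhere else.\<close>

lemma angular_cone_halfplanes:
  assumes ab: "0 \<le> b - a" "b - a < pi / 2" and z: "z \<in> angular_cone a b"
  shows "0 \<le> Re (cis (- a) * z)" "0 \<le> Im (cis (- a) * z)" "0 \<le> Re (cis (- b) * z)" "Im (cis (- b) * z) \<le> 0"
    and "z \<noteq> 0 \<Longrightarrow> 0 < Re (cis (- a) * z)" "z \<noteq> 0 \<Longrightarrow> 0 < Re (cis (- b) * z)"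
    and "z \<in> cone_boundary a b \<longleftrightarrow> Im (cis (- a) * z) = 0 \<or> Im (cis (- b) * z) = 0"
proof -
  obtain r \<theta> where r: "r \<ge> 0" "\<theta> \<in> {a..b}" and zr: "z = complex_of_real r * cis \<theta>"
    using z unfolding angular_cone_def by blast
  have p: "0 < cos (\<theta> + - a)" "0 \<le> sin (\<theta> + - a)" "0 < cos (\<theta> + - b)"
    using r ab pi_gt_zero by (auto intro!: cos_gt_zero_pi sin_ge_zero)
  have "0 \<le> sin (b - \<theta>)" using r ab pi_gt_zero by (intro sin_ge_zero) auto
  then have p': "sin (\<theta> + - b) \<le> 0" using sin_minus[of "b - \<theta>"] by simp
  show "0 \<le> Re (cis (- a) * z)" "0 \<le> Im (cis (- a) * z)" "0 \<le> Re (cis (- b) * z)" "Im (cis (- b) * z) \<le> 0"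
    unfolding zr rotate_polar using r p p' by (auto simp: mult_nonneg_nonpos)
  show "z \<noteq> 0 \<Longrightarrow> 0 < Re (cis (- a) * z)" "z \<noteq> 0 \<Longrightarrow> 0 < Re (cis (- b) * z)"
    unfolding zr rotate_polar using r p by auto
  show "z \<in> cone_boundary a b \<longleftrightarrow> Im (cis (- a) * z) = 0 \<or> Im (cis (- b) * z) = 0"
  proof
    assume "z \<in> cone_boundary a b"
    then obtain s \<phi> where s: "\<phi> \<in> {a, b}" "z = complex_of_real s * cis \<phi>"
      unfolding cone_boundary_def by blast
    show "Im (cis (- a) * z) = 0 \<or> Im (cis (- b) * z) = 0"
      unfolding s(2) rotate_polar using s(1) by auto
  next
    assume *: "Im (cis (- a) * z) = 0 \<or> Im (cis (- b) * z) = 0"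
    have "r = 0 \<or> \<theta> = a \<or> \<theta> = b"
    proof (rule ccontr)
      assume "\<not> (r = 0 \<or> \<theta> = a \<or> \<theta> = b)"
      then have n: "r \<noteq> 0" "a < \<theta>" "\<theta> < b" using r by auto
      have "0 < sin (\<theta> + - a)" using n ab pi_gt_zero by (intro sin_gt_zero) auto
      moreover have "0 < sin (b - \<theta>)" using n ab pi_gt_zero by (intro sin_gt_zero) auto
      then have "sin (\<theta> + - b) < 0" using sin_minus[of "b - \<theta>"] by simp
      ultimately show False using * n(1) unfolding zr rotate_polar by auto
    qed
    then show "z \<in> cone_boundary a b"
      unfolding cone_boundary_def zr using r
      \<comment> \<open>At the origin the angle \<open>\<theta>\<close> is arbitrary, so
        \<open>a\<close> is substituted to reach an extreme ray.\<close>
      by (intro CollectI exI[of _ r] exI[of _ "if r = 0 then a else \<theta>"]) auto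
  qed
qed

lemma angular_coneI:
  assumes ab: "0 \<le> b - a" "b - a < pi / 2"
    and z: "0 \<le> Re (cis (- a) * z)" "0 \<le> Im (cis (- a) * z)" "Im (cis (- b) * z) \<le> 0"
  shows "z \<in> angular_cone a b"
proof (cases "z = 0")
  case True
  then show ?thesis unfolding angular_cone_def using ab by (intro CollectI exI[of _ 0] exI[of _ a]) auto
next
  case False
  define r where "r = cmod z"
  have r: "r > 0" using False by (simp add: r_def)
  have "cmod (cis (- a) * z) = r" by (simp add: norm_mult r_def)
  then have "(Re (cis (- a) * z))\<^sup>2 + (Im (cis (- a) * z))\<^sup>2 = r\<^sup>2" using cmod_power2 by metis
  then have "(Re (cis (- a) * z) / r)\<^sup>2 + (Im (cis (- a) * z) / r)\<^sup>2 = 1"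
    using r by (simp add: power_divide add_divide_distrib[symmetric])
  then obtain \<phi> where \<phi>: "0 \<le> \<phi>" "\<phi> \<le> pi / 2" "Re (cis (- a) * z) / r = cos \<phi>" "Im (cis (- a) * z) / r = sin \<phi>"
    using sincos_total_pi_half[of "Re (cis (- a) * z) / r" "Im (cis (- a) * z) / r"] z r by auto
  have "cis (- a) * z = complex_of_real r * cis \<phi>"
    using \<phi>(3,4) r by (simp add: complex_eq_iff field_simps)
  then have "cis a * (cis (- a) * z) = cis a * (complex_of_real r * cis \<phi>)" by simp
  moreover have "cis a * (cis (- a) * z) = z" by (simp add: cis_mult mult.assoc[symmetric])
  moreover have "cis a * (complex_of_real r * cis \<phi>) = complex_of_real r * cis (\<phi> + a)"
    by (simp add: cis_mult[symmetric] mult_ac)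
  ultimately have zr: "z = complex_of_real r * cis (\<phi> + a)" by simp
  have "r * sin (\<phi> + a + - b) \<le> 0" using z(3) unfolding zr rotate_polar .
  then have "sin (\<phi> + a + - b) \<le> 0" using r by (simp add: mult_le_0_iff)
  moreover have "\<phi> + a + - b < pi" using \<phi> ab pi_gt_zero by linarith
  ultimately have "\<phi> + a + - b \<le> 0" using sin_gt_zero[of "\<phi> + a + - b"] by linarith
  then show ?thesis
    unfolding angular_cone_def zr using r \<phi> by (intro CollectI exI[of _ r] exI[of _ "\<phi> + a"]) auto
qed

text \<open>The quadrant conditions survive as weak inequalities at both ends of the range of
  \<open>\<delta>\<close> and become there the half-planes that bound the cone. A single
  \<open>\<delta>\<close> inside the range already excludes the origin.\<close>

lemma angular_coneI_rotations:
  assumes ab: "0 \<le> b - a" "b - a < pi / 2"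
    and z: "\<And>\<delta>. 0 < \<delta> \<Longrightarrow> \<delta> < pi / 2 - (b - a) \<Longrightarrow> 0 < Re (cis (\<delta> - a) * z) \<and> 0 < Im (cis (\<delta> - a) * z)"
  shows "z \<in> angular_cone a b" "z \<noteq> 0"
proof -
  define d where "d = pi / 2 - (b - a)"
  have d: "d > 0" using ab by (simp add: d_def)
  show "z \<noteq> 0" using z[of "d / 2"] d by (auto simp: d_def)
  have t: "(f \<longlongrightarrow> f x) (at x within S)" if "continuous_on UNIV f" for f :: "real \<Rightarrow> real" and x S
    by (rule tendsto_within_subset[OF _ subset_UNIV]) (use that in \<open>simp add: continuous_on_def\<close>)
  have c: "continuous_on UNIV (\<lambda>\<delta>. Re (cis (\<delta> - a) * z))" "continuous_on UNIV (\<lambda>\<delta>. Im (cis (\<delta> - a) * z))"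
    by (intro continuous_intros)+
  note t0 = t[OF c(1), of 0 "{0<..}"] t[OF c(2), of 0 "{0<..}"] t[OF c(1), of d "{..<d}"]
  have e: "eventually (\<lambda>\<delta>. 0 < \<delta> \<and> \<delta> < d) (at_right 0)" "eventually (\<lambda>\<delta>. 0 < \<delta> \<and> \<delta> < d) (at_left d)"
    using d by (auto simp: eventually_at_right_field eventually_at_left_field)
  have "0 \<le> Re (cis (0 - a) * z)"
    by (rule tendsto_lowerbound[OF t0(1) eventually_mono[OF e(1)]])
       (use z in \<open>simp_all add: d_def less_imp_le\<close>)
  moreover have "0 \<le> Im (cis (0 - a) * z)"
    by (rule tendsto_lowerbound[OF t0(2) eventually_mono[OF e(1)]])
       (use z in \<open>simp_all add: d_def less_imp_le\<close>)
  moreover have "0 \<le> Re (cis (d - a) * z)"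
    by (rule tendsto_lowerbound[OF t0(3) eventually_mono[OF e(2)]])
       (use z in \<open>simp_all add: d_def less_imp_le\<close>)
  \<comment> \<open>At the upper end the condition on the real part thus turns into the one on the
    imaginary part at the ray \<open>b\<close>.\<close>
  moreover have "cis (d - a) * z = \<i> * (cis (- b) * z)"
  proof -
    have "cis (d - a) = cis (pi / 2) * cis (- b)" unfolding cis_mult by (simp add: d_def algebra_simps)
    then show ?thesis by simp
  qed
  ultimately show "z \<in> angular_cone a b" by (intro angular_coneI ab) simp_all
qed

section \<open>Minimizers between cones\<close>

lemma action_minimizer_rotate:
  assumes "action_minimizer m (\<lambda>t. (Z1 t, Z2 t))"
  shows "action_minimizer m (\<lambda>t. (cis c * Z1 t, cis c * Z2 t))"
proof -
  let ?T = "\<lambda>c z::complex \<times> complex. (cis c * fst z, cis c * snd z)"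
  have L: "bounded_linear (?T c)" for c
    by (intro bounded_linear_Pair bounded_linear_compose[OF bounded_linear_mult_right] bounded_linear_fst bounded_linear_snd)
  have "cis (- c) * (cis c * w) = w" "cis c * (cis (- c) * w) = w" for w
    by (simp_all add: cis_mult mult.assoc[symmetric])
  moreover have "potential m (?T c z) = potential m z" for z
  proof -
    have "cis c * fst z / 2 + cis c * snd z = cis c * (fst z / 2 + snd z)"
      "cis c * fst z / 2 - cis c * snd z = cis c * (fst z / 2 - snd z)" by (simp_all add: algebra_simps)
    then show ?thesis unfolding potential_def fst_conv snd_conv by (simp only: norm_mult norm_cis mult_1)
  qed
  moreover have "kinetic m (?T c z) = kinetic m z" for z by (simp add: kinetic_def norm_mult)
  ultimately have "action_minimizer m (\<lambda>t. ?T c (Z1 t, Z2 t))"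
    by (intro action_minimizer_isometry[where T = "?T c" and S = "?T (- c)", OF assms L L]) auto
  then show ?thesis by simp
qed

text \<open>Here \<open>W = - \<i> Z2\<close>, so that both paths live in the same cone.\<close>

lemma minimizer_in_cones:
  fixes m a b :: real and Z1 W :: "real \<Rightarrow> complex"
  assumes m: "m > 0" and ab: "0 \<le> b - a" "b - a < pi / 2"
    and e1: "Z1 0 \<in> angular_cone a b" "Z1 1 \<in> angular_cone a b"
    and e2: "W 0 \<in> angular_cone a b" "W 1 \<in> angular_cone a b"
    and n1: "Z1 0 \<noteq> 0 \<or> Z1 1 \<noteq> 0" and n2: "W 0 \<noteq> 0 \<or> W 1 \<noteq> 0"
    and min: "action_minimizer m (\<lambda>t. (Z1 t, \<i> * W t))"
  shows "\<forall>t\<in>{0..1}. Z1 t \<in> angular_cone a b \<and> W t \<in> angular_cone a b"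
    and "(\<forall>t\<in>{0<..<1}. Z1 t \<notin> cone_boundary a b \<and> W t \<notin> cone_boundary a b) \<or>
         (\<forall>t\<in>{0..1}. Z1 t \<in> cone_boundary a b \<and> W t \<in> cone_boundary a b)"
    and "\<forall>t\<in>{0<..<1}. Z1 t \<noteq> 0 \<and> W t \<noteq> 0"
proof -
  have coord: "Re (cis c * (\<i> * w)) = - Im (cis c * w)" "Im (cis c * (\<i> * w)) = Re (cis c * w)" for c w
    by simp_all
  note rot = action_minimizer_rotate[OF min]
  have inside: "0 < Re (cis (\<delta> - a) * Z1 t) \<and> 0 < Im (cis (\<delta> - a) * Z1 t) \<and>
       0 < Re (cis (\<delta> - a) * W t) \<and> 0 < Im (cis (\<delta> - a) * W t)"
    if t: "0 < t" "t < 1" and \<delta>: "0 < \<delta>" "\<delta> < pi / 2 - (b - a)" for t \<delta>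
  proof -
    note I = angular_cone_interior_rotation[OF ab _ \<delta>]
    let ?Z = "\<lambda>t. (cis (\<delta> - a) * Z1 t, cis (\<delta> - a) * (\<i> * W t))"
    have q: "?Z 0 \<in> quadrants" "?Z 1 \<in> quadrants"
      unfolding quadrants_def mem_Collect_eq fst_conv snd_conv coord
      using I(1,2)[OF e1(1)] I(1,2)[OF e1(2)] I(1,2)[OF e2(1)] I(1,2)[OF e2(2)] by auto
    have p: "0 < Re (fst (?Z 0)) \<or> 0 < Re (fst (?Z 1))" "0 < Im (fst (?Z 0)) \<or> 0 < Im (fst (?Z 1))"
      "0 < - Re (snd (?Z 0)) \<or> 0 < - Re (snd (?Z 1))" "0 < Im (snd (?Z 0)) \<or> 0 < Im (snd (?Z 1))"
      unfolding fst_conv snd_conv coord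
      using n1 n2 I(3,4)[OF e1(1)] I(3,4)[OF e1(2)] I(3,4)[OF e2(1)] I(3,4)[OF e2(2)] by auto
    show ?thesis
      using minimizer_interior_quadrants[OF m rot q p t] unfolding fst_conv snd_conv coord by auto
  qed
  have cone: "Z1 t \<in> angular_cone a b" "W t \<in> angular_cone a b" "Z1 t \<noteq> 0" "W t \<noteq> 0" if t: "0 < t" "t < 1" for t
  proof -
    show "Z1 t \<in> angular_cone a b" by (rule angular_coneI_rotations(1)[OF ab]) (use inside[OF t] in blast)
    show "W t \<in> angular_cone a b" by (rule angular_coneI_rotations(1)[OF ab]) (use inside[OF t] in blast)
    show "Z1 t \<noteq> 0" by (rule angular_coneI_rotations(2)[OF ab]) (use inside[OF t] in blast)
    show "W t \<noteq> 0" by (rule angular_coneI_rotations(2)[OF ab]) (use inside[OF t] in blast)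
  qed
  then show "\<forall>t\<in>{0<..<1}. Z1 t \<noteq> 0 \<and> W t \<noteq> 0" by auto
  have cone': "Z1 t \<in> angular_cone a b" "W t \<in> angular_cone a b" if "t \<in> {0..1}" for t
  proof -
    have "t = 0 \<or> t = 1 \<or> 0 < t \<and> t < 1" using that by auto
    then show "Z1 t \<in> angular_cone a b" "W t \<in> angular_cone a b" using cone e1 e2 by blast+
  qed
  then show "\<forall>t\<in>{0..1}. Z1 t \<in> angular_cone a b \<and> W t \<in> angular_cone a b" by blast
  note H1 = angular_cone_halfplanes[OF ab cone'(1)] and H2 = angular_cone_halfplanes[OF ab cone'(2)]
  \<comment> \<open>The ray \<open>b\<close> is moved to the imaginary axis, not to the real one,
    because the cone must land in the first quadrant.\<close>
  have halfpi: "cis (pi / 2 - b) * w = \<i> * (cis (- b) * w)" for w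
  proof -
    have "cis (pi / 2 - b) = cis (pi / 2) * cis (- b)" unfolding cis_mult by simp
    then show ?thesis by simp
  qed
  have cont: "continuous_on {0..1} (\<lambda>t. Im (cis c * Z1 t))" "continuous_on {0..1} (\<lambda>t. Im (cis c * W t))" for c
  proof -
    obtain g where "has_L2_derivative (\<lambda>t. (Z1 t, \<i> * W t)) g"
      using min unfolding action_minimizer_def paths_def H1_def by blast
    then have C: "continuous_on {0..1} (\<lambda>t. (Z1 t, \<i> * W t))" by (rule has_L2_derivative_continuous)
    have "continuous_on {0..1} (\<lambda>t. Im (cis c * fst (Z1 t, \<i> * W t)))"
      by (intro continuous_intros C)
    then show "continuous_on {0..1} (\<lambda>t. Im (cis c * Z1 t))" by simp
    have "continuous_on {0..1} (\<lambda>t. - Re (cis c * snd (Z1 t, \<i> * W t)))"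
      by (intro continuous_intros C)
    then show "continuous_on {0..1} (\<lambda>t. Im (cis c * W t))" by (simp add: algebra_simps)
  qed
  \<comment> \<open>For each of the two extreme rotations, the paths touch the corresponding rays
    together and always, or neither ever does at interior times.\<close>
  have alt: "(\<forall>t\<in>{0<..<1}. Im (cis (- c) * Z1 t) \<noteq> 0 \<and> Im (cis (- c) * W t) \<noteq> 0) \<or>
       (\<forall>t\<in>{0..1}. Im (cis (- c) * Z1 t) = 0 \<and> Im (cis (- c) * W t) = 0)" if c: "c = a \<or> c = b" for c
  proof -
    have "\<forall>t\<in>{0<..<1}. Im (cis (- c) * Z1 t) = 0 \<and> Im (cis (- c) * W t) = 0"
      if s: "0 < s" "s < 1" and 0: "Im (cis (- c) * Z1 s) = 0 \<or> Im (cis (- c) * W s) = 0" for s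
    proof
      fix t :: real assume "t \<in> {0<..<1}"
      then have t: "0 < t" "t < 1" "t \<in> {0..1}" by auto
      have s': "s \<in> {0..1}" using s by simp
      from c show "Im (cis (- c) * Z1 t) = 0 \<and> Im (cis (- c) * W t) = 0"
      proof
        assume c: "c = a"
        let ?Z = "\<lambda>t. (cis (- a) * Z1 t, cis (- a) * (\<i> * W t))"
        have Q: "?Z t \<in> quadrants" if "t \<in> {0..1}" for t
          unfolding quadrants_def mem_Collect_eq fst_conv snd_conv coord using H1(1,2)[OF that] H2(1,2)[OF that] by auto
        obtain g where "finite_minimizer m ?Z g"
          using minimizer_finite[OF m rot Q Q] by force
        then interpret finite_minimizer m ?Z g .
        note van = coordinates_vanish[OF Q s t(1,2), unfolded fst_conv snd_conv coord]
        have "0 < Re (cis (- a) * Z1 t)" "0 < Re (cis (- a) * W t)"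
          using H1(5)[OF t(3)] H2(5)[OF t(3)] cone[OF t(1,2)] by auto
        \<comment> \<open>A zero of one imaginary part spreads in time, and in the accompanying
          product the two real parts are positive, which makes the other imaginary part vanish as
          well.\<close>
        then show ?thesis using van(2,3) 0 unfolding c by auto
      next
        assume c: "c = b"
        let ?Z = "\<lambda>t. (cis (pi / 2 - b) * Z1 t, cis (pi / 2 - b) * (\<i> * W t))"
        have coord': "Re (cis (pi / 2 - b) * w) = - Im (cis (- b) * w)" "Im (cis (pi / 2 - b) * w) = Re (cis (- b) * w)" for w
          unfolding halfpi by simp_all
        have Q: "?Z t \<in> quadrants" if "t \<in> {0..1}" for t
          unfolding quadrants_def mem_Collect_eq fst_conv snd_conv coord coord' using H1(3,4)[OF that] H2(3,4)[OF that] by auto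
        obtain g where "finite_minimizer m ?Z g"
          using minimizer_finite[OF m rot Q Q] by force
        then interpret finite_minimizer m ?Z g .
        note van = coordinates_vanish[OF Q s t(1,2), unfolded fst_conv snd_conv coord coord']
        have "0 < Re (cis (- b) * Z1 t)" "0 < Re (cis (- b) * W t)"
          using H1(6)[OF t(3)] H2(6)[OF t(3)] cone[OF t(1,2)] by auto
        then show ?thesis using van(1,4) 0 unfolding c by auto
      qed
    qed
    then show ?thesis
      using zero_on_closed_unit_interval[OF cont(1)[of "- c"]] zero_on_closed_unit_interval[OF cont(2)[of "- c"]]
      by (meson greaterThanLessThan_iff)
  qed
  show "(\<forall>t\<in>{0<..<1}. Z1 t \<notin> cone_boundary a b \<and> W t \<notin> cone_boundary a b) \<or>
         (\<forall>t\<in>{0..1}. Z1 t \<in> cone_boundary a b \<and> W t \<in> cone_boundary a b)"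
    \<comment> \<open>Being off the boundary means the first alternative for both \<open>a\<close>
      and \<open>b\<close>; otherwise one extreme ray of each cone carries its path
      throughout.\<close>
    using alt[of a] alt[of b] H1(7) H2(7) by force
qed

theorem corollary1p2:
  fixes m a b :: real and Z1 Z2 :: "real \<Rightarrow> complex"
  assumes "m > 0"
    and "0 \<le> b - a" and "b - a < pi / 2"
    and "Z1 0 \<in> angular_cone a b" and "Z1 1 \<in> angular_cone a b"
    and "cmod (Z1 0) + cmod (Z1 1) \<noteq> 0"
    and "cmod (Z2 0) + cmod (Z2 1) \<noteq> 0"
    and "action_minimizer m (\<lambda>t. (Z1 t, Z2 t))"
  shows
    "(Z2 0 \<in> cone_plus a b \<and> Z2 1 \<in> cone_plus a b \<longrightarrow>
        (\<forall>t\<in>{0..1}. Z1 t \<in> angular_cone a b \<and> Z2 t \<in> cone_plus a b) \<and>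
        ((\<forall>t\<in>{0<..<1}. Z1 t \<notin> cone_boundary a b \<and> Z2 t \<notin> cone_plus_boundary a b) \<or>
         (\<forall>t\<in>{0..1}. Z1 t \<in> cone_boundary a b \<and> Z2 t \<in> cone_plus_boundary a b) \<and>
         (\<forall>t\<in>{0<..<1}. Z1 t \<noteq> 0 \<and> Z2 t \<noteq> 0)))
     \<and>
     (Z2 0 \<in> cone_minus a b \<and> Z2 1 \<in> cone_minus a b \<longrightarrow>
        (\<forall>t\<in>{0..1}. Z1 t \<in> angular_cone a b \<and> Z2 t \<in> cone_minus a b) \<and>
        ((\<forall>t\<in>{0<..<1}. Z1 t \<notin> cone_boundary a b \<and> Z2 t \<notin> cone_minus_boundary a b) \<or>
         (\<forall>t\<in>{0..1}. Z1 t \<in> cone_boundary a b \<and> Z2 t \<in> cone_minus_boundary a b) \<and>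
         (\<forall>t\<in>{0<..<1}. Z1 t \<noteq> 0 \<and> Z2 t \<noteq> 0)))"
proof (intro conjI impI)
  have n1: "Z1 0 \<noteq> 0 \<or> Z1 1 \<noteq> 0" using assms(6) by auto
  have main: "(\<forall>t\<in>{0..1}. Z1 t \<in> angular_cone a b \<and> W t \<in> angular_cone a b) \<and>
        ((\<forall>t\<in>{0<..<1}. Z1 t \<notin> cone_boundary a b \<and> W t \<notin> cone_boundary a b) \<or>
         (\<forall>t\<in>{0..1}. Z1 t \<in> cone_boundary a b \<and> W t \<in> cone_boundary a b) \<and>
         (\<forall>t\<in>{0<..<1}. Z1 t \<noteq> 0 \<and> W t \<noteq> 0))"
    if "W 0 \<in> angular_cone a b" "W 1 \<in> angular_cone a b" "W 0 \<noteq> 0 \<or> W 1 \<noteq> 0"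
      "action_minimizer m (\<lambda>t. (Z1 t, \<i> * W t))" for W
    using minimizer_in_cones[OF assms(1-5) that(1,2) n1 that(3,4)] by blast
  {
    assume *: "Z2 0 \<in> cone_plus a b \<and> Z2 1 \<in> cone_plus a b"
    have r: "w \<in> cone_plus a b \<longleftrightarrow> - \<i> * w \<in> angular_cone a b"
      "w \<in> cone_plus_boundary a b \<longleftrightarrow> - \<i> * w \<in> cone_boundary a b" for w
      using angular_cone_rotate[of "pi / 2" "- \<i> * w"] cone_boundary_rotate[of "pi / 2" "- \<i> * w"] by simp_all
    have mi: "action_minimizer m (\<lambda>t. (Z1 t, \<i> * (- \<i> * Z2 t)))" using assms(8) by simp
    have "- \<i> * Z2 0 \<noteq> 0 \<or> - \<i> * Z2 1 \<noteq> 0" using assms(7) by auto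
    from main[OF _ _ this mi] *
    have M: "(\<forall>t\<in>{0..1}. Z1 t \<in> angular_cone a b \<and> - \<i> * Z2 t \<in> angular_cone a b) \<and>
        ((\<forall>t\<in>{0<..<1}. Z1 t \<notin> cone_boundary a b \<and> - \<i> * Z2 t \<notin> cone_boundary a b) \<or>
         (\<forall>t\<in>{0..1}. Z1 t \<in> cone_boundary a b \<and> - \<i> * Z2 t \<in> cone_boundary a b) \<and>
         (\<forall>t\<in>{0<..<1}. Z1 t \<noteq> 0 \<and> - \<i> * Z2 t \<noteq> 0))" unfolding r by blast
    show "\<forall>t\<in>{0..1}. Z1 t \<in> angular_cone a b \<and> Z2 t \<in> cone_plus a b" unfolding r using M by blast
    show "(\<forall>t\<in>{0<..<1}. Z1 t \<notin> cone_boundary a b \<and> Z2 t \<notin> cone_plus_boundary a b) \<or>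
         (\<forall>t\<in>{0..1}. Z1 t \<in> cone_boundary a b \<and> Z2 t \<in> cone_plus_boundary a b) \<and>
         (\<forall>t\<in>{0<..<1}. Z1 t \<noteq> 0 \<and> Z2 t \<noteq> 0)" unfolding r using M by auto
  next
    assume *: "Z2 0 \<in> cone_minus a b \<and> Z2 1 \<in> cone_minus a b"
    have r: "w \<in> cone_minus a b \<longleftrightarrow> \<i> * w \<in> angular_cone a b"
      "w \<in> cone_minus_boundary a b \<longleftrightarrow> \<i> * w \<in> cone_boundary a b" for w
      using angular_cone_rotate[of "pi / 2" w "a - pi / 2" "b - pi / 2"]
        cone_boundary_rotate[of "pi / 2" w "a - pi / 2" "b - pi / 2"] by simp_all
    have L: "bounded_linear (\<lambda>z::complex \<times> complex. (fst z, - snd z))"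
      by (intro bounded_linear_Pair bounded_linear_minus bounded_linear_fst bounded_linear_snd)
    \<comment> \<open>Reversing the second Jacobi vector exchanges the distances of the first body
      to the two equal masses, so the action is preserved and the negative cone becomes the positive
      one.\<close>
    have "action_minimizer m (\<lambda>t. (fst (Z1 t, Z2 t), - snd (Z1 t, Z2 t)))"
      by (rule action_minimizer_isometry[OF assms(8) L L]) (simp_all add: kinetic_def potential_def algebra_simps)
    then have mi: "action_minimizer m (\<lambda>t. (Z1 t, \<i> * (\<i> * Z2 t)))" by (simp add: mult.assoc[symmetric])
    have "\<i> * Z2 0 \<noteq> 0 \<or> \<i> * Z2 1 \<noteq> 0" using assms(7) by auto
    from main[OF _ _ this mi] *
    have M: "(\<forall>t\<in>{0..1}. Z1 t \<in> angular_cone a b \<and> \<i> * Z2 t \<in> angular_cone a b) \<and>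
        ((\<forall>t\<in>{0<..<1}. Z1 t \<notin> cone_boundary a b \<and> \<i> * Z2 t \<notin> cone_boundary a b) \<or>
         (\<forall>t\<in>{0..1}. Z1 t \<in> cone_boundary a b \<and> \<i> * Z2 t \<in> cone_boundary a b) \<and>
         (\<forall>t\<in>{0<..<1}. Z1 t \<noteq> 0 \<and> \<i> * Z2 t \<noteq> 0))" unfolding r by blast
    show "\<forall>t\<in>{0..1}. Z1 t \<in> angular_cone a b \<and> Z2 t \<in> cone_minus a b" unfolding r using M by blast
    show "(\<forall>t\<in>{0<..<1}. Z1 t \<notin> cone_boundary a b \<and> Z2 t \<notin> cone_minus_boundary a b) \<or>
         (\<forall>t\<in>{0..1}. Z1 t \<in> cone_boundary a b \<and> Z2 t \<in> cone_minus_boundary a b) \<and>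
         (\<forall>t\<in>{0<..<1}. Z1 t \<noteq> 0 \<and> Z2 t \<noteq> 0)" unfolding r using M by auto
  }
qed

end
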